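(* Let $H\rtimes G$ be a Lie 2-group and let $B\rightrightarrows Y$ be an $(H\rtimes G)$-bundle gerbe over a Lie groupoid $Y^{(1)}\rightrightarrows Y$, with projection $\Pi:B\to Y^{(1)}$, anchor $\rho:B\to G$, groupoid action $\star$ and composition $\circ_\mu$. Then there is a trivial base principal $(H\rtimes G)$-bundle groupoid $G\times B\rightrightarrows G\times Y$ over $Y^{(1)}\rightrightarrows Y$ given by the following structure: (i) for all $(k_1,b_1)\in G\times B$: $\mathbf s(k_1,b_1)=(k_1,\mathbf s(\Pi(b_1)))$ and $\mathbf t(k_1,b_1)=(k_1\,\rho(b_1),\mathbf t(\Pi(b_1)))$; (ii) for $((k_2,b_2),(k_1,b_1))\in (G\times B)\,{}_{\mathbf s}\!\times_{\mathbf t}(G\times B)$: $(k_2,b_2)\circ(k_1,b_1)=(k_1,\,b_2\circ_\mu b_1)$; (iii) for $(h,g)\in H\rtimes G$ and $(k_1,b_1)\in G\times B$, the Lie 2-group action is $(h,g)\cdot(k_1,b_1)=\big(gk_1,\ (C_{\rho(b_1)k_1^{-1}g^{-1}}h^{-1},\,\rho(b_1))\star b_1\big)$; (iv) the identity morphism of an object $(g,y)$ is $(g,\mathbf 1_B(y))$, where $\mathbf 1_B$ is the unit of $B$; (v) the inverse of a morphism $(g,b)$ is $(g\,\rho(b)^{-1},i_B(b))$, where $i_B$ is the inverse map of $B$.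
   Context: A crossed module of Lie groups $(H,G,C,d)$ consists of Lie groups $H,G$, a smooth action $C:g\mapsto C_g$ of $G$ on $H$ by automorphisms and a Lie group homomorphism $d:H\to G$ with $d(C_gh)=g\,d(h)\,g^{-1}$ and $C_{d(h)}h'=hh'h^{-1}$. The associated Lie 2-group $H\rtimes G\rightrightarrows G$ has arrows $H\times G$, $\mathbf s(h,g)=g$, $\mathbf t(h,g)=d(h)g$, composition $(h_2,d(h_1)g_1)\circ(h_1,g_1)=(h_2h_1,g_1)$ and group product $(h_2,g_2)\cdot(h_1,g_1)=(h_2\,C_{g_2}h_1,\,g_2g_1)$. Every Lie 2-group is, up to isomorphism, of this form. A Lie 2-group action of $H\rtimes G\rightrightarrows G$ on a Lie groupoid $P^{(1)}\rightrightarrows P$ consists of (left) Lie group actions of $H\rtimes G$ on $P^{(1)}$ and of $G$ on $P$ such that the action maps form a Lie groupoid morphism from the product groupoid $(H\rtimes G)\times P^{(1)}\rightrightarrows G\times P$ to $P^{(1)}\rightrightarrows P$. A principal $(H\rtimes G)$-bundle groupoid over $Y^{(1)}\rightrightarrows Y$ is a free and proper Lie 2-group action whose quotient groupoid is isomorphic to $Y^{(1)}\rightrightarrows Y$. It has trivial base if the object-level principal bundle is trivial, i.e. $P=G\times Y\to Y$. A (left) action of a Lie groupoid $\Gamma\rightrightarrows\Gamma_0$ on a manifold $B$ is given by a surjective submersion $\rho:B\to\Gamma_0$, called the anchor, and a smooth map $\star:\Gamma\,{}_{\mathbf s}\!\times_\rho B\to B$ with $\rho(\gamma\star b)=\mathbf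 t(\gamma)$ and $\gamma_2\star(\gamma_1\star b)=(\gamma_2\circ\gamma_1)\star b$. A principal $\Gamma$-bundle over a manifold $N$ consists of such an action together with a surjective submersion $\Pi:B\to N$ such that the quotient $B/\Gamma$ of $B$ by the action is a manifold, $\Pi$ is $\star$-invariant, and the induced map $B/\Gamma\to N$ is a diffeomorphism. An $(H\rtimes G)$-bundle gerbe over a Lie groupoid $Y^{(1)}\rightrightarrows Y$ consists of a Lie groupoid $B\rightrightarrows Y$ with composition $\circ_\mu$, a groupoid morphism $\Pi:B\to Y^{(1)}$ over $\mathrm{id}_Y$, and a groupoid action $\star$ of $H\rtimes G\rightrightarrows G$ on $B$ with anchor $\rho:B\to G$, such that (1) $\Pi:B\to Y^{(1)}$ is a principal $(H\rtimes G\rightrightarrows G)$-bundle, and (2) $\circ_\mu$ is $(H\rtimes G)$-equivariant, i.e. $((h_2,g_2)\star b_2)\circ_\mu((h_1,g_1)\star b_1)=((h_2,g_2)\cdot(h_1,g_1))\star(b_2\circ_\mu b_1)$ for all composable $b_2,b_1\in B$ and all $(h_2,g_2),(h_1,g_1)\in H\rtimes G$ for which these expressions are defined ($g_i=\rho(b_i)$).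
   Formalization: In (i) the target is (k ρ(b)^{-1}, t(Π(b))), since the printed k ρ(b) contradicts (v); a principal bundle's groupoid action is taken to be free, proper and unital, and equivariance includes ρ(b2∘b1)=ρ(b2)ρ(b1), without which the claim fails. *)

theory Defs
  imports "HOL-Analysis.Analysis" "HOL-Algebra.Group"
begin

section \<open>Smooth maps between subsets of Euclidean spaces\<close>

text \<open>\<open>Ck_on k U f\<close> is the usual notion of a \<open>C\<^sup>k\<close> map, for \<open>U\<close> open.\<close>

primrec Ck_on ::
  "nat \<Rightarrow> 'a::euclidean_space set \<Rightarrow> ('a \<Rightarrow> 'b::euclidean_space) \<Rightarrow> bool"
where
  "Ck_on 0 U f \<longleftrightarrow> continuous_on U f"
| "Ck_on (Suc k) U f \<longleftrightarrow>
     (\<forall>x\<in>U. f differentiable (at x)) \<and>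
     (\<forall>v. Ck_on k U (\<lambda>x. frechet_derivative f (at x) v))"

text \<open>On an arbitrary subset: local extendability to a \<open>C\<^sup>\<infinity>\<close> map on an open set. For a relatively
  open subset of a linear subspace, and for an embedded submanifold, this is the
  intrinsic notion of smoothness.\<close>

definition smooth_on ::
  "'a::euclidean_space set \<Rightarrow> ('a \<Rightarrow> 'b::euclidean_space) \<Rightarrow> bool"
where
  "smooth_on S f \<longleftrightarrow>
     (\<forall>x\<in>S. \<exists>U f'. open U \<and> x \<in> U \<and> (\<forall>k. Ck_on k U f') \<and> (\<forall>y\<in>S \<inter> U. f y = f' y))"


section \<open>Smooth manifolds\<close>

text \<open>Charts take values in the linear subspace \<open>model M\<close> of the ambient type \<open>'e\<close>, so
  that \<open>dim (model M)\<close> is the dimension of the manifold. The ambient type alone would exclude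
  dimension 0 (hence discrete groups), since \<open>DIM('e) \<ge> 1\<close>. A smooth structure is given by some
  atlas, not necessarily a maximal one.\<close>

record ('x, 'e) mfd =
  mtop :: "'x topology"
  model :: "'e set"
  atlas :: "('x set \<times> ('x \<Rightarrow> 'e)) set"

abbreviation pts :: "('x, 'e) mfd \<Rightarrow> 'x set"
  where "pts M \<equiv> topspace (mtop M)"

definition manifold :: "('x, 'e::euclidean_space) mfd \<Rightarrow> bool"
where
  "manifold M \<longleftrightarrow>
     Hausdorff_space (mtop M) \<and> second_countable (mtop M) \<and> subspace (model M) \<and>
     (\<Union>(U, \<phi>)\<in>atlas M. U) = pts M \<and>
     (\<forall>(U, \<phi>)\<in>atlas M.
        openin (mtop M) U \<and> openin (top_of_set (model M)) (\<phi> ` U) \<and>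
        homeomorphic_map (subtopology (mtop M) U) (top_of_set (\<phi> ` U)) \<phi>) \<and>
     (\<forall>(U, \<phi>)\<in>atlas M. \<forall>(V, \<psi>)\<in>atlas M. smooth_on (\<phi> ` (U \<inter> V)) (\<psi> \<circ> inv_into U \<phi>))"

definition prod_mfd :: "('x, 'e) mfd \<Rightarrow> ('y, 'f) mfd \<Rightarrow> ('x \<times> 'y, 'e \<times> 'f) mfd"
where
  "prod_mfd M N =
     \<lparr> mtop = prod_topology (mtop M) (mtop N),
       model = model M \<times> model N,
       atlas = {(U \<times> V, map_prod \<phi> \<psi>) | U \<phi> V \<psi>. (U, \<phi>) \<in> atlas M \<and> (V, \<psi>) \<in> atlas N} \<rparr>"

text \<open>Smoothness of a map defined on a subset \<open>S\<close> of \<open>M\<close>. It is used below for \<open>S = pts M\<close> and for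
  fibre products over submersions; these are embedded submanifolds, and the notion agrees with
  smoothness for the submanifold structure.\<close>

definition smooth_map_on ::
  "'x set \<Rightarrow> ('x, 'e::euclidean_space) mfd \<Rightarrow> ('y, 'f::euclidean_space) mfd \<Rightarrow> ('x \<Rightarrow> 'y) \<Rightarrow> bool"
where
  "smooth_map_on S M N f \<longleftrightarrow>
     continuous_map (subtopology (mtop M) S) (mtop N) f \<and>
     (\<forall>(U, \<phi>)\<in>atlas M. \<forall>(V, \<psi>)\<in>atlas N.
        smooth_on (\<phi> ` {x \<in> S \<inter> U. f x \<in> V}) (\<psi> \<circ> f \<circ> inv_into U \<phi>))"

abbreviation smooth_map ::
  "('x, 'e::euclidean_space) mfd \<Rightarrow> ('y, 'f::euclidean_space) mfd \<Rightarrow> ('x \<Rightarrow> 'y) \<Rightarrow> bool"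
  where "smooth_map M N f \<equiv> smooth_map_on (pts M) M N f"

definition diffeomorphism ::
  "('x, 'e::euclidean_space) mfd \<Rightarrow> ('y, 'f::euclidean_space) mfd \<Rightarrow> ('x \<Rightarrow> 'y) \<Rightarrow> bool"
where
  "diffeomorphism M N f \<longleftrightarrow>
     smooth_map M N f \<and>
     (\<exists>g. smooth_map N M g \<and> (\<forall>x\<in>pts M. g (f x) = x) \<and> (\<forall>y\<in>pts N. f (g y) = y))"

text \<open>The derivative \<open>D\<close> of the coordinate expression is determined only on \<open>model M\<close>,
  which represents the tangent space.\<close>

definition surjective_submersion ::
  "('x, 'e::euclidean_space) mfd \<Rightarrow> ('y, 'f::euclidean_space) mfd \<Rightarrow> ('x \<Rightarrow> 'y) \<Rightarrow> bool"
where
  "surjective_submersion M N f \<longleftrightarrow>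
     smooth_map M N f \<and> f ` pts M = pts N \<and>
     (\<forall>(U, \<phi>)\<in>atlas M. \<forall>(V, \<psi>)\<in>atlas N. \<forall>x\<in>U. f x \<in> V \<longrightarrow>
        (\<exists>D. ((\<psi> \<circ> f \<circ> inv_into U \<phi>) has_derivative D)
                (at (\<phi> x) within \<phi> ` {x' \<in> U. f x' \<in> V}) \<and>
             D ` model M = model N))"

text \<open>\<open>Q\<close> is the quotient of \<open>M\<close> by the fibres of \<open>q\<close>: the smooth structure of a quotient
  manifold is the unique one for which the quotient map is a submersion.\<close>

definition quotient_manifold ::
  "('x, 'e::euclidean_space) mfd \<Rightarrow> ('x \<Rightarrow> 'y) \<Rightarrow> ('y, 'f::euclidean_space) mfd \<Rightarrow> bool"
where
  "quotient_manifold M q Q \<longleftrightarrow> manifold Q \<and> surjective_submersion M Q q"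


section \<open>Lie groups\<close>

record ('g, 'e) lie_grp = "'g monoid" +
  gmfd :: "('g, 'e) mfd"

definition lie_group :: "('g, 'e::euclidean_space) lie_grp \<Rightarrow> bool"
where
  "lie_group G \<longleftrightarrow>
     group G \<and> manifold (gmfd G) \<and> carrier G = pts (gmfd G) \<and>
     smooth_map (prod_mfd (gmfd G) (gmfd G)) (gmfd G) (\<lambda>(a, b). a \<otimes>\<^bsub>G\<^esub> b) \<and>
     smooth_map (gmfd G) (gmfd G) (\<lambda>a. inv\<^bsub>G\<^esub> a)"

definition lie_group_action ::
  "('k, 'e::euclidean_space) lie_grp \<Rightarrow> ('x, 'f::euclidean_space) mfd \<Rightarrow> ('k \<Rightarrow> 'x \<Rightarrow> 'x) \<Rightarrow> bool"
where
  "lie_group_action K M A \<longleftrightarrow>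
     lie_group K \<and> manifold M \<and>
     smooth_map (prod_mfd (gmfd K) M) M (\<lambda>(k, x). A k x) \<and>
     (\<forall>x\<in>pts M. A \<one>\<^bsub>K\<^esub> x = x) \<and>
     (\<forall>k\<in>carrier K. \<forall>l\<in>carrier K. \<forall>x\<in>pts M. A (k \<otimes>\<^bsub>K\<^esub> l) x = A k (A l x))"

definition free_group_action ::
  "('k, 'e) lie_grp \<Rightarrow> ('x, 'f) mfd \<Rightarrow> ('k \<Rightarrow> 'x \<Rightarrow> 'x) \<Rightarrow> bool"
where
  "free_group_action K M A \<longleftrightarrow>
     (\<forall>k\<in>carrier K. \<forall>x\<in>pts M. A k x = x \<longrightarrow> k = \<one>\<^bsub>K\<^esub>)"

definition proper_group_action ::
  "('k, 'e) lie_grp \<Rightarrow> ('x, 'f) mfd \<Rightarrow> ('k \<Rightarrow> 'x \<Rightarrow> 'x) \<Rightarrow> bool"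
where
  "proper_group_action K M A \<longleftrightarrow>
     proper_map (prod_topology (mtop (gmfd K)) (mtop M)) (prod_topology (mtop M) (mtop M))
       (\<lambda>(k, x). (A k x, x))"

definition group_orbit :: "('k, 'e) lie_grp \<Rightarrow> ('k \<Rightarrow> 'x \<Rightarrow> 'x) \<Rightarrow> 'x \<Rightarrow> 'x set"
where
  "group_orbit K A x = {A k x | k. k \<in> carrier K}"


section \<open>Lie groupoids\<close>

text \<open>\<open>comp_arr X a2 a1\<close> is \<open>a2\<close> after \<open>a1\<close>, meaningful when \<open>source X a2 = target X a1\<close>.\<close>

record ('o, 'a, 'eo, 'ea) grpd =
  objs :: "('o, 'eo) mfd"
  arrs :: "('a, 'ea) mfd"
  source :: "'a \<Rightarrow> 'o"
  target :: "'a \<Rightarrow> 'o"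
  comp_arr :: "'a \<Rightarrow> 'a \<Rightarrow> 'a"
  unit_arr :: "'o \<Rightarrow> 'a"
  inv_arr :: "'a \<Rightarrow> 'a"

definition composable :: "('o, 'a, 'eo, 'ea) grpd \<Rightarrow> ('a \<times> 'a) set"
where
  "composable X =
     {(a2, a1). a2 \<in> pts (arrs X) \<and> a1 \<in> pts (arrs X) \<and> source X a2 = target X a1}"

definition lie_groupoid :: "('o, 'a, 'eo::euclidean_space, 'ea::euclidean_space) grpd \<Rightarrow> bool"
where
  "lie_groupoid X \<longleftrightarrow>
     manifold (objs X) \<and> manifold (arrs X) \<and>
     surjective_submersion (arrs X) (objs X) (source X) \<and>
     surjective_submersion (arrs X) (objs X) (target X) \<and>
     smooth_map_on (composable X) (prod_mfd (arrs X) (arrs X)) (arrs X)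
       (\<lambda>(a2, a1). comp_arr X a2 a1) \<and>
     smooth_map (objs X) (arrs X) (unit_arr X) \<and>
     smooth_map (arrs X) (arrs X) (inv_arr X) \<and>
     (\<forall>(a2, a1)\<in>composable X.
        source X (comp_arr X a2 a1) = source X a1 \<and>
        target X (comp_arr X a2 a1) = target X a2) \<and>
     (\<forall>a3 a2 a1. (a3, a2) \<in> composable X \<and> (a2, a1) \<in> composable X \<longrightarrow>
        comp_arr X (comp_arr X a3 a2) a1 = comp_arr X a3 (comp_arr X a2 a1)) \<and>
     (\<forall>y\<in>pts (objs X). source X (unit_arr X y) = y \<and> target X (unit_arr X y) = y) \<and>
     (\<forall>a\<in>pts (arrs X).
        comp_arr X a (unit_arr X (source X a)) = a \<and>
        comp_arr X (unit_arr X (target X a)) a = a) \<and>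
     (\<forall>a\<in>pts (arrs X).
        source X (inv_arr X a) = target X a \<and> target X (inv_arr X a) = source X a \<and>
        comp_arr X (inv_arr X a) a = unit_arr X (source X a) \<and>
        comp_arr X a (inv_arr X a) = unit_arr X (target X a))"

text \<open>Compatibility with units and inverses follows from compatibility with composition.\<close>

definition lie_groupoid_morphism ::
  "('o, 'a, 'eo::euclidean_space, 'ea::euclidean_space) grpd \<Rightarrow>
   ('p, 'b, 'ep::euclidean_space, 'eb::euclidean_space) grpd \<Rightarrow> ('a \<Rightarrow> 'b) \<Rightarrow> ('o \<Rightarrow> 'p) \<Rightarrow> bool"
where
  "lie_groupoid_morphism X Z F1 F0 \<longleftrightarrow>
     smooth_map (arrs X) (arrs Z) F1 \<and> smooth_map (objs X) (objs Z) F0 \<and>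
     (\<forall>a\<in>pts (arrs X). source Z (F1 a) = F0 (source X a) \<and> target Z (F1 a) = F0 (target X a)) \<and>
     (\<forall>(a2, a1)\<in>composable X. F1 (comp_arr X a2 a1) = comp_arr Z (F1 a2) (F1 a1))"

definition lie_groupoid_isomorphism ::
  "('o, 'a, 'eo::euclidean_space, 'ea::euclidean_space) grpd \<Rightarrow>
   ('p, 'b, 'ep::euclidean_space, 'eb::euclidean_space) grpd \<Rightarrow> ('a \<Rightarrow> 'b) \<Rightarrow> ('o \<Rightarrow> 'p) \<Rightarrow> bool"
where
  "lie_groupoid_isomorphism X Z F1 F0 \<longleftrightarrow>
     lie_groupoid_morphism X Z F1 F0 \<and>
     diffeomorphism (arrs X) (arrs Z) F1 \<and> diffeomorphism (objs X) (objs Z) F0"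

definition prod_groupoid ::
  "('o, 'a, 'eo, 'ea) grpd \<Rightarrow> ('p, 'b, 'ep, 'eb) grpd \<Rightarrow>
   ('o \<times> 'p, 'a \<times> 'b, 'eo \<times> 'ep, 'ea \<times> 'eb) grpd"
where
  "prod_groupoid X Z =
     \<lparr> objs = prod_mfd (objs X) (objs Z),
       arrs = prod_mfd (arrs X) (arrs Z),
       source = map_prod (source X) (source Z),
       target = map_prod (target X) (target Z),
       comp_arr = (\<lambda>(a2, b2) (a1, b1). (comp_arr X a2 a1, comp_arr Z b2 b1)),
       unit_arr = map_prod (unit_arr X) (unit_arr Z),
       inv_arr = map_prod (inv_arr X) (inv_arr Z) \<rparr>"


section \<open>Crossed modules and Lie 2-groups\<close>

definition crossed_module ::
  "('h, 'eh::euclidean_space) lie_grp \<Rightarrow> ('g, 'eg::euclidean_space) lie_grp \<Rightarrow>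
   ('g \<Rightarrow> 'h \<Rightarrow> 'h) \<Rightarrow> ('h \<Rightarrow> 'g) \<Rightarrow> bool"
where
  "crossed_module H G C d \<longleftrightarrow>
     lie_group H \<and> lie_group G \<and>
     lie_group_action G (gmfd H) C \<and> (\<forall>g\<in>carrier G. C g \<in> iso H H) \<and>
     d \<in> hom H G \<and> smooth_map (gmfd H) (gmfd G) d \<and>
     (\<forall>g\<in>carrier G. \<forall>h\<in>carrier H. d (C g h) = g \<otimes>\<^bsub>G\<^esub> d h \<otimes>\<^bsub>G\<^esub> inv\<^bsub>G\<^esub> g) \<and>
     (\<forall>h\<in>carrier H. \<forall>h'\<in>carrier H. C (d h) h' = h \<otimes>\<^bsub>H\<^esub> h' \<otimes>\<^bsub>H\<^esub> inv\<^bsub>H\<^esub> h)"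

definition cm_group ::
  "('h, 'eh) lie_grp \<Rightarrow> ('g, 'eg) lie_grp \<Rightarrow> ('g \<Rightarrow> 'h \<Rightarrow> 'h) \<Rightarrow> ('h \<times> 'g, 'eh \<times> 'eg) lie_grp"
where
  "cm_group H G C =
     \<lparr> carrier = carrier H \<times> carrier G,
       mult = (\<lambda>(h2, g2) (h1, g1). (h2 \<otimes>\<^bsub>H\<^esub> C g2 h1, g2 \<otimes>\<^bsub>G\<^esub> g1)),
       one = (\<one>\<^bsub>H\<^esub>, \<one>\<^bsub>G\<^esub>),
       gmfd = prod_mfd (gmfd H) (gmfd G) \<rparr>"

text \<open>\<open>(h\<^sub>2, g\<^sub>2) \<circ> (h\<^sub>1, g\<^sub>1)\<close> is only meaningful for \<open>g\<^sub>2 = d h\<^sub>1 \<cdot> g\<^sub>1\<close>, so \<open>g\<^sub>2\<close> is ignored.\<close>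

definition cm_groupoid ::
  "('h, 'eh) lie_grp \<Rightarrow> ('g, 'eg) lie_grp \<Rightarrow> ('h \<Rightarrow> 'g) \<Rightarrow> ('g, 'h \<times> 'g, 'eg, 'eh \<times> 'eg) grpd"
where
  "cm_groupoid H G d =
     \<lparr> objs = gmfd G,
       arrs = prod_mfd (gmfd H) (gmfd G),
       source = (\<lambda>(h, g). g),
       target = (\<lambda>(h, g). d h \<otimes>\<^bsub>G\<^esub> g),
       comp_arr = (\<lambda>(h2, g2) (h1, g1). (h2 \<otimes>\<^bsub>H\<^esub> h1, g1)),
       unit_arr = (\<lambda>g. (\<one>\<^bsub>H\<^esub>, g)),
       inv_arr = (\<lambda>(h, g). (inv\<^bsub>H\<^esub> h, d h \<otimes>\<^bsub>G\<^esub> g)) \<rparr>"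


section \<open>Principal 2-group bundles over Lie groupoids\<close>

definition lie_2group_action ::
  "('h, 'eh::euclidean_space) lie_grp \<Rightarrow> ('g, 'eg::euclidean_space) lie_grp \<Rightarrow>
   ('g \<Rightarrow> 'h \<Rightarrow> 'h) \<Rightarrow> ('h \<Rightarrow> 'g) \<Rightarrow>
   ('o, 'a, 'eo::euclidean_space, 'ea::euclidean_space) grpd \<Rightarrow>
   ('h \<times> 'g \<Rightarrow> 'a \<Rightarrow> 'a) \<Rightarrow> ('g \<Rightarrow> 'o \<Rightarrow> 'o) \<Rightarrow> bool"
where
  "lie_2group_action H G C d P A1 A0 \<longleftrightarrow>
     lie_groupoid P \<and>
     lie_group_action (cm_group H G C) (arrs P) A1 \<and>
     lie_group_action G (objs P) A0 \<and>
     lie_groupoid_morphism (prod_groupoid (cm_groupoid H G d) P) P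
       (\<lambda>(k, a). A1 k a) (\<lambda>(g, y). A0 g y)"

text \<open>The structure maps of the quotient groupoid are determined by the requirement that the
  orbit maps form a groupoid morphism.\<close>

definition quotient_groupoid ::
  "('h, 'eh::euclidean_space) lie_grp \<Rightarrow> ('g, 'eg::euclidean_space) lie_grp \<Rightarrow>
   ('g \<Rightarrow> 'h \<Rightarrow> 'h) \<Rightarrow>
   ('o, 'a, 'eo::euclidean_space, 'ea::euclidean_space) grpd \<Rightarrow>
   ('h \<times> 'g \<Rightarrow> 'a \<Rightarrow> 'a) \<Rightarrow> ('g \<Rightarrow> 'o \<Rightarrow> 'o) \<Rightarrow>
   ('o set, 'a set, 'ep::euclidean_space, 'eb::euclidean_space) grpd \<Rightarrow> bool"
where
  "quotient_groupoid H G C P A1 A0 Q \<longleftrightarrow>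
     lie_groupoid Q \<and>
     quotient_manifold (arrs P) (group_orbit (cm_group H G C) A1) (arrs Q) \<and>
     quotient_manifold (objs P) (group_orbit G A0) (objs Q) \<and>
     lie_groupoid_morphism P Q (group_orbit (cm_group H G C) A1) (group_orbit G A0)"

text \<open>\<open>(p1, p0)\<close> is the bundle projection: the map that the orbit map becomes after identifying the
  quotient groupoid with \<open>Y\<close>. The quotient groupoid may be modelled in the same ambient types
  as \<open>Y\<close>, being diffeomorphic to it.\<close>

definition principal_bundle_groupoid ::
  "('h, 'eh::euclidean_space) lie_grp \<Rightarrow> ('g, 'eg::euclidean_space) lie_grp \<Rightarrow>
   ('g \<Rightarrow> 'h \<Rightarrow> 'h) \<Rightarrow> ('h \<Rightarrow> 'g) \<Rightarrow>
   ('o, 'a, 'eo::euclidean_space, 'ea::euclidean_space) grpd \<Rightarrow>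
   ('h \<times> 'g \<Rightarrow> 'a \<Rightarrow> 'a) \<Rightarrow> ('g \<Rightarrow> 'o \<Rightarrow> 'o) \<Rightarrow>
   ('y, 'z, 'ey::euclidean_space, 'ez::euclidean_space) grpd \<Rightarrow>
   ('a \<Rightarrow> 'z) \<Rightarrow> ('o \<Rightarrow> 'y) \<Rightarrow> bool"
where
  "principal_bundle_groupoid H G C d P A1 A0 Y p1 p0 \<longleftrightarrow>
     lie_2group_action H G C d P A1 A0 \<and>
     free_group_action (cm_group H G C) (arrs P) A1 \<and>
     free_group_action G (objs P) A0 \<and>
     proper_group_action (cm_group H G C) (arrs P) A1 \<and>
     proper_group_action G (objs P) A0 \<and>
     (\<exists>(Q :: ('o set, 'a set, 'ey, 'ez) grpd) F1 F0.
        quotient_groupoid H G C P A1 A0 Q \<and>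
        lie_groupoid_isomorphism Q Y F1 F0 \<and>
        (\<forall>a\<in>pts (arrs P). F1 (group_orbit (cm_group H G C) A1 a) = p1 a) \<and>
        (\<forall>x\<in>pts (objs P). F0 (group_orbit G A0 x) = p0 x))"

definition trivial_base_principal_bundle_groupoid ::
  "('h, 'eh::euclidean_space) lie_grp \<Rightarrow> ('g, 'eg::euclidean_space) lie_grp \<Rightarrow>
   ('g \<Rightarrow> 'h \<Rightarrow> 'h) \<Rightarrow> ('h \<Rightarrow> 'g) \<Rightarrow>
   ('g \<times> 'y, 'a, 'eg \<times> 'ey::euclidean_space, 'ea::euclidean_space) grpd \<Rightarrow>
   ('h \<times> 'g \<Rightarrow> 'a \<Rightarrow> 'a) \<Rightarrow> ('g \<Rightarrow> 'g \<times> 'y \<Rightarrow> 'g \<times> 'y) \<Rightarrow>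
   ('y, 'z, 'ey, 'ez::euclidean_space) grpd \<Rightarrow>
   ('a \<Rightarrow> 'z) \<Rightarrow> ('g \<times> 'y \<Rightarrow> 'y) \<Rightarrow> bool"
where
  "trivial_base_principal_bundle_groupoid H G C d P A1 A0 Y p1 p0 \<longleftrightarrow>
     principal_bundle_groupoid H G C d P A1 A0 Y p1 p0 \<and>
     objs P = prod_mfd (gmfd G) (objs Y) \<and>
     (\<forall>g\<in>carrier G. \<forall>k\<in>carrier G. \<forall>y\<in>pts (objs Y). A0 g (k, y) = (g \<otimes>\<^bsub>G\<^esub> k, y)) \<and>
     (\<forall>k\<in>carrier G. \<forall>y\<in>pts (objs Y). p0 (k, y) = y)"


section \<open>Principal groupoid bundles and bundle gerbes\<close>

definition action_domain ::
  "('o, 'c, 'eo, 'ec) grpd \<Rightarrow> ('b, 'eb) mfd \<Rightarrow> ('b \<Rightarrow> 'o) \<Rightarrow> ('c \<times> 'b) set"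
where
  "action_domain \<Gamma> M \<rho> = {(\<gamma>, b). \<gamma> \<in> pts (arrs \<Gamma>) \<and> b \<in> pts M \<and> source \<Gamma> \<gamma> = \<rho> b}"

definition groupoid_action ::
  "('o, 'c, 'eo::euclidean_space, 'ec::euclidean_space) grpd \<Rightarrow> ('b, 'eb::euclidean_space) mfd \<Rightarrow>
   ('b \<Rightarrow> 'o) \<Rightarrow> ('c \<Rightarrow> 'b \<Rightarrow> 'b) \<Rightarrow> bool"
where
  "groupoid_action \<Gamma> M \<rho> star \<longleftrightarrow>
     manifold M \<and> surjective_submersion M (objs \<Gamma>) \<rho> \<and>
     smooth_map_on (action_domain \<Gamma> M \<rho>) (prod_mfd (arrs \<Gamma>) M) M (\<lambda>(\<gamma>, b). star \<gamma> b) \<and>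
     (\<forall>(\<gamma>, b)\<in>action_domain \<Gamma> M \<rho>. \<rho> (star \<gamma> b) = target \<Gamma> \<gamma>) \<and>
     (\<forall>\<gamma>2 \<gamma>1 b. (\<gamma>2, \<gamma>1) \<in> composable \<Gamma> \<and> (\<gamma>1, b) \<in> action_domain \<Gamma> M \<rho> \<longrightarrow>
        star \<gamma>2 (star \<gamma>1 b) = star (comp_arr \<Gamma> \<gamma>2 \<gamma>1) b) \<and>
     (\<forall>b\<in>pts M. star (unit_arr \<Gamma> (\<rho> b)) b = b)"

definition groupoid_orbit ::
  "('o, 'c, 'eo, 'ec) grpd \<Rightarrow> ('b \<Rightarrow> 'o) \<Rightarrow> ('c \<Rightarrow> 'b \<Rightarrow> 'b) \<Rightarrow> 'b \<Rightarrow> 'b set"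
where
  "groupoid_orbit \<Gamma> \<rho> star b = {star \<gamma> b | \<gamma>. \<gamma> \<in> pts (arrs \<Gamma>) \<and> source \<Gamma> \<gamma> = \<rho> b}"

text \<open>As usual, principal includes free and proper.\<close>

definition principal_groupoid_bundle ::
  "('o, 'c, 'eo::euclidean_space, 'ec::euclidean_space) grpd \<Rightarrow> ('b, 'eb::euclidean_space) mfd \<Rightarrow>
   ('b \<Rightarrow> 'o) \<Rightarrow> ('c \<Rightarrow> 'b \<Rightarrow> 'b) \<Rightarrow> ('n, 'en::euclidean_space) mfd \<Rightarrow> ('b \<Rightarrow> 'n) \<Rightarrow> bool"
where
  "principal_groupoid_bundle \<Gamma> M \<rho> star N pr \<longleftrightarrow>
     groupoid_action \<Gamma> M \<rho> star \<and>
     (\<forall>(\<gamma>, b)\<in>action_domain \<Gamma> M \<rho>. star \<gamma> b = b \<longrightarrow> \<gamma> = unit_arr \<Gamma> (\<rho> b)) \<and>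
     proper_map (subtopology (prod_topology (mtop (arrs \<Gamma>)) (mtop M)) (action_domain \<Gamma> M \<rho>))
       (prod_topology (mtop M) (mtop M)) (\<lambda>(\<gamma>, b). (star \<gamma> b, b)) \<and>
     manifold N \<and> surjective_submersion M N pr \<and>
     (\<forall>(\<gamma>, b)\<in>action_domain \<Gamma> M \<rho>. pr (star \<gamma> b) = pr b) \<and>
     (\<exists>(Q :: ('b set, 'en) mfd) F.
        quotient_manifold M (groupoid_orbit \<Gamma> \<rho> star) Q \<and>
        (\<forall>b\<in>pts M. F (groupoid_orbit \<Gamma> \<rho> star b) = pr b) \<and>
        diffeomorphism Q N F)"

text \<open>The last conjunct is equivariance of the composition of \<open>B\<close>. Its right-hand side is defined
  only if \<open>\<rho> (b2 \<circ> b1) = \<rho> b2 \<cdot> \<rho> b1\<close>, so this identity is part of the condition.\<close>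

definition bundle_gerbe ::
  "('h, 'eh::euclidean_space) lie_grp \<Rightarrow> ('g, 'eg::euclidean_space) lie_grp \<Rightarrow>
   ('g \<Rightarrow> 'h \<Rightarrow> 'h) \<Rightarrow> ('h \<Rightarrow> 'g) \<Rightarrow>
   ('y, 'z, 'ey::euclidean_space, 'ez::euclidean_space) grpd \<Rightarrow>
   ('y, 'b, 'ey, 'eb::euclidean_space) grpd \<Rightarrow>
   ('b \<Rightarrow> 'z) \<Rightarrow> ('b \<Rightarrow> 'g) \<Rightarrow> ('h \<times> 'g \<Rightarrow> 'b \<Rightarrow> 'b) \<Rightarrow> bool"
where
  "bundle_gerbe H G C d Y B pr \<rho> star \<longleftrightarrow>
     lie_groupoid B \<and> objs B = objs Y \<and>
     lie_groupoid_morphism B Y pr id \<and>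
     principal_groupoid_bundle (cm_groupoid H G d) (arrs B) \<rho> star (arrs Y) pr \<and>
     (\<forall>(b2, b1)\<in>composable B.
        \<rho> (comp_arr B b2 b1) = \<rho> b2 \<otimes>\<^bsub>G\<^esub> \<rho> b1 \<and>
        (\<forall>h2\<in>carrier H. \<forall>h1\<in>carrier H.
           comp_arr B (star (h2, \<rho> b2) b2) (star (h1, \<rho> b1) b1) =
           star ((h2, \<rho> b2) \<otimes>\<^bsub>cm_group H G C\<^esub> (h1, \<rho> b1)) (comp_arr B b2 b1)))"

end

(*
  Write the points of the bundle as pairs (k, b). The action of (h, g) multiplies k by g on the left
  and moves b inside its Pi-fibre by the element C_x h^-1 of H, x = rho(b) k^-1 g^-1. The identity
  C_{d(h)} h' = h h' h^-1 turns composition of such moves into the product of H x| G, and equivariance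
  of the composition of B turns it into functoriality of the action.

  Freeness and transitivity on the fibres of (k, b) |-> Pi(b) are those of the H x| G-action on B,
  because C_x is bijective. Properness is also inherited: ((h, g), (k, b)) |-> ((g k, k), (C_x h^-1, rho(b), b))
  is a homeomorphism onto (G x G) times the domain of the groupoid action, and it carries the
  shear map of the group action to the product of the identity with the shear map of the groupoid action.

  The orbits are therefore the sets G x Pi^-1(z), and the quotient groupoid is obtained by transporting the
  structure of Y along z |-> G x Pi^-1(z), so no general quotient manifold theorem is needed. The target map
  (k, b) |-> (k rho(b)^-1, t(b)) is a submersion because it is id x t after a diffeomorphism of G x B.
*)

theory Submission
  imports Defs
begin

section \<open>Calculus of smooth maps\<close>

text \<open>The factor \<rho>(b)^-1 in the target is forced, and item (i) has to be read with it: a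
  composite keeps k and has anchor \<rho>(b2)\<rho>(b1), so its target component
  k(\<rho>(b2)\<rho>(b1))^-1 = k\<rho>(b1)^-1 \<rho>(b2)^-1 is that of b2 started at k\<rho>(b1)^-1.
  With \<rho>(b) instead, the two factors would appear in opposite orders, and the inverse in (v)
  would not start at the target. The twist x in the action is then suggested by equivariance of the
  target.

  On the analytic side the obstacle is that charts take values in relatively open subsets of a
  linear subspace. A derivative there is determined only along that subspace, so uniqueness
  arguments for submersions are carried out in tangent directions, by restriction to line segments.
  Smoothness of the action and of the coordinate changes is reduced to pointwise closure rules for
  words in the group operations, \<rho> and the H-action on B.\<close>

lemma Ck_on_cong:
  assumes "open U" "\<And>x. x \<in> U \<Longrightarrow> f x = g x" "Ck_on k U f"
  shows "Ck_on k U g"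
  using assms(2,3)
proof (induction k arbitrary: f g)
  case 0
  then show ?case using continuous_on_cong[of U U f g] by simp
next
  case (Suc k)
  \<comment> \<open>\<open>U\<close> is open, so a derivative at a point of \<open>U\<close> sees
    only the values on \<open>U\<close>, and \<open>frechet_derivative\<close> chooses the same map
    for \<open>f\<close> and \<open>g\<close>.\<close>
  have *: "(f has_derivative D) (at x) = (g has_derivative D) (at x)" if "x \<in> U" for x D
    using has_derivative_transform_within_open[of f D x UNIV U g]
      has_derivative_transform_within_open[of g D x UNIV U f] Suc.prems(1) assms(1) that
    by auto
  have "frechet_derivative f (at x) = frechet_derivative g (at x)" if "x \<in> U" for x
    unfolding frechet_derivative_def using *[OF that] by simp
  moreover have "g differentiable (at x)" if "x \<in> U" for x
    using Suc.prems(2) *[OF that] that unfolding differentiable_def Ck_on.simps by blast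
  moreover have "Ck_on k U (\<lambda>x. frechet_derivative g (at x) v)" for v
    by (rule Suc.IH[of "\<lambda>x. frechet_derivative f (at x) v"]) (use Suc.prems(2) calculation(1) in auto)
  ultimately show ?case
    by simp
qed

lemma Ck_on_subset: "Ck_on k U f \<Longrightarrow> V \<subseteq> U \<Longrightarrow> Ck_on k V f"
  by (induction k arbitrary: f) (auto intro: continuous_on_subset)

lemma Ck_on_Suc_continuous: "Ck_on (Suc k) U f \<Longrightarrow> continuous_on U f"
  by (simp add: continuous_at_imp_continuous_on differentiable_imp_continuous_within)

lemma Ck_on_SucD: "Ck_on (Suc k) U f \<Longrightarrow> Ck_on k U f"
proof (induction k arbitrary: f)
  case 0
  then show ?case using Ck_on_Suc_continuous[of 0 U f] by (simp del: Ck_on.simps(2))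
next
  case (Suc k)
  then show ?case by (metis Ck_on.simps(2))
qed

text \<open>\<open>Ck_on\<close> iterates the chosen \<open>frechet_derivative\<close>. Derivatives
  at a point are unique, so any explicit formula agrees with the choice on \<open>U\<close> and may
  replace it. The closure rules below argue with such formulas.\<close>

lemma Ck_on_SucI:
  assumes "open U" "\<And>x. x \<in> U \<Longrightarrow> (f has_derivative f' x) (at x)"
    and "\<And>v. Ck_on k U (\<lambda>x. f' x v)"
  shows "Ck_on (Suc k) U f"
proof -
  have "f' x = frechet_derivative f (at x)" if "x \<in> U" for x
    using frechet_derivative_at[OF assms(2)[OF that]] .
  then have "Ck_on k U (\<lambda>x. frechet_derivative f (at x) v)" for v
    by (intro Ck_on_cong[OF assms(1) _ assms(3)[of v]]) simp
  with assms(2) show ?thesis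
    by (auto simp: differentiable_def)
qed

lemma Ck_on_SucE:
  assumes "Ck_on (Suc k) U f"
  obtains f' where "\<And>x. x \<in> U \<Longrightarrow> (f has_derivative f' x) (at x)"
    and "\<And>v. Ck_on k U (\<lambda>x. f' x v)"
  using assms that[of "\<lambda>x. frechet_derivative f (at x)"] by (auto simp: frechet_derivative_works)

lemma Ck_on_const: "open U \<Longrightarrow> Ck_on k U (\<lambda>x. c)"
proof (induction k arbitrary: c)
  case (Suc k)
  then show ?case by (intro Ck_on_SucI[where f' = "\<lambda>x v. 0"]) auto
qed simp

lemma Ck_on_bounded_linear: "open U \<Longrightarrow> bounded_linear L \<Longrightarrow> Ck_on k U L"
proof (cases k)
  case (Suc k')
  assume "open U" "bounded_linear L"
  then show ?thesis unfolding Suc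
    by (intro Ck_on_SucI[where f' = "\<lambda>x. L"]) (auto intro: bounded_linear_imp_has_derivative Ck_on_const)
qed (simp add: linear_continuous_on)

lemma Ck_on_bounded_linear_comp:
  assumes "open U" "bounded_linear L" "Ck_on k U f"
  shows "Ck_on k U (\<lambda>x. L (f x))"
  using assms(3)
proof (induction k arbitrary: f)
  case 0
  then show ?case using assms(2) by (simp add: bounded_linear.continuous_on)
next
  case (Suc k)
  obtain f' where "\<And>x. x \<in> U \<Longrightarrow> (f has_derivative f' x) (at x)" "\<And>v. Ck_on k U (\<lambda>x. f' x v)"
    using Ck_on_SucE[OF Suc.prems] by blast
  then show ?case
    by (intro Ck_on_SucI[OF assms(1), where f' = "\<lambda>x v. L (f' x v)"] bounded_linear.has_derivative[OF assms(2)] Suc.IH)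
qed

lemma Ck_on_add:
  assumes "open U" "Ck_on k U f" "Ck_on k U g"
  shows "Ck_on k U (\<lambda>x. f x + g x)"
  using assms(2,3)
proof (induction k arbitrary: f g)
  case 0
  then show ?case by (simp add: continuous_on_add)
next
  case (Suc k)
  obtain f' where f: "\<And>x. x \<in> U \<Longrightarrow> (f has_derivative f' x) (at x)" "\<And>v. Ck_on k U (\<lambda>x. f' x v)"
    using Ck_on_SucE[OF Suc.prems(1)] by blast
  obtain g' where g: "\<And>x. x \<in> U \<Longrightarrow> (g has_derivative g' x) (at x)" "\<And>v. Ck_on k U (\<lambda>x. g' x v)"
    using Ck_on_SucE[OF Suc.prems(2)] by blast
  show ?case
    by (intro Ck_on_SucI[OF assms(1), where f' = "\<lambda>x v. f' x v + g' x v"] has_derivative_add Suc.IH f g)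
qed

lemma Ck_on_sum:
  assumes "open U" "finite I" "\<And>i. i \<in> I \<Longrightarrow> Ck_on k U (f i)"
  shows "Ck_on k U (\<lambda>x. \<Sum>i\<in>I. f i x)"
  using assms(2,3)
  by (induction I) (auto intro: Ck_on_const Ck_on_add assms(1))

lemma Ck_on_scaleR:
  assumes "open U" "Ck_on k U f" "Ck_on k U g"
  shows "Ck_on k U (\<lambda>x. f x *\<^sub>R g x)"
  using assms(2,3)
proof (induction k arbitrary: f g)
  case 0
  then show ?case by (simp add: continuous_on_scaleR)
next
  case (Suc k)
  obtain f' where f: "\<And>x. x \<in> U \<Longrightarrow> (f has_derivative f' x) (at x)" "\<And>v. Ck_on k U (\<lambda>x. f' x v)"
    using Ck_on_SucE[OF Suc.prems(1)] by blast
  obtain g' where g: "\<And>x. x \<in> U \<Longrightarrow> (g has_derivative g' x) (at x)" "\<And>v. Ck_on k U (\<lambda>x. g' x v)"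
    using Ck_on_SucE[OF Suc.prems(2)] by blast
  show ?case
    \<comment> \<open>The product rule keeps one factor undifferentiated, whence the use of
      \<open>Ck_on_SucD\<close>.\<close>
    by (intro Ck_on_SucI[OF assms(1), where f' = "\<lambda>x v. f x *\<^sub>R g' x v + f' x v *\<^sub>R g x"]
        has_derivative_scaleR Ck_on_add Suc.IH f g Suc.prems[THEN Ck_on_SucD] assms(1))
qed

lemma Ck_on_Pair:
  assumes "open U" "Ck_on k U f" "Ck_on k U g"
  shows "Ck_on k U (\<lambda>x. (f x, g x))"
  using assms(2,3)
proof (induction k arbitrary: f g)
  case 0
  then show ?case by (simp add: continuous_on_Pair)
next
  case (Suc k)
  obtain f' where f: "\<And>x. x \<in> U \<Longrightarrow> (f has_derivative f' x) (at x)" "\<And>v. Ck_on k U (\<lambda>x. f' x v)"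
    using Ck_on_SucE[OF Suc.prems(1)] by blast
  obtain g' where g: "\<And>x. x \<in> U \<Longrightarrow> (g has_derivative g' x) (at x)" "\<And>v. Ck_on k U (\<lambda>x. g' x v)"
    using Ck_on_SucE[OF Suc.prems(2)] by blast
  show ?case
    by (intro Ck_on_SucI[OF assms(1), where f' = "\<lambda>x v. (f' x v, g' x v)"] has_derivative_Pair Suc.IH f g)
qed

text \<open>The chain rule gives \<open>g' (f x) (f' x v)\<close>, whose direction varies with
  \<open>x\<close>, while the induction hypothesis speaks of a fixed direction. Expanding
  \<open>f' x v\<close> in \<open>Basis\<close> leaves fixed directions \<open>b\<close> with scalar
  coefficients that are \<open>Ck_on k\<close>.\<close>

lemma Ck_on_compose:
  fixes f :: "'a::euclidean_space \<Rightarrow> 'b::euclidean_space"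
    and g :: "'b \<Rightarrow> 'c::euclidean_space"
  assumes "open U" "open W" "f ` U \<subseteq> W" "Ck_on k U f" "Ck_on k W g"
  shows "Ck_on k U (\<lambda>x. g (f x))"
  using assms(4,5)
proof (induction k arbitrary: g)
  case 0
  then show ?case using continuous_on_compose2 assms(3) by auto
next
  case (Suc k)
  obtain f' where f: "\<And>x. x \<in> U \<Longrightarrow> (f has_derivative f' x) (at x)" "\<And>v. Ck_on k U (\<lambda>x. f' x v)"
    using Ck_on_SucE[OF Suc.prems(1)] by blast
  obtain g' where g: "\<And>x. x \<in> W \<Longrightarrow> (g has_derivative g' x) (at x)" "\<And>v. Ck_on k W (\<lambda>x. g' x v)"
    using Ck_on_SucE[OF Suc.prems(2)] by blast
  have der: "((\<lambda>x. g (f x)) has_derivative (\<lambda>v. g' (f x) (f' x v))) (at x)" if "x \<in> U" for x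
    using has_derivative_compose[OF f(1)[OF that] g(1)] assms(3) that by blast
  have "Ck_on k U (\<lambda>x. \<Sum>b\<in>Basis. (f' x v \<bullet> b) *\<^sub>R g' (f x) b)" for v
    by (intro Ck_on_sum Ck_on_scaleR Suc.IH g Suc.prems(1)[THEN Ck_on_SucD] assms(1) finite_Basis
      Ck_on_bounded_linear_comp[OF _ bounded_linear_inner_left] f(2))
  moreover have "g' (f x) (f' x v) = (\<Sum>b\<in>Basis. (f' x v \<bullet> b) *\<^sub>R g' (f x) b)" if "x \<in> U" for x v
  proof -
    have lin: "linear (g' (f x))"
      using g(1) that assms(3) has_derivative_linear by blast
    have "g' (f x) (f' x v) = g' (f x) (\<Sum>b\<in>Basis. (f' x v \<bullet> b) *\<^sub>R b)"
      by (simp add: euclidean_representation)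
    then show ?thesis
      using lin by (simp add: linear_sum linear_scale)
  qed
  ultimately have "Ck_on k U (\<lambda>x. g' (f x) (f' x v))" for v
    using Ck_on_cong[OF assms(1), of "\<lambda>x. \<Sum>b\<in>Basis. (f' x v \<bullet> b) *\<^sub>R g' (f x) b"] by simp
  with assms(1) der show ?case
    by (intro Ck_on_SucI)
qed

section \<open>Smooth maps on arbitrary subsets of Euclidean space\<close>

lemma smooth_onE:
  assumes "smooth_on S f" "x \<in> S"
  obtains U f' where "open U" "x \<in> U" "\<And>k. Ck_on k U f'" "\<And>y. y \<in> S \<Longrightarrow> y \<in> U \<Longrightarrow> f y = f' y"
proof -
  from assms have "\<exists>U f'. open U \<and> x \<in> U \<and> (\<forall>k. Ck_on k U f') \<and> (\<forall>y\<in>S \<inter> U. f y = f' y)"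
    unfolding smooth_on_def by (rule bspec)
  then show thesis by (elim exE conjE) (rule that, assumption+, erule spec, erule bspec, rule IntI)
qed

lemma smooth_on_subset:
  assumes "smooth_on S f" "T \<subseteq> S"
  shows "smooth_on T f"
  unfolding smooth_on_def
proof
  fix x assume "x \<in> T"
  with assms(2) have "x \<in> S" by blast
  then obtain U f' where "open U" "x \<in> U" "\<And>k. Ck_on k U f'" "\<And>y. y \<in> S \<Longrightarrow> y \<in> U \<Longrightarrow> f y = f' y"
    using smooth_onE[OF assms(1)] by blast
  with assms(2) show "\<exists>U f'. open U \<and> x \<in> U \<and> (\<forall>k. Ck_on k U f') \<and> (\<forall>y\<in>T \<inter> U. f y = f' y)"
    by (intro exI[of _ U] exI[of _ f']) (simp add: subset_iff)
qed

lemma smooth_on_cong: 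
  assumes "smooth_on S f" "\<And>x. x \<in> S \<Longrightarrow> f x = g x"
  shows "smooth_on S g"
  using assms unfolding smooth_on_def by (metis IntD1)

text \<open>A coordinate expression of a composite is controlled only near each point, where one
  chart of the middle manifold suffices; this rule glues the local statements.\<close>

lemma smooth_on_local:
  assumes "\<And>x. x \<in> S \<Longrightarrow> \<exists>W. open W \<and> x \<in> W \<and> smooth_on (S \<inter> W) f"
  shows "smooth_on S f"
  unfolding smooth_on_def
proof
  fix x assume x: "x \<in> S"
  obtain W where W: "open W" "x \<in> W" "smooth_on (S \<inter> W) f"
    using assms[OF x] by blast
  obtain U f' where "open U" "x \<in> U" "\<And>k. Ck_on k U f'"
      "\<And>y. y \<in> S \<inter> W \<Longrightarrow> y \<in> U \<Longrightarrow> f y = f' y"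
    using smooth_onE[OF W(3), of x] x W(2) by blast
  with W show "\<exists>U f'. open U \<and> x \<in> U \<and> (\<forall>k. Ck_on k U f') \<and> (\<forall>y\<in>S \<inter> U. f y = f' y)"
    by (intro exI[of _ "U \<inter> W"] exI[of _ f']) (auto intro: Ck_on_subset)
qed

lemma smooth_on_bounded_linear: "bounded_linear L \<Longrightarrow> smooth_on S L"
  unfolding smooth_on_def
  by (intro ballI exI[of _ UNIV] exI[of _ L]) (simp add: Ck_on_bounded_linear)

lemma smooth_on_Pair:
  assumes "smooth_on S f" "smooth_on S g"
  shows "smooth_on S (\<lambda>x. (f x, g x))"
  unfolding smooth_on_def
proof
  fix x assume x: "x \<in> S"
  obtain U f' where U: "open U" "x \<in> U" "\<And>k. Ck_on k U f'" "\<And>y. y \<in> S \<Longrightarrow> y \<in> U \<Longrightarrow> f y = f' y"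
    using smooth_onE[OF assms(1) x] by blast
  obtain V g' where V: "open V" "x \<in> V" "\<And>k. Ck_on k V g'" "\<And>y. y \<in> S \<Longrightarrow> y \<in> V \<Longrightarrow> g y = g' y"
    using smooth_onE[OF assms(2) x] by blast
  show "\<exists>U f'. open U \<and> x \<in> U \<and> (\<forall>k. Ck_on k U f') \<and> (\<forall>y\<in>S \<inter> U. (f y, g y) = f' y)"
    using U V
    by (intro exI[of _ "U \<inter> V"] exI[of _ "\<lambda>y. (f' y, g' y)"])
      (auto intro!: Ck_on_Pair intro: Ck_on_subset)
qed

lemma smooth_on_compose:
  assumes "smooth_on S f" "smooth_on T g" "f ` S \<subseteq> T"
  shows "smooth_on S (\<lambda>x. g (f x))"
  unfolding smooth_on_def
proof
  fix x assume x: "x \<in> S"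
  obtain U f' where U: "open U" "x \<in> U" "\<And>k. Ck_on k U f'" "\<And>y. y \<in> S \<Longrightarrow> y \<in> U \<Longrightarrow> f y = f' y"
    using smooth_onE[OF assms(1) x] by blast
  obtain V g' where V: "open V" "f x \<in> V" "\<And>k. Ck_on k V g'" "\<And>y. y \<in> T \<Longrightarrow> y \<in> V \<Longrightarrow> g y = g' y"
    using smooth_onE[OF assms(2), of "f x"] x assms(3) by blast
  \<comment> \<open>The extension of \<open>g\<close> lives on \<open>V\<close> only, and the
    extension \<open>f'\<close> may leave \<open>V\<close>. Cutting back to \<open>?W\<close> cures
    this, and continuity of \<open>f'\<close> keeps it open.\<close>
  let ?W = "U \<inter> f' -` V"
  have "continuous_on U f'"
    using U(3)[of 0] by simp
  then have op: "open ?W"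
    using U(1) V(1) by (simp add: continuous_on_open_vimage Int_commute)
  show "\<exists>U f'. open U \<and> x \<in> U \<and> (\<forall>k. Ck_on k U f') \<and> (\<forall>y\<in>S \<inter> U. g (f y) = f' y)"
  proof (intro exI[of _ ?W] exI[of _ "\<lambda>y. g' (f' y)"] conjI allI ballI)
    show "Ck_on k ?W (\<lambda>y. g' (f' y))" for k
      by (rule Ck_on_compose[OF op V(1) _ _ V(3)]) (auto intro: Ck_on_subset[OF U(3)])
    show "g (f y) = g' (f' y)" if "y \<in> S \<inter> ?W" for y
      using that U(4) V(4) assms(3) by auto
  qed (use op x U V in auto)
qed

section \<open>Derivatives within relatively open subsets of a linear subspace\<close>

lemma has_derivative_within_Int_open:
  "open W \<Longrightarrow> x \<in> W \<Longrightarrow>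
    (f has_derivative D) (at x within S \<inter> W) \<longleftrightarrow> (f has_derivative D) (at x within S)"
  by (metis at_within_nhd inf_assoc inf_idem)

lemma smooth_on_has_derivative:
  assumes "smooth_on S f" "x \<in> S"
  obtains D where "(f has_derivative D) (at x within S)"
proof -
  obtain U f' where U: "open U" "x \<in> U" "\<And>k. Ck_on k U f'" "\<And>y. y \<in> S \<Longrightarrow> y \<in> U \<Longrightarrow> f y = f' y"
    using smooth_onE[OF assms] by blast
  obtain D where "(f' has_derivative D) (at x)"
    using U(3)[of 1] U(2) by (auto simp: differentiable_def)
  then have "(f' has_derivative D) (at x within S \<inter> U)"
    by (rule has_derivative_at_withinI)
  then have "(f has_derivative D) (at x within S \<inter> U)"
    by (rule has_derivative_transform[rotated 2]) (use assms U in auto)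
  then have "(f has_derivative D) (at x within S)"
    using U(1,2) by (simp add: has_derivative_within_Int_open)
  then show thesis using that by blast
qed

text \<open>For \<open>v\<close> in \<open>L\<close> a short segment through \<open>x\<close> stays
  in \<open>S\<close>, since \<open>S\<close> is relatively open in \<open>L\<close>. Restricting to
  it gives an ordinary derivative in one variable, which is unique.\<close>

lemma has_derivative_along_line:
  assumes "(f has_derivative D) (at x within S)" "openin (top_of_set L) S" "subspace L" "x \<in> S" "v \<in> L"
  obtains e where "e > 0" "\<And>t. \<bar>t\<bar> < e \<Longrightarrow> x + t *\<^sub>R v \<in> S"
    "((\<lambda>t::real. f (x + t *\<^sub>R v)) has_derivative (\<lambda>t. t *\<^sub>R D v)) (at 0)"
proof -
  have lin: "linear D" using assms(1) has_derivative_linear by blast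
  obtain W where W: "open W" "S = L \<inter> W"
    using assms(2) unfolding openin_open by auto
  have "open ((\<lambda>t::real. x + t *\<^sub>R v) -` W)"
    by (intro open_vimage W continuous_intros)
  moreover have "0 \<in> (\<lambda>t::real. x + t *\<^sub>R v) -` W"
    using assms(4) W by simp
  ultimately obtain e where e: "e > 0" "ball 0 e \<subseteq> (\<lambda>t::real. x + t *\<^sub>R v) -` W"
    using openE by blast
  have inS: "x + t *\<^sub>R v \<in> S" if "\<bar>t\<bar> < e" for t
    using e that assms(3-5) W by (auto simp: subspace_add subspace_scale subset_iff)
  have "((\<lambda>t::real. x + t *\<^sub>R v) has_derivative (\<lambda>t. t *\<^sub>R v)) (at 0 within ball 0 e)"
    by (auto intro!: derivative_eq_intros)
  then have "((\<lambda>t::real. f (x + t *\<^sub>R v)) has_derivative (\<lambda>t. D (t *\<^sub>R v))) (at 0 within ball 0 e)"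
    using assms(1) inS e has_derivative_in_compose[of "\<lambda>t. x + t *\<^sub>R v" "\<lambda>t. t *\<^sub>R v" 0 "ball 0 e" f D]
      has_derivative_subset[of f D x S "(\<lambda>t. x + t *\<^sub>R v) ` ball 0 e"]
    by (auto simp: image_subset_iff)
  then have "((\<lambda>t::real. f (x + t *\<^sub>R v)) has_derivative (\<lambda>t. t *\<^sub>R D v)) (at 0)"
    using e(1) unfolding linear_scale[OF lin] by (subst (asm) at_within_open) auto
  with e(1) inS show thesis
    using that by blast
qed

section \<open>Manifolds, products and submersions\<close>

lemma second_countable_prod_topology:
  assumes "second_countable X" "second_countable Y"
  shows "second_countable (prod_topology X Y)"
proof -
  obtain A where A: "countable A" "\<And>V. V \<in> A \<Longrightarrow> openin X V"
      "\<And>U x. openin X U \<Longrightarrow> x \<in> U \<Longrightarrow> \<exists>V\<in>A. x \<in> V \<and> V \<subseteq> U"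
    using assms(1) unfolding second_countable_def by metis
  obtain B where B: "countable B" "\<And>V. V \<in> B \<Longrightarrow> openin Y V"
      "\<And>U x. openin Y U \<Longrightarrow> x \<in> U \<Longrightarrow> \<exists>V\<in>B. x \<in> V \<and> V \<subseteq> U"
    using assms(2) unfolding second_countable_def by metis
  let ?C = "(\<lambda>(U, V). U \<times> V) ` (A \<times> B)"
  have "countable ?C"
    using A(1) B(1) by blast
  moreover have "\<forall>V\<in>?C. openin (prod_topology X Y) V"
    using A(2) B(2) by (auto simp: openin_prod_Times_iff)
  moreover have "\<exists>V\<in>?C. z \<in> V \<and> V \<subseteq> W" if "openin (prod_topology X Y) W" "z \<in> W" for W z
  proof -
    obtain x y where z: "z = (x, y)" by fastforce
    with that have "\<exists>U V. openin X U \<and> openin Y V \<and> x \<in> U \<and> y \<in> V \<and> U \<times> V \<subseteq> W"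
      by (simp add: openin_prod_topology_alt)
    then obtain U V where UV: "openin X U" "openin Y V" "x \<in> U" "y \<in> V" "U \<times> V \<subseteq> W"
      by (elim exE conjE)
    obtain U' where "U' \<in> A" "x \<in> U'" "U' \<subseteq> U"
      using A(3) UV(1,3) by blast
    moreover obtain V' where "V' \<in> B" "y \<in> V'" "V' \<subseteq> V"
      using B(3) UV(2,4) by blast
    ultimately show ?thesis
      using UV(5) z by (intro bexI[of _ "U' \<times> V'"]) auto
  qed
  ultimately show ?thesis
    unfolding second_countable_def by (intro exI[of _ ?C] conjI allI impI) (simp_all only:)
qed

text \<open>This replaces uniqueness of derivatives, which fails transversally to \<open>L\<close>
  because \<open>S\<close> need not have interior points in the ambient space.\<close>

lemma has_derivative_eq_on_subspace:
  assumes "(f has_derivative D) (at x within S)" "(g has_derivative E) (at x within S)"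
    and "openin (top_of_set L) S" "subspace L" "x \<in> S" "v \<in> L"
    and "\<And>y. y \<in> S \<Longrightarrow> f y = g y"
  shows "D v = E v"
proof -
  have "(f has_derivative E) (at x within S)"
    using has_derivative_transform[OF assms(5,7,2)] .
  then obtain e where "((\<lambda>t::real. f (x + t *\<^sub>R v)) has_derivative (\<lambda>t. t *\<^sub>R E v)) (at 0)"
    using has_derivative_along_line assms(3-6) by metis
  moreover obtain e where "((\<lambda>t::real. f (x + t *\<^sub>R v)) has_derivative (\<lambda>t. t *\<^sub>R D v)) (at 0)"
    using has_derivative_along_line assms(1,3-6) by metis
  ultimately have "(\<lambda>t::real. t *\<^sub>R D v) = (\<lambda>t. t *\<^sub>R E v)"
    using has_derivative_unique by blast
  then show ?thesis
    by (metis scaleR_one)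
qed

lemma has_derivative_in_subspace:
  fixes f :: "'a::euclidean_space \<Rightarrow> 'b::euclidean_space"
  assumes "(f has_derivative D) (at x within S)"
    and "openin (top_of_set L) S" "subspace L" "x \<in> S" "v \<in> L"
    and "f ` S \<subseteq> L'" "subspace L'"
  shows "D v \<in> L'"
proof -
  \<comment> \<open>\<open>z\<close> is the component of \<open>D v\<close> orthogonal to
    \<open>L'\<close>. The function \<open>z \<bullet> f\<close> vanishes on \<open>S\<close>, so
    its derivative \<open>z \<bullet> D v\<close> vanishes too; as \<open>z\<close> is orthogonal to
    \<open>y\<close>, this number is \<open>z \<bullet> z\<close>.\<close>
  obtain y z where yz: "y \<in> span L'" "\<And>w. w \<in> span L' \<Longrightarrow> orthogonal z w" "D v = y + z"
    using orthogonal_subspace_decomp_exists by blast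
  have z: "z \<bullet> w = 0" if "w \<in> L'" for w
    using yz(2) that span_base unfolding orthogonal_def by blast
  have "((\<lambda>a. z \<bullet> f a) has_derivative (\<lambda>v. z \<bullet> D v)) (at x within S)"
    by (intro has_derivative_inner_right assms(1))
  moreover have "((\<lambda>a. 0::real) has_derivative (\<lambda>v. 0)) (at x within S)"
    by simp
  ultimately have "z \<bullet> D v = 0"
    using has_derivative_eq_on_subspace[OF _ _ assms(2-5), of "\<lambda>a. z \<bullet> f a" "\<lambda>v. z \<bullet> D v" "\<lambda>a. 0" "\<lambda>v. 0"]
      z assms(6) by (auto simp: image_subset_iff)
  moreover have "z \<bullet> y = 0"
    using yz(1,2) unfolding orthogonal_def by blast
  ultimately have "z = 0"
    using yz(3) by (simp add: inner_add_right)
  then show ?thesis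
    using yz assms(7) by (simp add: span_eq_iff[THEN iffD2])
qed

section \<open>Charts and smooth maps between manifolds\<close>

lemma manifoldD:
  assumes "manifold M"
  shows "Hausdorff_space (mtop M)" "second_countable (mtop M)" "subspace (model M)"
    "(\<Union>(U, \<phi>)\<in>atlas M. U) = pts M"
  using assms unfolding manifold_def by simp_all

lemma manifold_chartD:
  assumes "manifold M" "(U, \<phi>) \<in> atlas M"
  shows "openin (mtop M) U" "openin (top_of_set (model M)) (\<phi> ` U)"
    "homeomorphic_map (subtopology (mtop M) U) (top_of_set (\<phi> ` U)) \<phi>"
    "U \<subseteq> pts M" "inj_on \<phi> U"
proof -
  show *: "openin (mtop M) U" "openin (top_of_set (model M)) (\<phi> ` U)"
    "homeomorphic_map (subtopology (mtop M) U) (top_of_set (\<phi> ` U)) \<phi>"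
    using assms unfolding manifold_def by blast+
  show "U \<subseteq> pts M" using *(1) openin_subset by blast
  then show "inj_on \<phi> U"
    using homeomorphic_imp_injective_map[OF *(3)] by (simp add: inf_absorb2)
qed

lemma inv_chart:
  assumes "manifold M" "(U, \<phi>) \<in> atlas M" "x \<in> U"
  shows "inv_into U \<phi> (\<phi> x) = x"
  using manifold_chartD(5)[OF assms(1,2)] assms(3) by simp

lemma manifold_transition:
  "manifold M \<Longrightarrow> (U, \<phi>) \<in> atlas M \<Longrightarrow> (V, \<psi>) \<in> atlas M \<Longrightarrow>
    smooth_on (\<phi> ` (U \<inter> V)) (\<lambda>a. \<psi> (inv_into U \<phi> a))"
  unfolding manifold_def o_def by fast

lemma manifold_chart_at:
  assumes "manifold M" "x \<in> pts M"
  obtains U \<phi> where "(U, \<phi>) \<in> atlas M" "x \<in> U"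
  using manifoldD(4)[OF assms(1)] assms(2) by fast

text \<open>Turns relative openness on the manifold into an open set of the ambient Euclidean space,
  the form in which \<open>smooth_on_local\<close> localises. Injectivity of the chart makes images
  commute with intersections.\<close>

lemma chart_image_openin:
  assumes "manifold M" "(U, \<phi>) \<in> atlas M" "openin (subtopology (mtop M) S) T"
  obtains W where "open W" "\<phi> ` (T \<inter> U) = \<phi> ` (S \<inter> U) \<inter> W"
proof -
  note ch = manifold_chartD[OF assms(1,2)]
  obtain A where A: "openin (mtop M) A" "T = A \<inter> S"
    using assms(3) unfolding openin_subtopology by blast
  have "openin (subtopology (mtop M) U) (A \<inter> U)"
    using A(1) by (auto simp: openin_subtopology)
  then have "openin (top_of_set (\<phi> ` U)) (\<phi> ` (A \<inter> U))"
    using homeomorphic_imp_open_map[OF ch(3)] unfolding open_map_def by blast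
  then obtain W where W: "open W" "\<phi> ` (A \<inter> U) = \<phi> ` U \<inter> W"
    unfolding openin_open by blast
  have "\<phi> ` (T \<inter> U) = \<phi> ` (S \<inter> U) \<inter> \<phi> ` (A \<inter> U)"
    using A(2) inj_on_image_Int[OF ch(5), of "S \<inter> U" "A \<inter> U"] by (simp add: Int_ac)
  then have "\<phi> ` (T \<inter> U) = \<phi> ` (S \<inter> U) \<inter> W"
    using W(2) by blast
  with W(1) show thesis by (rule that)
qed

lemma smooth_map_onI:
  assumes "continuous_map (subtopology (mtop M) S) (mtop N) f"
    and "\<And>U \<phi> V \<psi>. (U, \<phi>) \<in> atlas M \<Longrightarrow> (V, \<psi>) \<in> atlas N \<Longrightarrow>
       smooth_on (\<phi> ` {x \<in> S \<inter> U. f x \<in> V}) (\<lambda>a. \<psi> (f (inv_into U \<phi> a)))"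
  shows "smooth_map_on S M N f"
  using assms unfolding smooth_map_on_def o_def by fast

lemma smooth_map_on_continuous:
  "smooth_map_on S M N f \<Longrightarrow> continuous_map (subtopology (mtop M) S) (mtop N) f"
  unfolding smooth_map_on_def by blast

lemma smooth_map_continuous:
  "smooth_map M N f \<Longrightarrow> continuous_map (mtop M) (mtop N) f"
  using smooth_map_on_continuous[of "pts M" M N f] by simp

lemma smooth_map_on_chart:
  "smooth_map_on S M N f \<Longrightarrow> (U, \<phi>) \<in> atlas M \<Longrightarrow> (V, \<psi>) \<in> atlas N \<Longrightarrow>
    smooth_on (\<phi> ` {x \<in> S \<inter> U. f x \<in> V}) (\<lambda>a. \<psi> (f (inv_into U \<phi> a)))"
  unfolding smooth_map_on_def o_def by fast

lemma smooth_map_on_pts: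
  "smooth_map_on S M N f \<Longrightarrow> x \<in> S \<Longrightarrow> x \<in> pts M \<Longrightarrow> f x \<in> pts N"
  using continuous_map_image_subset_topspace[OF smooth_map_on_continuous, of S M N f]
  by (auto simp: image_subset_iff)

lemma smooth_map_on_compose:
  assumes "manifold M" "manifold N"
    and f: "smooth_map_on S M N f" and g: "smooth_map_on T N P g"
    and sub: "\<And>x. x \<in> S \<Longrightarrow> x \<in> pts M \<Longrightarrow> f x \<in> T"
  shows "smooth_map_on S M P (\<lambda>x. g (f x))"
proof (rule smooth_map_onI)
  have "continuous_map (subtopology (mtop M) S) (subtopology (mtop N) T) f"
    by (rule continuous_map_into_subtopology[OF smooth_map_on_continuous[OF f]]) (use sub in auto)
  from continuous_map_compose[OF this smooth_map_on_continuous[OF g]]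
  show "continuous_map (subtopology (mtop M) S) (mtop P) (\<lambda>x. g (f x))"
    unfolding o_def .
next
  fix U \<phi> W \<xi>
  assume U: "(U, \<phi>) \<in> atlas M" and W: "(W, \<xi>) \<in> atlas P"
  let ?A = "{x \<in> S \<inter> U. g (f x) \<in> W}"
  note Usub = manifold_chartD(4)[OF assms(1) U]
  show "smooth_on (\<phi> ` ?A) (\<lambda>a. \<xi> (g (f (inv_into U \<phi> a))))"
  proof (rule smooth_on_local)
    fix a assume "a \<in> \<phi> ` ?A"
    then obtain x where x: "x \<in> ?A" "a = \<phi> x" by blast
    have "f x \<in> pts N"
      using smooth_map_on_pts[OF f] x(1) Usub by blast
    then obtain V \<psi> where V: "(V, \<psi>) \<in> atlas N" "f x \<in> V"
      using manifold_chart_at[OF assms(2)] by blast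
    have "openin (subtopology (mtop M) S) {y \<in> topspace (subtopology (mtop M) S). f y \<in> V}"
      by (rule openin_continuous_map_preimage[OF smooth_map_on_continuous[OF f] 
            manifold_chartD(1)[OF assms(2) V(1)]])
    \<comment> \<open>\<open>Z\<close> cuts out of the chart image the points that \<open>f\<close>
      sends into the one chart \<open>V\<close> around \<open>f x\<close>; there the coordinate
      expression factors through \<open>\<psi>\<close>.\<close>
    then obtain Z where Z: "open Z"
      "\<phi> ` ({y \<in> topspace (subtopology (mtop M) S). f y \<in> V} \<inter> U) = \<phi> ` (S \<inter> U) \<inter> Z"
      using chart_image_openin[OF assms(1) U] by blast
    let ?B = "{y \<in> ?A. f y \<in> V}"
    have fz: "f y \<in> V" if "y \<in> S \<inter> U" "\<phi> y \<in> Z" for y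
    proof -
      have "\<phi> y \<in> \<phi> ` ({y \<in> topspace (subtopology (mtop M) S). f y \<in> V} \<inter> U)"
        unfolding Z(2) using that by blast
      then show ?thesis
        using inj_onD[OF manifold_chartD(5)[OF assms(1) U]] that(1) by blast
    qed
    have eq: "\<phi> ` ?A \<inter> Z \<subseteq> \<phi> ` ?B"
      using fz by auto
    have "smooth_on (\<phi> ` ?B) (\<lambda>a. \<psi> (f (inv_into U \<phi> a)))"
      by (rule smooth_on_subset[OF smooth_map_on_chart[OF f U V(1)]]) auto
    moreover have "smooth_on (\<psi> ` {y \<in> T \<inter> V. g y \<in> W}) (\<lambda>b. \<xi> (g (inv_into V \<psi> b)))"
      by (rule smooth_map_on_chart[OF g V(1) W])
    moreover have "(\<lambda>a. \<psi> (f (inv_into U \<phi> a))) ` \<phi> ` ?B \<subseteq> \<psi> ` {y \<in> T \<inter> V. g y \<in> W}"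
      using sub Usub by (auto simp: inv_chart[OF assms(1) U])
    ultimately have "smooth_on (\<phi> ` ?B) (\<lambda>a. \<xi> (g (inv_into V \<psi> (\<psi> (f (inv_into U \<phi> a))))))"
      by (rule smooth_on_compose)
    then have "smooth_on (\<phi> ` ?B) (\<lambda>a. \<xi> (g (f (inv_into U \<phi> a))))"
      by (rule smooth_on_cong) (auto simp: inv_chart[OF assms(1) U] inv_chart[OF assms(2) V(1)])
    then have "smooth_on (\<phi> ` ?A \<inter> Z) (\<lambda>a. \<xi> (g (f (inv_into U \<phi> a))))"
      using eq by (rule smooth_on_subset)
    moreover have "a \<in> Z"
    proof -
      have "\<phi> x \<in> \<phi> ` ({y \<in> topspace (subtopology (mtop M) S). f y \<in> V} \<inter> U)"
        using x(1) V(2) Usub by auto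
      then show ?thesis unfolding Z(2) x(2) by blast
    qed
    ultimately show "\<exists>Z. open Z \<and> a \<in> Z \<and> smooth_on (\<phi> ` ?A \<inter> Z) (\<lambda>a. \<xi> (g (f (inv_into U \<phi> a))))"
      using Z(1) by blast
  qed
qed

lemma smooth_map_compose:
  "manifold M \<Longrightarrow> manifold N \<Longrightarrow> smooth_map_on S M N f \<Longrightarrow> smooth_map N P g \<Longrightarrow>
    smooth_map_on S M P (\<lambda>x. g (f x))"
  by (rule smooth_map_on_compose) (auto dest: smooth_map_on_pts)

lemma smooth_map_on_subset:
  assumes "smooth_map_on S M N f" "T \<subseteq> S"
  shows "smooth_map_on T M N f"
proof (rule smooth_map_onI)
  show "continuous_map (subtopology (mtop M) T) (mtop N) f"
    using continuous_map_from_subtopology_mono[OF smooth_map_on_continuous[OF assms(1)] assms(2)] .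
qed (rule smooth_on_subset[OF smooth_map_on_chart[OF assms(1)]], use assms(2) in auto)

lemma smooth_map_on_cong:
  assumes "manifold M" "smooth_map_on S M N f" "\<And>x. x \<in> S \<Longrightarrow> x \<in> pts M \<Longrightarrow> f x = g x"
  shows "smooth_map_on S M N g"
proof (rule smooth_map_onI)
  show "continuous_map (subtopology (mtop M) S) (mtop N) g"
    by (rule continuous_map_eq[OF smooth_map_on_continuous[OF assms(2)]]) (use assms(3) in auto)
next
  fix U \<phi> V \<psi>
  assume U: "(U, \<phi>) \<in> atlas M" and V: "(V, \<psi>) \<in> atlas N"
  have *: "f x = g x" if "x \<in> S" "x \<in> U" for x
    using assms(3) manifold_chartD(4)[OF assms(1) U] that by blast
  then have "{x \<in> S \<inter> U. f x \<in> V} = {x \<in> S \<inter> U. g x \<in> V}"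
    by auto
  with smooth_map_on_chart[OF assms(2) U V]
  have "smooth_on (\<phi> ` {x \<in> S \<inter> U. g x \<in> V}) (\<lambda>a. \<psi> (f (inv_into U \<phi> a)))"
    by simp
  then show "smooth_on (\<phi> ` {x \<in> S \<inter> U. g x \<in> V}) (\<lambda>a. \<psi> (g (inv_into U \<phi> a)))"
    by (rule smooth_on_cong) (auto simp: inv_chart[OF assms(1) U] *)
qed

lemma smooth_map_on_ident: "manifold M \<Longrightarrow> smooth_map_on S M M (\<lambda>x. x)"
proof (rule smooth_map_onI)
  fix U \<phi> V \<psi>
  assume "manifold M" "(U, \<phi>) \<in> atlas M" "(V, \<psi>) \<in> atlas M"
  then show "smooth_on (\<phi> ` {x \<in> S \<inter> U. x \<in> V}) (\<lambda>a. \<psi> (inv_into U \<phi> a))"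
    by (intro smooth_on_subset[OF manifold_transition]) auto
qed (simp add: continuous_map_from_subtopology)

section \<open>Products of manifolds\<close>

lemma prod_mfd_sel [simp]:
  "mtop (prod_mfd M N) = prod_topology (mtop M) (mtop N)"
  "model (prod_mfd M N) = model M \<times> model N"
  by (simp_all add: prod_mfd_def)

lemma atlas_prod_mfdI:
  "(U, \<phi>) \<in> atlas M \<Longrightarrow> (V, \<psi>) \<in> atlas N \<Longrightarrow> (U \<times> V, map_prod \<phi> \<psi>) \<in> atlas (prod_mfd M N)"
  unfolding prod_mfd_def by auto

lemma atlas_prod_mfdE:
  assumes "(W, \<xi>) \<in> atlas (prod_mfd M N)"
  obtains U \<phi> V \<psi> where "W = U \<times> V" "\<xi> = map_prod \<phi> \<psi>" "(U, \<phi>) \<in> atlas M" "(V, \<psi>) \<in> atlas N"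
  using assms unfolding prod_mfd_def by auto

lemma inv_into_map_prod:
  assumes "inj_on \<phi> U" "inj_on \<psi> V" "a \<in> \<phi> ` U" "b \<in> \<psi> ` V"
  shows "inv_into (U \<times> V) (map_prod \<phi> \<psi>) (a, b) = (inv_into U \<phi> a, inv_into V \<psi> b)"
  using assms by (intro inv_into_f_eq map_prod_inj_on) (auto simp: inv_into_into f_inv_into_f)

lemma manifold_prod_mfd:
  assumes M: "manifold M" and N: "manifold N"
  shows "manifold (prod_mfd M N)"
  unfolding manifold_def
proof (intro conjI)
  show "Hausdorff_space (mtop (prod_mfd M N))"
    using manifoldD(1)[OF M] manifoldD(1)[OF N] by (simp add: Hausdorff_space_prod_topology)
  show "second_countable (mtop (prod_mfd M N))"
    using manifoldD(2)[OF M] manifoldD(2)[OF N] by (simp add: second_countable_prod_topology)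
  show "subspace (model (prod_mfd M N))"
    using manifoldD(3)[OF M] manifoldD(3)[OF N] by (simp add: subspace_Times)
  show "(\<Union>(U, \<phi>)\<in>atlas (prod_mfd M N). U) = pts (prod_mfd M N)"
  proof (intro equalityI subsetI)
    fix p assume "p \<in> (\<Union>(U, \<phi>)\<in>atlas (prod_mfd M N). U)"
    then obtain W \<xi> where "(W, \<xi>) \<in> atlas (prod_mfd M N)" "p \<in> W"
      by blast
    then obtain U \<phi> V \<psi> where "p \<in> U \<times> V" "(U, \<phi>) \<in> atlas M" "(V, \<psi>) \<in> atlas N"
      by (blast elim: atlas_prod_mfdE)
    then show "p \<in> pts (prod_mfd M N)"
      using manifold_chartD(4)[OF M] manifold_chartD(4)[OF N] by fastforce
  next
    fix p assume "p \<in> pts (prod_mfd M N)"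
    then have p: "fst p \<in> pts M" "snd p \<in> pts N"
      by auto
    obtain U \<phi> where U: "(U, \<phi>) \<in> atlas M" "fst p \<in> U"
      using manifold_chart_at[OF M p(1)] .
    obtain V \<psi> where V: "(V, \<psi>) \<in> atlas N" "snd p \<in> V"
      using manifold_chart_at[OF N p(2)] .
    show "p \<in> (\<Union>(U, \<phi>)\<in>atlas (prod_mfd M N). U)"
      using atlas_prod_mfdI[OF U(1) V(1)] U(2) V(2) by (intro UN_I) (auto simp: mem_Times_iff)
  qed
  show "\<forall>(W, \<xi>)\<in>atlas (prod_mfd M N). openin (mtop (prod_mfd M N)) W \<and>
      openin (top_of_set (model (prod_mfd M N))) (\<xi> ` W) \<and>
      homeomorphic_map (subtopology (mtop (prod_mfd M N)) W) (top_of_set (\<xi> ` W)) \<xi>"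
  proof (clarify elim!: atlas_prod_mfdE)
    fix U \<phi> V \<psi> assume U: "(U, \<phi>) \<in> atlas M" and V: "(V, \<psi>) \<in> atlas N"
    note u = manifold_chartD[OF M U] and v = manifold_chartD[OF N V]
    have im: "map_prod \<phi> \<psi> ` (U \<times> V) = \<phi> ` U \<times> \<psi> ` V"
      by auto
    obtain \<phi>' \<psi>' where "homeomorphic_maps (subtopology (mtop M) U) (top_of_set (\<phi> ` U)) \<phi> \<phi>'"
      "homeomorphic_maps (subtopology (mtop N) V) (top_of_set (\<psi> ` V)) \<psi> \<psi>'"
      using u(3) v(3) homeomorphic_map_maps by metis
    then have "homeomorphic_maps (prod_topology (subtopology (mtop M) U) (subtopology (mtop N) V)) 
        (prod_topology (top_of_set (\<phi> ` U)) (top_of_set (\<psi> ` V))) (\<lambda>(x,y). (\<phi> x, \<psi> y)) (\<lambda>(x,y). (\<phi>' x, \<psi>' y))"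
      by (simp only: homeomorphic_maps_prod simp_thms)
    then have "homeomorphic_map (subtopology (prod_topology (mtop M) (mtop N)) (U \<times> V))
        (top_of_set (\<phi> ` U \<times> \<psi> ` V)) (\<lambda>(x,y). (\<phi> x, \<psi> y))"
      using homeomorphic_map_maps by (metis subtopology_Times prod_topology_subtopology_eu)
    moreover have "openin (top_of_set (model M \<times> model N)) (\<phi> ` U \<times> \<psi> ` V)"
      using u(2) v(2) by (rule openin_Times)
    ultimately show "openin (mtop (prod_mfd M N)) (U \<times> V) \<and>
      openin (top_of_set (model (prod_mfd M N))) (map_prod \<phi> \<psi> ` (U \<times> V)) \<and>
      homeomorphic_map (subtopology (mtop (prod_mfd M N)) (U \<times> V))
        (top_of_set (map_prod \<phi> \<psi> ` (U \<times> V))) (map_prod \<phi> \<psi>)"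
      unfolding im using u(1) v(1) by (simp add: openin_prod_Times_iff map_prod_def)
  qed
  show "\<forall>(W, \<xi>)\<in>atlas (prod_mfd M N). \<forall>(W', \<xi>')\<in>atlas (prod_mfd M N).
      smooth_on (\<xi> ` (W \<inter> W')) (\<xi>' \<circ> inv_into W \<xi>)"
  proof (clarify elim!: atlas_prod_mfdE)
    fix U \<phi> V \<psi> U' \<phi>' V' \<psi>' 
    assume U: "(U, \<phi>) \<in> atlas M" and V: "(V, \<psi>) \<in> atlas N"
      and U': "(U', \<phi>') \<in> atlas M" and V': "(V', \<psi>') \<in> atlas N"
    let ?S = "\<phi> ` (U \<inter> U') \<times> \<psi> ` (V \<inter> V')"
    have "smooth_on ?S (\<lambda>p. (\<phi>' (inv_into U \<phi> (fst p)), \<psi>' (inv_into V \<psi> (snd p))))"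
      by (intro smooth_on_Pair
        smooth_on_compose[OF smooth_on_bounded_linear[OF bounded_linear_fst] manifold_transition[OF M U U']]
        smooth_on_compose[OF smooth_on_bounded_linear[OF bounded_linear_snd] manifold_transition[OF N V V']]) auto
    then have "smooth_on ?S (map_prod \<phi>' \<psi>' \<circ> inv_into (U \<times> V) (map_prod \<phi> \<psi>))"
      by (rule smooth_on_cong)
        (auto simp: inv_into_map_prod[OF manifold_chartD(5)[OF M U] manifold_chartD(5)[OF N V]])
    moreover have "map_prod \<phi> \<psi> ` (U \<times> V \<inter> U' \<times> V') = ?S"
      by auto
    ultimately show "smooth_on (map_prod \<phi> \<psi> ` (U \<times> V \<inter> U' \<times> V'))
        (map_prod \<phi>' \<psi>' \<circ> inv_into (U \<times> V) (map_prod \<phi> \<psi>))"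
      by simp
  qed
qed

lemma smooth_map_on_Pair:
  assumes "manifold M" and f: "smooth_map_on S M N f" and g: "smooth_map_on S M P g"
  shows "smooth_map_on S M (prod_mfd N P) (\<lambda>x. (f x, g x))"
proof (rule smooth_map_onI)
  show "continuous_map (subtopology (mtop M) S) (mtop (prod_mfd N P)) (\<lambda>x. (f x, g x))"
    using f g by (simp add: continuous_map_pairedI smooth_map_on_continuous)
next
  fix U \<phi> W \<xi>
  assume U: "(U, \<phi>) \<in> atlas M" and "(W, \<xi>) \<in> atlas (prod_mfd N P)"
  then obtain V \<psi> V' \<psi>' where W: "W = V \<times> V'" "\<xi> = map_prod \<psi> \<psi>'"
    and V: "(V, \<psi>) \<in> atlas N" and V': "(V', \<psi>') \<in> atlas P"
    by (blast elim: atlas_prod_mfdE)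
  let ?A = "\<phi> ` {x \<in> S \<inter> U. (f x, g x) \<in> W}"
  have "smooth_on ?A (\<lambda>a. (\<psi> (f (inv_into U \<phi> a)), \<psi>' (g (inv_into U \<phi> a))))"
    by (intro smooth_on_Pair smooth_on_subset[OF smooth_map_on_chart[OF f U V]]
        smooth_on_subset[OF smooth_map_on_chart[OF g U V']]) (auto simp: W)
  then show "smooth_on ?A (\<lambda>a. \<xi> (f (inv_into U \<phi> a), g (inv_into U \<phi> a)))"
    unfolding W by simp
qed

lemma smooth_map_fst:
  assumes M: "manifold M" and N: "manifold N"
  shows "smooth_map (prod_mfd M N) M fst"
proof (rule smooth_map_onI)
  show "continuous_map (subtopology (mtop (prod_mfd M N)) (pts (prod_mfd M N))) (mtop M) fst"
    by (simp add: continuous_map_fst continuous_map_from_subtopology)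
next
  fix W \<xi> U' \<phi>'
  assume "(W, \<xi>) \<in> atlas (prod_mfd M N)" and U': "(U', \<phi>') \<in> atlas M"
  then obtain U \<phi> V \<psi> where W: "W = U \<times> V" "\<xi> = map_prod \<phi> \<psi>"
    and U: "(U, \<phi>) \<in> atlas M" and V: "(V, \<psi>) \<in> atlas N"
    by (blast elim: atlas_prod_mfdE)
  let ?A = "\<xi> ` {x \<in> pts (prod_mfd M N) \<inter> W. fst x \<in> U'}"
  have "smooth_on ?A (\<lambda>p. \<phi>' (inv_into U \<phi> (fst p)))"
    by (rule smooth_on_compose[OF smooth_on_bounded_linear[OF bounded_linear_fst] manifold_transition[OF M U U']])
      (auto simp: W)
  then show "smooth_on ?A (\<lambda>a. \<phi>' (fst (inv_into W \<xi> a)))"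
    by (rule smooth_on_cong)
      (auto simp: W inv_into_map_prod[OF manifold_chartD(5)[OF M U] manifold_chartD(5)[OF N V]])
qed

lemma smooth_map_snd:
  assumes M: "manifold M" and N: "manifold N"
  shows "smooth_map (prod_mfd M N) N snd"
proof (rule smooth_map_onI)
  show "continuous_map (subtopology (mtop (prod_mfd M N)) (pts (prod_mfd M N))) (mtop N) snd"
    by (simp add: continuous_map_snd continuous_map_from_subtopology)
next
  fix W \<xi> V' \<psi>'
  assume "(W, \<xi>) \<in> atlas (prod_mfd M N)" and V': "(V', \<psi>') \<in> atlas N"
  then obtain U \<phi> V \<psi> where W: "W = U \<times> V" "\<xi> = map_prod \<phi> \<psi>"
    and U: "(U, \<phi>) \<in> atlas M" and V: "(V, \<psi>) \<in> atlas N"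
    by (blast elim: atlas_prod_mfdE)
  let ?A = "\<xi> ` {x \<in> pts (prod_mfd M N) \<inter> W. snd x \<in> V'}"
  have "smooth_on ?A (\<lambda>p. \<psi>' (inv_into V \<psi> (snd p)))"
    by (rule smooth_on_compose[OF smooth_on_bounded_linear[OF bounded_linear_snd] manifold_transition[OF N V V']])
      (auto simp: W)
  then show "smooth_on ?A (\<lambda>a. \<psi>' (snd (inv_into W \<xi> a)))"
    by (rule smooth_on_cong)
      (auto simp: W inv_into_map_prod[OF manifold_chartD(5)[OF M U] manifold_chartD(5)[OF N V]])
qed

section \<open>Surjective submersions and diffeomorphisms\<close>

lemma surjective_submersionI:
  assumes "smooth_map M N f" "f ` pts M = pts N"
    and "\<And>U \<phi> V \<psi> x. (U, \<phi>) \<in> atlas M \<Longrightarrow> (V, \<psi>) \<in> atlas N \<Longrightarrow> x \<in> U \<Longrightarrow> f x \<in> V \<Longrightarrow>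
        \<exists>D. ((\<lambda>a. \<psi> (f (inv_into U \<phi> a))) has_derivative D)
                (at (\<phi> x) within \<phi> ` {x' \<in> U. f x' \<in> V}) \<and> D ` model M = model N"
  shows "surjective_submersion M N f"
  using assms unfolding surjective_submersion_def o_def by fast

lemma surjective_submersion_derivative:
  assumes "surjective_submersion M N f" "(U, \<phi>) \<in> atlas M" "(V, \<psi>) \<in> atlas N" "x \<in> U" "f x \<in> V"
  obtains D where "((\<lambda>a. \<psi> (f (inv_into U \<phi> a))) has_derivative D)
                (at (\<phi> x) within \<phi> ` {x' \<in> U. f x' \<in> V})" "D ` model M = model N"
  using assms unfolding surjective_submersion_def o_def by fast

lemma surjective_submersion_smooth: "surjective_submersion M N f \<Longrightarrow> smooth_map M N f"
  and surjective_submersion_image: "surjective_submersion M N f \<Longrightarrow> f ` pts M = pts N"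
  unfolding surjective_submersion_def by auto

text \<open>One open set \<open>W\<close> describes the condition \<open>f x \<in> V\<close> in the
  chart for every subset \<open>T\<close> of \<open>U\<close> at once. Derivatives within the larger
  and the smaller coordinate set can then be exchanged by
  \<open>has_derivative_within_Int_open\<close>.\<close>

lemma chart_preimage_open:
  assumes "manifold M" "manifold N" "smooth_map M N f" "(U, \<phi>) \<in> atlas M" "(V, \<psi>) \<in> atlas N"
  obtains W where "open W" "\<And>T. T \<subseteq> U \<Longrightarrow> \<phi> ` {x \<in> T. f x \<in> V} = \<phi> ` T \<inter> W"
proof -
  have "openin (mtop M) {x \<in> pts M. f x \<in> V}"
    using openin_continuous_map_preimage[OF smooth_map_continuous[OF assms(3)] manifold_chartD(1)[OF assms(2,5)]] .
  then obtain W where W: "open W" "\<phi> ` ({x \<in> pts M. f x \<in> V} \<inter> U) = \<phi> ` (pts M \<inter> U) \<inter> W"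
    using chart_image_openin[OF assms(1,4), of "pts M"] by auto
  have Usub: "U \<subseteq> pts M" by (rule manifold_chartD(4)[OF assms(1,4)])
  have *: "f x \<in> V \<longleftrightarrow> \<phi> x \<in> W" if "x \<in> U" for x
  proof
    assume "f x \<in> V"
    then have "\<phi> x \<in> \<phi> ` ({x \<in> pts M. f x \<in> V} \<inter> U)"
      using that Usub by blast
    then show "\<phi> x \<in> W" unfolding W(2) by blast
  next
    assume "\<phi> x \<in> W"
    then have "\<phi> x \<in> \<phi> ` ({x \<in> pts M. f x \<in> V} \<inter> U)"
      unfolding W(2) using that Usub by blast
    then show "f x \<in> V"
      using inj_onD[OF manifold_chartD(5)[OF assms(1,4)]] that by blast
  qed
  show thesis
    by (rule that[OF W(1)]) (use * in auto)
qed

lemma surjective_submersion_compose: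
  assumes M: "manifold M" and N: "manifold N" and P: "manifold P"
    and f: "surjective_submersion M N f" and g: "surjective_submersion N P g"
  shows "surjective_submersion M P (\<lambda>x. g (f x))"
proof (rule surjective_submersionI)
  show "smooth_map M P (\<lambda>x. g (f x))"
    by (rule smooth_map_compose[OF M N]) (use f g in \<open>auto intro: surjective_submersion_smooth\<close>)
  show "(\<lambda>x. g (f x)) ` pts M = pts P"
    using surjective_submersion_image[OF f] surjective_submersion_image[OF g] by (metis image_image)
next
  fix U \<phi> W \<xi> x
  assume U: "(U, \<phi>) \<in> atlas M" and W: "(W, \<xi>) \<in> atlas P" and x: "x \<in> U" and gx: "g (f x) \<in> W"
  let ?A = "{x' \<in> U. g (f x') \<in> W}"
  have "f x \<in> pts N"
    using surjective_submersion_image[OF f] x manifold_chartD(4)[OF M U] by blast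
  then obtain V \<psi> where V: "(V, \<psi>) \<in> atlas N" "f x \<in> V"
    using manifold_chart_at[OF N] by blast
  obtain Z where Z: "open Z" "\<And>T. T \<subseteq> U \<Longrightarrow> \<phi> ` {x \<in> T. f x \<in> V} = \<phi> ` T \<inter> Z"
    using chart_preimage_open[OF M N surjective_submersion_smooth[OF f] U V(1)] by blast
  \<comment> \<open>The chain rule applies only where \<open>f\<close> lands in the intermediate
    chart \<open>V\<close>. In coordinates \<open>?B\<close> is \<open>?A\<close> cut by an open
    set, so a derivative within the one is a derivative within the other.\<close>
  let ?B = "{x' \<in> ?A. f x' \<in> V}"
  have B: "\<phi> ` ?B = \<phi> ` ?A \<inter> Z" by (rule Z(2)) auto
  obtain D where D: "((\<lambda>a. \<psi> (f (inv_into U \<phi> a))) has_derivative D)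
                (at (\<phi> x) within \<phi> ` {x' \<in> U. f x' \<in> V})" "D ` model M = model N"
    using surjective_submersion_derivative[OF f U V(1) x V(2)] .
  obtain E where E: "((\<lambda>a. \<xi> (g (inv_into V \<psi> a))) has_derivative E)
                (at (\<psi> (f x)) within \<psi> ` {x' \<in> V. g x' \<in> W})" "E ` model N = model P"
    using surjective_submersion_derivative[OF g V(1) W V(2) gx] .
  have inv: "inv_into U \<phi> (\<phi> y) = y" if "y \<in> U" for y
    using inv_chart[OF M U that] .
  have "((\<lambda>a. \<psi> (f (inv_into U \<phi> a))) has_derivative D) (at (\<phi> x) within \<phi> ` ?B)"
    by (rule has_derivative_subset[OF D(1)]) auto
  moreover have "((\<lambda>a. \<xi> (g (inv_into V \<psi> a))) has_derivative E)
     (at (\<psi> (f (inv_into U \<phi> (\<phi> x)))) within (\<lambda>a. \<psi> (f (inv_into U \<phi> a))) ` \<phi> ` ?B)"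
    unfolding inv[OF x] by (rule has_derivative_subset[OF E(1)]) (auto simp: inv)
  ultimately have "((\<lambda>a. \<xi> (g (inv_into V \<psi> (\<psi> (f (inv_into U \<phi> a)))))) has_derivative (\<lambda>v. E (D v)))
     (at (\<phi> x) within \<phi> ` ?B)"
    by (rule has_derivative_in_compose)
  then have "((\<lambda>a. \<xi> (g (f (inv_into U \<phi> a)))) has_derivative (\<lambda>v. E (D v))) (at (\<phi> x) within \<phi> ` ?B)"
    by (rule has_derivative_transform[rotated 2]) (use x V gx in \<open>auto simp: inv inv_chart[OF N V(1)]\<close>)
  moreover have "\<phi> x \<in> Z"
    using B x V gx by blast
  ultimately have "((\<lambda>a. \<xi> (g (f (inv_into U \<phi> a)))) has_derivative (\<lambda>v. E (D v))) (at (\<phi> x) within \<phi> ` ?A)"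
    unfolding B using Z(1) by (simp add: has_derivative_within_Int_open)
  moreover have "(\<lambda>v. E (D v)) ` model M = model P"
    using D(2) E(2) by (metis image_image)
  ultimately show "\<exists>D. ((\<lambda>a. \<xi> (g (f (inv_into U \<phi> a)))) has_derivative D)
                (at (\<phi> x) within \<phi> ` ?A) \<and> D ` model M = model P"
    by blast
qed

lemma diffeomorphism_smooth: "diffeomorphism M N f \<Longrightarrow> smooth_map M N f"
  unfolding diffeomorphism_def by blast

lemma diffeomorphismI:
  assumes "smooth_map M N f" "smooth_map N M g"
    and "\<And>x. x \<in> pts M \<Longrightarrow> g (f x) = x" "\<And>y. y \<in> pts N \<Longrightarrow> f (g y) = y"
  shows "diffeomorphism M N f"
  using assms unfolding diffeomorphism_def by blast

text \<open>In coordinates, \<open>F\<close> and \<open>K\<close> are inverse to each other, so the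
  chain rule gives \<open>D (E w) = w\<close> for \<open>w\<close> in \<open>model N\<close>. That
  the image of \<open>model M\<close> is exactly \<open>model N\<close> also needs \<open>D\<close>
  and \<open>E\<close> to map the model spaces into each other, which
  \<open>has_derivative_in_subspace\<close> provides.\<close>

lemma diffeomorphism_imp_surjective_submersion:
  assumes M: "manifold M" and N: "manifold N" and "diffeomorphism M N f"
  shows "surjective_submersion M N f"
proof -
  obtain g where f: "smooth_map M N f" and g: "smooth_map N M g"
    and gf: "\<And>x. x \<in> pts M \<Longrightarrow> g (f x) = x" and fg: "\<And>y. y \<in> pts N \<Longrightarrow> f (g y) = y"
    using assms(3) unfolding diffeomorphism_def by blast
  show ?thesis
  proof (rule surjective_submersionI)
    show "smooth_map M N f" by fact
    show "f ` pts M = pts N"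
      using smooth_map_on_pts[OF f] smooth_map_on_pts[OF g] fg by (auto simp: image_iff) metis
  next
    fix U \<phi> V \<psi> x
    assume U: "(U, \<phi>) \<in> atlas M" and V: "(V, \<psi>) \<in> atlas N" and x: "x \<in> U" and fx: "f x \<in> V"
    note u = manifold_chartD[OF M U] and v = manifold_chartD[OF N V]
    have iu: "inv_into U \<phi> (\<phi> y) = y" if "y \<in> U" for y
      using inv_chart[OF M U that] .
    have iv: "inv_into V \<psi> (\<psi> y) = y" if "y \<in> V" for y
      using inv_chart[OF N V that] .
    have guv: "g (f y) = y" if "y \<in> U" for y using gf that u(4) by blast
    have fgv: "f (g y) = y" if "y \<in> V" for y using fg that v(4) by blast
    define F where "F = (\<lambda>a. \<psi> (f (inv_into U \<phi> a)))"
    define K where "K = (\<lambda>a. \<phi> (g (inv_into V \<psi> a)))"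
    define S where "S = \<phi> ` {x' \<in> U. f x' \<in> V}"
    define T where "T = \<psi> ` {y \<in> V. g y \<in> U}"
    obtain W where W: "open W" "\<And>T. T \<subseteq> U \<Longrightarrow> \<phi> ` {x \<in> T. f x \<in> V} = \<phi> ` T \<inter> W"
      using chart_preimage_open[OF M N f U V] by blast
    obtain Z where Z: "open Z" "\<And>T. T \<subseteq> V \<Longrightarrow> \<psi> ` {x \<in> T. g x \<in> U} = \<psi> ` T \<inter> Z"
      using chart_preimage_open[OF N M g V U] by blast
    have S: "openin (top_of_set (model M)) S"
      unfolding S_def W(2)[OF order_refl] using u(2) W(1) by (rule openin_Int_open)
    have T: "openin (top_of_set (model N)) T"
      unfolding T_def Z(2)[OF order_refl] using v(2) Z(1) by (rule openin_Int_open)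
    have FS: "F ` S \<subseteq> T" and KT: "K ` T \<subseteq> S"
      unfolding F_def K_def S_def T_def by (auto simp: iu iv guv fgv)
    have FK: "F (K b) = b" if "b \<in> T" for b
      using that unfolding F_def K_def T_def by (auto simp: iu iv fgv)
    have pU: "{x \<in> pts M \<inter> U. f x \<in> V} = {x' \<in> U. f x' \<in> V}"
      "{y \<in> pts N \<inter> V. g y \<in> U} = {y \<in> V. g y \<in> U}"
      using u(4) v(4) by auto
    have xS: "\<phi> x \<in> S" and fxT: "\<psi> (f x) \<in> T" and Kx: "K (\<psi> (f x)) = \<phi> x"
      unfolding F_def K_def S_def T_def using x fx by (auto simp: iu iv guv)
    have "smooth_on S F"
      using smooth_map_on_chart[OF f U V] unfolding F_def S_def pU .
    then obtain D where D: "(F has_derivative D) (at (\<phi> x) within S)"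
      using smooth_on_has_derivative xS by blast
    have "smooth_on T K"
      using smooth_map_on_chart[OF g V U] unfolding K_def T_def pU .
    then obtain E where E: "(K has_derivative E) (at (\<psi> (f x)) within T)"
      using smooth_on_has_derivative fxT by blast
    have SM: "S \<subseteq> model M" and TN: "T \<subseteq> model N"
      using S T openin_imp_subset by blast+
    have DM: "D w \<in> model N" if "w \<in> model M" for w
      using has_derivative_in_subspace[OF D S manifoldD(3)[OF M] xS that _ manifoldD(3)[OF N]] FS TN by blast
    have EN: "E w \<in> model M" if "w \<in> model N" for w
      using has_derivative_in_subspace[OF E T manifoldD(3)[OF N] fxT that _ manifoldD(3)[OF M]] KT SM by blast
    have "(F has_derivative D) (at (K (\<psi> (f x))) within K ` T)"
      unfolding Kx using D KT by (rule has_derivative_subset)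
    from has_derivative_in_compose[OF E this]
    have DE: "((\<lambda>b. F (K b)) has_derivative (\<lambda>w. D (E w))) (at (\<psi> (f x)) within T)" .
    have "D (E w) = w" if "w \<in> model N" for w
      using has_derivative_eq_on_subspace[OF DE has_derivative_ident T manifoldD(3)[OF N] fxT that] FK by blast
    then have "D ` model M = model N"
      using DM EN by (auto simp: image_iff) metis
    then show "\<exists>D. ((\<lambda>a. \<psi> (f (inv_into U \<phi> a))) has_derivative D)
                (at (\<phi> x) within \<phi> ` {x' \<in> U. f x' \<in> V}) \<and> D ` model M = model N"
      using D unfolding F_def S_def by blast
  qed
qed

text \<open>Different charts may occur at the two ends, so this says that the derivatives of
  transition maps are onto the model space. The projection of a product uses it in that
  form.\<close>

lemma surjective_submersion_ident: "manifold M \<Longrightarrow> surjective_submersion M M (\<lambda>x. x)"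
  by (intro diffeomorphism_imp_surjective_submersion diffeomorphismI[where g = "\<lambda>x. x"])
    (auto intro: smooth_map_on_ident)

lemma surjective_submersion_snd:
  assumes M: "manifold M" and N: "manifold N" and "pts M \<noteq> {}"
  shows "surjective_submersion (prod_mfd M N) N snd"
proof (rule surjective_submersionI)
  show "smooth_map (prod_mfd M N) N snd"
    using M N by (rule smooth_map_snd)
  show "snd ` pts (prod_mfd M N) = pts N"
    using assms(3) by simp
next
  fix W \<xi> V' \<psi>' x
  assume "(W, \<xi>) \<in> atlas (prod_mfd M N)" and V': "(V', \<psi>') \<in> atlas N" and x: "x \<in> W" "snd x \<in> V'"
  then obtain U \<phi> V \<psi> where W: "W = U \<times> V" "\<xi> = map_prod \<phi> \<psi>"
    and U: "(U, \<phi>) \<in> atlas M" and V: "(V, \<psi>) \<in> atlas N"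
    by (blast elim: atlas_prod_mfdE)
  let ?S = "\<xi> ` {x' \<in> W. snd x' \<in> V'}"
  have sx: "snd x \<in> V" "snd (\<xi> x) = \<psi> (snd x)" using x W by auto
  obtain D where D: "((\<lambda>a. \<psi>' (inv_into V \<psi> a)) has_derivative D)
      (at (\<psi> (snd x)) within \<psi> ` {y \<in> V. y \<in> V'})" "D ` model N = model N"
    using surjective_submersion_derivative[OF surjective_submersion_ident[OF N] V V' sx(1) x(2)] .
  have "((\<lambda>a. \<psi>' (inv_into V \<psi> a)) has_derivative D) (at (snd (\<xi> x)) within snd ` ?S)"
    unfolding sx(2) by (rule has_derivative_subset[OF D(1)]) (auto simp: W)
  then have "((\<lambda>a. \<psi>' (inv_into V \<psi> (snd a))) has_derivative (\<lambda>v. D (snd v))) (at (\<xi> x) within ?S)"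
    by (rule has_derivative_in_compose[OF has_derivative_snd[OF has_derivative_ident]])
  then have "((\<lambda>a. \<psi>' (snd (inv_into W \<xi> a))) has_derivative (\<lambda>v. D (snd v))) (at (\<xi> x) within ?S)"
    by (rule has_derivative_transform[rotated 2]) 
      (use x in \<open>auto simp: W inv_into_map_prod[OF manifold_chartD(5)[OF M U] manifold_chartD(5)[OF N V]]\<close>)
  moreover have "(\<lambda>v. D (snd v)) ` model (prod_mfd M N) = model N"
  proof -
    \<comment> \<open>A subspace contains 0, so the first factor of the model is nonempty.\<close>
    have "snd ` (model M \<times> model N) = model N"
      using subspace_0[OF manifoldD(3)[OF M]] by auto
    then show ?thesis
      using D(2) by (metis image_image prod_mfd_sel(2))
  qed
  ultimately show "\<exists>D. ((\<lambda>a. \<psi>' (snd (inv_into W \<xi> a))) has_derivative D) (at (\<xi> x) within ?S)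
      \<and> D ` model (prod_mfd M N) = model N"
    by blast
qed

lemma surjective_submersion_map_prod:
  assumes M: "manifold M" and N: "manifold N" and M': "manifold M'" and N': "manifold N'"
    and f: "surjective_submersion M M' f" and g: "surjective_submersion N N' g"
  shows "surjective_submersion (prod_mfd M N) (prod_mfd M' N') (map_prod f g)"
proof (rule surjective_submersionI)
  note MN = manifold_prod_mfd[OF M N]
  have "smooth_map (prod_mfd M N) (prod_mfd M' N') (\<lambda>p. (f (fst p), g (snd p)))"
    by (rule smooth_map_on_Pair[OF MN smooth_map_compose[OF MN M smooth_map_fst[OF M N] surjective_submersion_smooth[OF f]]
        smooth_map_compose[OF MN N smooth_map_snd[OF M N] surjective_submersion_smooth[OF g]]])
  then show "smooth_map (prod_mfd M N) (prod_mfd M' N') (map_prod f g)"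
    by (simp add: map_prod_def case_prod_beta')
  show "map_prod f g ` pts (prod_mfd M N) = pts (prod_mfd M' N')"
    using surjective_submersion_image[OF f] surjective_submersion_image[OF g] by (simp add: map_prod_surj_on)
next
  fix W \<xi> W' \<xi>' x
  assume MN: "(W, \<xi>) \<in> atlas (prod_mfd M N)" and MN': "(W', \<xi>') \<in> atlas (prod_mfd M' N')"
    and x: "x \<in> W" "map_prod f g x \<in> W'"
  obtain U \<phi> V \<psi> where W1: "W = U \<times> V" "\<xi> = map_prod \<phi> \<psi>"
    and U: "(U, \<phi>) \<in> atlas M" and V: "(V, \<psi>) \<in> atlas N"
    using MN by (rule atlas_prod_mfdE)
  obtain U' \<phi>' V' \<psi>' where W2: "W' = U' \<times> V'" "\<xi>' = map_prod \<phi>' \<psi>'"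
    and U': "(U', \<phi>') \<in> atlas M'" and V': "(V', \<psi>') \<in> atlas N'"
    using MN' by (rule atlas_prod_mfdE)
  note W = W1 W2
  let ?S = "\<xi> ` {x' \<in> W. map_prod f g x' \<in> W'}"
  obtain y z where yz: "x = (y, z)" by fastforce
  with x W have yz': "y \<in> U" "z \<in> V" "f y \<in> U'" "g z \<in> V'" by auto
  obtain D where D: "((\<lambda>a. \<phi>' (f (inv_into U \<phi> a))) has_derivative D)
      (at (\<phi> y) within \<phi> ` {y \<in> U. f y \<in> U'})" "D ` model M = model M'"
    using surjective_submersion_derivative[OF f U U' yz'(1,3)] .
  obtain E where E: "((\<lambda>a. \<psi>' (g (inv_into V \<psi> a))) has_derivative E)
      (at (\<psi> z) within \<psi> ` {y \<in> V. g y \<in> V'})" "E ` model N = model N'"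
    using surjective_submersion_derivative[OF g V V' yz'(2,4)] .
  have S: "fst ` ?S \<subseteq> \<phi> ` {y \<in> U. f y \<in> U'}" "snd ` ?S \<subseteq> \<psi> ` {y \<in> V. g y \<in> V'}"
    unfolding W by force+
  have fs: "fst (\<xi> x) = \<phi> y" "snd (\<xi> x) = \<psi> z"
    by (simp_all add: W yz)
  have "((\<lambda>a. \<phi>' (f (inv_into U \<phi> a))) has_derivative D) (at (fst (\<xi> x)) within fst ` ?S)"
    unfolding fs by (rule has_derivative_subset[OF D(1) S(1)])
  then have D': "((\<lambda>a. \<phi>' (f (inv_into U \<phi> (fst a)))) has_derivative (\<lambda>v. D (fst v))) (at (\<xi> x) within ?S)"
    by (rule has_derivative_in_compose[OF has_derivative_fst[OF has_derivative_ident]])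
  have "((\<lambda>a. \<psi>' (g (inv_into V \<psi> a))) has_derivative E) (at (snd (\<xi> x)) within snd ` ?S)"
    unfolding fs by (rule has_derivative_subset[OF E(1) S(2)])
  then have E': "((\<lambda>a. \<psi>' (g (inv_into V \<psi> (snd a)))) has_derivative (\<lambda>v. E (snd v))) (at (\<xi> x) within ?S)"
    by (rule has_derivative_in_compose[OF has_derivative_snd[OF has_derivative_ident]])
  have "((\<lambda>a. \<xi>' (map_prod f g (inv_into W \<xi> a))) has_derivative (\<lambda>v. (D (fst v), E (snd v)))) (at (\<xi> x) within ?S)"
    by (rule has_derivative_transform[OF _ _ has_derivative_Pair[OF D' E']]) 
      (use x in \<open>auto simp: W inv_into_map_prod[OF manifold_chartD(5)[OF M U] manifold_chartD(5)[OF N V]]\<close>)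
  moreover have "(\<lambda>v. (D (fst v), E (snd v))) ` model (prod_mfd M N) = model (prod_mfd M' N')"
    using map_prod_surj_on[OF D(2) E(2)] by (simp add: map_prod_def case_prod_beta')
  ultimately show "\<exists>D. ((\<lambda>a. \<xi>' (map_prod f g (inv_into W \<xi> a))) has_derivative D) (at (\<xi> x) within ?S)
      \<and> D ` model (prod_mfd M N) = model (prod_mfd M' N')"
    by blast
qed

section \<open>Transport of structure and quotients\<close>

lemma surjective_submersion_cong:
  assumes M: "manifold M" and f: "surjective_submersion M N f" and eq: "\<And>x. x \<in> pts M \<Longrightarrow> f x = g x"
  shows "surjective_submersion M N g"
proof (rule surjective_submersionI)
  show "smooth_map M N g"
    using smooth_map_on_cong[OF M surjective_submersion_smooth[OF f]] eq by blast
  show "g ` pts M = pts N"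
    using surjective_submersion_image[OF f] eq by force
next
  fix U \<phi> V \<psi> x
  assume U: "(U, \<phi>) \<in> atlas M" and V: "(V, \<psi>) \<in> atlas N" and x: "x \<in> U" and gx: "g x \<in> V"
  have *: "g y = f y" if "y \<in> U" for y
    using that eq manifold_chartD(4)[OF M U] by force
  have S: "{x' \<in> U. f x' \<in> V} = {x' \<in> U. g x' \<in> V}"
    using * by auto
  have fx: "f x \<in> V"
    using gx *[OF x] by simp
  obtain D where D: "((\<lambda>a. \<psi> (f (inv_into U \<phi> a))) has_derivative D)
      (at (\<phi> x) within \<phi> ` {x' \<in> U. g x' \<in> V})" "D ` model M = model N"
    using surjective_submersion_derivative[OF f U V x fx] unfolding S .
  have "((\<lambda>a. \<psi> (g (inv_into U \<phi> a))) has_derivative D)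
      (at (\<phi> x) within \<phi> ` {x' \<in> U. g x' \<in> V})"
    by (rule has_derivative_transform[OF _ _ D(1)]) (use x gx in \<open>auto simp: inv_chart[OF M U] *\<close>)
  with D(2) show "\<exists>D. ((\<lambda>a. \<psi> (g (inv_into U \<phi> a))) has_derivative D)
      (at (\<phi> x) within \<phi> ` {x' \<in> U. g x' \<in> V}) \<and> D ` model M = model N"
    by blast
qed

text \<open>For \<open>\<beta>\<close> injective on the points this renames the points of
  \<open>M\<close>. The ambient type \<open>'e\<close> and the model are kept, so a quotient built
  in this way is modelled in the types of \<open>Y\<close>, as
  \<open>principal_bundle_groupoid\<close> asks.\<close>

definition transport_mfd :: "('x \<Rightarrow> 'y) \<Rightarrow> ('x, 'e) mfd \<Rightarrow> ('y, 'e) mfd" where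
  "transport_mfd \<beta> M =
     \<lparr> mtop = pullback_topology (\<beta> ` pts M) (inv_into (pts M) \<beta>) (mtop M),
       model = model M,
       atlas = (\<lambda>(U, \<phi>). (\<beta> ` U, \<phi> \<circ> inv_into (pts M) \<beta>)) ` atlas M \<rparr>"

lemma model_transport_mfd [simp]: "model (transport_mfd \<beta> M) = model M"
  by (simp add: transport_mfd_def)

lemma pts_transport_mfd [simp]: "pts (transport_mfd \<beta> M) = \<beta> ` pts M"
  by (auto simp: transport_mfd_def topspace_pullback_topology inv_into_into)

lemma atlas_transport_mfdE:
  assumes "(W, \<xi>) \<in> atlas (transport_mfd \<beta> M)"
  obtains U \<phi> where "(U, \<phi>) \<in> atlas M" "W = \<beta> ` U" "\<xi> = \<phi> \<circ> inv_into (pts M) \<beta>"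
  using assms unfolding transport_mfd_def by auto

lemma openin_transport_mfd:
  assumes "inj_on \<beta> (pts M)"
  shows "openin (mtop (transport_mfd \<beta> M)) V \<longleftrightarrow> (\<exists>U. openin (mtop M) U \<and> V = \<beta> ` U)"
proof -
  have "inv_into (pts M) \<beta> -` U \<inter> \<beta> ` pts M = \<beta> ` U" if "openin (mtop M) U" for U
    using openin_subset[OF that] assms by (auto simp: image_iff)
  then show ?thesis
    by (simp add: transport_mfd_def openin_pullback_topology cong: conj_cong)
qed

lemma homeomorphic_maps_transport_mfd:
  assumes "inj_on \<beta> (pts M)"
  shows "homeomorphic_maps (mtop M) (mtop (transport_mfd \<beta> M)) \<beta> (inv_into (pts M) \<beta>)"
  unfolding homeomorphic_maps_def
proof (intro conjI)
  have *: "{x \<in> pts M. \<beta> x \<in> \<beta> ` U} = U" if "openin (mtop M) U" for U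
    using openin_subset[OF that] assms by (auto dest: inj_onD)
  show "continuous_map (mtop M) (mtop (transport_mfd \<beta> M)) \<beta>"
    unfolding continuous_map using assms by (auto simp: openin_transport_mfd *)
  have *: "{y \<in> \<beta> ` pts M. inv_into (pts M) \<beta> y \<in> U} = \<beta> ` U" if "openin (mtop M) U" for U
    using openin_subset[OF that] assms by auto
  show "continuous_map (mtop (transport_mfd \<beta> M)) (mtop M) (inv_into (pts M) \<beta>)"
    unfolding continuous_map using assms by (auto simp: openin_transport_mfd *)
qed (use assms in auto)

context
  fixes \<beta> :: "'x \<Rightarrow> 'y" and M :: "('x, 'e::euclidean_space) mfd"
  assumes M: "manifold M" and inj: "inj_on \<beta> (pts M)"
begin

private lemma transport_chart:
  assumes U: "(U, \<phi>) \<in> atlas M"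
  shows "a \<in> \<phi> ` U \<Longrightarrow> inv_into (\<beta> ` U) (\<phi> \<circ> inv_into (pts M) \<beta>) a = \<beta> (inv_into U \<phi> a)"
    and "x \<in> U \<Longrightarrow> inv_into (pts M) \<beta> (\<beta> x) = x"
    and "T \<subseteq> U \<Longrightarrow> (\<phi> \<circ> inv_into (pts M) \<beta>) ` \<beta> ` T = \<phi> ` T"
proof -
  note u = manifold_chartD[OF M U]
  show *: "inv_into (pts M) \<beta> (\<beta> x) = x" if "x \<in> U" for x
    using that u(4) inj by auto
  have "inj_on (\<phi> \<circ> inv_into (pts M) \<beta>) (\<beta> ` U)"
    using u(5) by (auto simp: inj_on_def *)
  then show "inv_into (\<beta> ` U) (\<phi> \<circ> inv_into (pts M) \<beta>) a = \<beta> (inv_into U \<phi> a)" if "a \<in> \<phi> ` U"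
    using that by (intro inv_into_f_eq) (auto simp: * inv_into_into f_inv_into_f)
  show "(\<phi> \<circ> inv_into (pts M) \<beta>) ` \<beta> ` T = \<phi> ` T" if "T \<subseteq> U"
    unfolding image_image by (rule image_cong) (use that * in auto)
qed

private lemma transport_image_Int:
  assumes "(U, \<phi>) \<in> atlas M" "(V, \<psi>) \<in> atlas M"
  shows "\<beta> ` U \<inter> \<beta> ` V = \<beta> ` (U \<inter> V)"
  using inj_on_image_Int[OF inj] manifold_chartD(4)[OF M] assms by metis

lemma manifold_transport_mfd: "manifold (transport_mfd \<beta> M)"
  unfolding manifold_def
proof (intro conjI)
  let ?T = "transport_mfd \<beta> M" and ?\<gamma> = "inv_into (pts M) \<beta>"
  note hm = homeomorphic_maps_transport_mfd[OF inj]
  then have hs: "mtop M homeomorphic_space mtop ?T"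
    unfolding homeomorphic_space_def by blast
  have h\<gamma>: "homeomorphic_map (mtop ?T) (mtop M) ?\<gamma>"
    using hm homeomorphic_maps_sym homeomorphic_map_maps by blast
  show "Hausdorff_space (mtop ?T)"
    using homeomorphic_Hausdorff_space[OF hs] manifoldD(1)[OF M] by simp
  show "second_countable (mtop ?T)"
    using homeomorphic_space_second_countability[OF hs] manifoldD(2)[OF M] by simp
  show "subspace (model ?T)"
    using manifoldD(3)[OF M] by simp
  show "(\<Union>(U, \<phi>)\<in>atlas ?T. U) = pts ?T"
    unfolding pts_transport_mfd unfolding manifoldD(4)[OF M, symmetric] by (auto simp: transport_mfd_def)
  show "\<forall>(W, \<xi>)\<in>atlas ?T. openin (mtop ?T) W \<and> openin (top_of_set (model ?T)) (\<xi> ` W) \<and>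
      homeomorphic_map (subtopology (mtop ?T) W) (top_of_set (\<xi> ` W)) \<xi>"
  proof (clarify elim!: atlas_transport_mfdE, intro conjI)
    fix U \<phi> assume U: "(U, \<phi>) \<in> atlas M"
    note u = manifold_chartD[OF M U] and tc = transport_chart[OF U]
    show "openin (mtop ?T) (\<beta> ` U)"
      using u(1) by (auto simp: openin_transport_mfd[OF inj])
    show "openin (top_of_set (model ?T)) ((\<phi> \<circ> ?\<gamma>) ` \<beta> ` U)"
      using u(2) by (simp only: tc(3)[OF order_refl] model_transport_mfd)
    have "homeomorphic_map (subtopology (mtop ?T) (\<beta> ` U)) (subtopology (mtop M) U) ?\<gamma>"
      using h\<gamma> by (rule homeomorphic_map_subtopologies) 
        (use u(4) tc(2) in \<open>force simp: image_iff\<close>)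
    from homeomorphic_map_compose[OF this u(3)]
    show "homeomorphic_map (subtopology (mtop ?T) (\<beta> ` U)) (top_of_set ((\<phi> \<circ> ?\<gamma>) ` \<beta> ` U)) (\<phi> \<circ> ?\<gamma>)"
      by (simp only: tc(3)[OF order_refl])
  qed
  show "\<forall>(W, \<xi>)\<in>atlas ?T. \<forall>(W', \<xi>')\<in>atlas ?T. smooth_on (\<xi> ` (W \<inter> W')) (\<xi>' \<circ> inv_into W \<xi>)"
  proof (clarify elim!: atlas_transport_mfdE)
    fix U \<phi> V \<psi> assume U: "(U, \<phi>) \<in> atlas M" and V: "(V, \<psi>) \<in> atlas M"
    have "smooth_on (\<phi> ` (U \<inter> V)) (\<lambda>a. \<psi> (inv_into U \<phi> a))"
      by (rule manifold_transition[OF M U V])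
    then have "smooth_on (\<phi> ` (U \<inter> V)) ((\<psi> \<circ> ?\<gamma>) \<circ> inv_into (\<beta> ` U) (\<phi> \<circ> ?\<gamma>))"
      by (rule smooth_on_cong)
        (auto simp del: o_apply simp: transport_chart[OF U] inv_chart[OF M U] o_apply[of \<psi>] o_apply[of "\<psi> \<circ> ?\<gamma>"])
    then show "smooth_on ((\<phi> \<circ> ?\<gamma>) ` (\<beta> ` U \<inter> \<beta> ` V)) ((\<psi> \<circ> ?\<gamma>) \<circ> inv_into (\<beta> ` U) (\<phi> \<circ> ?\<gamma>))"
      by (simp only: transport_image_Int[OF U V] transport_chart(3)[OF U Int_lower1])
  qed
qed

text \<open>The transported charts undo \<open>\<beta>\<close>, so its coordinate expressions are
  the transition maps of \<open>M\<close>.\<close>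

lemma smooth_map_transport: "smooth_map M (transport_mfd \<beta> M) \<beta>"
proof (rule smooth_map_onI)
  show "continuous_map (subtopology (mtop M) (pts M)) (mtop (transport_mfd \<beta> M)) \<beta>"
    using homeomorphic_maps_transport_mfd[OF inj] unfolding homeomorphic_maps_def by simp
next
  fix U \<phi> W \<xi>
  assume U: "(U, \<phi>) \<in> atlas M" and "(W, \<xi>) \<in> atlas (transport_mfd \<beta> M)"
  then obtain V \<psi> where V: "(V, \<psi>) \<in> atlas M" and W: "W = \<beta> ` V" "\<xi> = \<psi> \<circ> inv_into (pts M) \<beta>"
    by (blast elim: atlas_transport_mfdE)
  note u = manifold_chartD(4)[OF M U] and v = manifold_chartD(4)[OF M V]
  have "{x \<in> pts M \<inter> U. \<beta> x \<in> W} = U \<inter> V"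
    using u v inj unfolding W by (auto dest: inj_onD)
  moreover have "smooth_on (\<phi> ` (U \<inter> V)) (\<lambda>a. \<xi> (\<beta> (inv_into U \<phi> a)))"
    by (rule smooth_on_cong[OF manifold_transition[OF M U V]])
      (auto simp: W inv_chart[OF M U] transport_chart(2)[OF U])
  ultimately show "smooth_on (\<phi> ` {x \<in> pts M \<inter> U. \<beta> x \<in> W}) (\<lambda>a. \<xi> (\<beta> (inv_into U \<phi> a)))"
    by simp
qed

lemma smooth_map_transport_inv: "smooth_map (transport_mfd \<beta> M) M (inv_into (pts M) \<beta>)"
proof (rule smooth_map_onI)
  show "continuous_map (subtopology (mtop (transport_mfd \<beta> M)) (pts (transport_mfd \<beta> M))) (mtop M)
      (inv_into (pts M) \<beta>)"
    using homeomorphic_maps_transport_mfd[OF inj] unfolding homeomorphic_maps_def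
    by (simp add: continuous_map_from_subtopology)
next
  let ?\<gamma> = "inv_into (pts M) \<beta>"
  fix W \<xi> V \<psi>
  assume "(W, \<xi>) \<in> atlas (transport_mfd \<beta> M)" and V: "(V, \<psi>) \<in> atlas M"
  then obtain U \<phi> where U: "(U, \<phi>) \<in> atlas M" and W: "W = \<beta> ` U" "\<xi> = \<phi> \<circ> ?\<gamma>"
    by (blast elim: atlas_transport_mfdE)
  note u = manifold_chartD(4)[OF M U] and v = manifold_chartD(4)[OF M V]
  have *: "{y \<in> pts (transport_mfd \<beta> M) \<inter> W. ?\<gamma> y \<in> V} = \<beta> ` (U \<inter> V)"
    using u v transport_chart(2)[OF U] unfolding W by auto
  have "smooth_on (\<phi> ` (U \<inter> V)) (\<lambda>a. \<psi> (?\<gamma> (inv_into W \<xi> a)))"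
    by (rule smooth_on_cong[OF manifold_transition[OF M U V]])
      (auto simp: W inv_chart[OF M U] transport_chart[OF U] simp del: o_apply)
  then show "smooth_on (\<xi> ` {y \<in> pts (transport_mfd \<beta> M) \<inter> W. ?\<gamma> y \<in> V}) (\<lambda>a. \<psi> (?\<gamma> (inv_into W \<xi> a)))"
    unfolding * unfolding W by (simp only: transport_chart(3)[OF U Int_lower1])
qed

lemma diffeomorphism_transport: "diffeomorphism M (transport_mfd \<beta> M) \<beta>"
  by (rule diffeomorphismI[OF smooth_map_transport smooth_map_transport_inv]) (use inj in auto)

lemma diffeomorphism_transport_inv: "diffeomorphism (transport_mfd \<beta> M) M (inv_into (pts M) \<beta>)"
  by (rule diffeomorphismI[OF smooth_map_transport_inv smooth_map_transport]) (use inj in auto)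

end

section \<open>Transport of a Lie groupoid and the quotient by orbits\<close>

definition transport_grpd ::
  "('o \<Rightarrow> 'p) \<Rightarrow> ('a \<Rightarrow> 'b) \<Rightarrow> ('o, 'a, 'eo, 'ea) grpd \<Rightarrow> ('p, 'b, 'eo, 'ea) grpd" where
  "transport_grpd \<beta>0 \<beta>1 Y =
     (let \<gamma>0 = inv_into (pts (objs Y)) \<beta>0; \<gamma>1 = inv_into (pts (arrs Y)) \<beta>1 in
     \<lparr> objs = transport_mfd \<beta>0 (objs Y),
       arrs = transport_mfd \<beta>1 (arrs Y),
       source = (\<lambda>a. \<beta>0 (source Y (\<gamma>1 a))),
       target = (\<lambda>a. \<beta>0 (target Y (\<gamma>1 a))),
       comp_arr = (\<lambda>a2 a1. \<beta>1 (comp_arr Y (\<gamma>1 a2) (\<gamma>1 a1))),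
       unit_arr = (\<lambda>y. \<beta>1 (unit_arr Y (\<gamma>0 y))),
       inv_arr = (\<lambda>a. \<beta>1 (inv_arr Y (\<gamma>1 a))) \<rparr>)"

lemma lie_groupoidD:
  assumes "lie_groupoid X"
  shows "manifold (objs X)" "manifold (arrs X)"
    "surjective_submersion (arrs X) (objs X) (source X)"
    "surjective_submersion (arrs X) (objs X) (target X)"
    "smooth_map_on (composable X) (prod_mfd (arrs X) (arrs X)) (arrs X) (\<lambda>(a2, a1). comp_arr X a2 a1)"
    "smooth_map (objs X) (arrs X) (unit_arr X)"
    "smooth_map (arrs X) (arrs X) (inv_arr X)"
    "\<And>a2 a1. (a2, a1) \<in> composable X \<Longrightarrow> source X (comp_arr X a2 a1) = source X a1"
    "\<And>a2 a1. (a2, a1) \<in> composable X \<Longrightarrow> target X (comp_arr X a2 a1) = target X a2"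
    "\<And>a3 a2 a1. (a3, a2) \<in> composable X \<Longrightarrow> (a2, a1) \<in> composable X \<Longrightarrow>
        comp_arr X (comp_arr X a3 a2) a1 = comp_arr X a3 (comp_arr X a2 a1)"
    "\<And>y. y \<in> pts (objs X) \<Longrightarrow> source X (unit_arr X y) = y"
    "\<And>y. y \<in> pts (objs X) \<Longrightarrow> target X (unit_arr X y) = y"
    "\<And>a. a \<in> pts (arrs X) \<Longrightarrow> comp_arr X a (unit_arr X (source X a)) = a"
    "\<And>a. a \<in> pts (arrs X) \<Longrightarrow> comp_arr X (unit_arr X (target X a)) a = a"
    "\<And>a. a \<in> pts (arrs X) \<Longrightarrow> source X (inv_arr X a) = target X a"
    "\<And>a. a \<in> pts (arrs X) \<Longrightarrow> target X (inv_arr X a) = source X a"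
    "\<And>a. a \<in> pts (arrs X) \<Longrightarrow> comp_arr X (inv_arr X a) a = unit_arr X (source X a)"
    "\<And>a. a \<in> pts (arrs X) \<Longrightarrow> comp_arr X a (inv_arr X a) = unit_arr X (target X a)"
  using assms unfolding lie_groupoid_def by (simp_all add: case_prod_beta' Ball_def split_paired_all)

lemma lie_groupoid_pts:
  assumes "lie_groupoid X"
  shows "a \<in> pts (arrs X) \<Longrightarrow> source X a \<in> pts (objs X)"
    "a \<in> pts (arrs X) \<Longrightarrow> target X a \<in> pts (objs X)"
    "(a2, a1) \<in> composable X \<Longrightarrow> comp_arr X a2 a1 \<in> pts (arrs X)"
    "y \<in> pts (objs X) \<Longrightarrow> unit_arr X y \<in> pts (arrs X)"
    "a \<in> pts (arrs X) \<Longrightarrow> inv_arr X a \<in> pts (arrs X)"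
proof -
  note X = lie_groupoidD[OF assms]
  show "a \<in> pts (arrs X) \<Longrightarrow> source X a \<in> pts (objs X)"
    using surjective_submersion_image[OF X(3)] by blast
  show "a \<in> pts (arrs X) \<Longrightarrow> target X a \<in> pts (objs X)"
    using surjective_submersion_image[OF X(4)] by blast
  show "(a2, a1) \<in> composable X \<Longrightarrow> comp_arr X a2 a1 \<in> pts (arrs X)"
    using smooth_map_on_pts[OF X(5), of "(a2, a1)"] unfolding composable_def by simp
  show "y \<in> pts (objs X) \<Longrightarrow> unit_arr X y \<in> pts (arrs X)"
    using smooth_map_on_pts[OF X(6)] by blast
  show "a \<in> pts (arrs X) \<Longrightarrow> inv_arr X a \<in> pts (arrs X)"
    using smooth_map_on_pts[OF X(7)] by blast
qed

lemma lie_groupoidI: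
  assumes "manifold (objs X)" "manifold (arrs X)"
    "surjective_submersion (arrs X) (objs X) (source X)"
    "surjective_submersion (arrs X) (objs X) (target X)"
    "smooth_map_on (composable X) (prod_mfd (arrs X) (arrs X)) (arrs X) (\<lambda>(a2, a1). comp_arr X a2 a1)"
    "smooth_map (objs X) (arrs X) (unit_arr X)"
    "smooth_map (arrs X) (arrs X) (inv_arr X)"
    "\<And>a2 a1. (a2, a1) \<in> composable X \<Longrightarrow> source X (comp_arr X a2 a1) = source X a1"
    "\<And>a2 a1. (a2, a1) \<in> composable X \<Longrightarrow> target X (comp_arr X a2 a1) = target X a2"
    "\<And>a3 a2 a1. (a3, a2) \<in> composable X \<Longrightarrow> (a2, a1) \<in> composable X \<Longrightarrow>
        comp_arr X (comp_arr X a3 a2) a1 = comp_arr X a3 (comp_arr X a2 a1)"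
    "\<And>y. y \<in> pts (objs X) \<Longrightarrow> source X (unit_arr X y) = y"
    "\<And>y. y \<in> pts (objs X) \<Longrightarrow> target X (unit_arr X y) = y"
    "\<And>a. a \<in> pts (arrs X) \<Longrightarrow> comp_arr X a (unit_arr X (source X a)) = a"
    "\<And>a. a \<in> pts (arrs X) \<Longrightarrow> comp_arr X (unit_arr X (target X a)) a = a"
    "\<And>a. a \<in> pts (arrs X) \<Longrightarrow> source X (inv_arr X a) = target X a"
    "\<And>a. a \<in> pts (arrs X) \<Longrightarrow> target X (inv_arr X a) = source X a"
    "\<And>a. a \<in> pts (arrs X) \<Longrightarrow> comp_arr X (inv_arr X a) a = unit_arr X (source X a)"
    "\<And>a. a \<in> pts (arrs X) \<Longrightarrow> comp_arr X a (inv_arr X a) = unit_arr X (target X a)"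
  shows "lie_groupoid X"
  unfolding lie_groupoid_def by (intro conjI ballI allI impI assms) (auto intro: assms)

context
  fixes Y :: "('o, 'a, 'eo::euclidean_space, 'ea::euclidean_space) grpd"
    and \<beta>0 :: "'o \<Rightarrow> 'p" and \<beta>1 :: "'a \<Rightarrow> 'b"
  assumes Y: "lie_groupoid Y"
    and inj0: "inj_on \<beta>0 (pts (objs Y))" and inj1: "inj_on \<beta>1 (pts (arrs Y))"
begin

lemma lie_groupoid_transport_grpd: "lie_groupoid (transport_grpd \<beta>0 \<beta>1 Y)"
proof -
  let ?\<gamma>0 = "inv_into (pts (objs Y)) \<beta>0" and ?\<gamma>1 = "inv_into (pts (arrs Y)) \<beta>1"
  let ?T = "transport_grpd \<beta>0 \<beta>1 Y"
  note y = lie_groupoidD[OF Y] and yp = lie_groupoid_pts[OF Y]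
  have g0: "?\<gamma>0 (\<beta>0 y) = y" if "y \<in> pts (objs Y)" for y
    using that inj0 by simp
  have g1: "?\<gamma>1 (\<beta>1 a) = a" if "a \<in> pts (arrs Y)" for a
    using that inj1 by simp
  have b0: "\<beta>0 y = \<beta>0 y' \<longleftrightarrow> y = y'" if "y \<in> pts (objs Y)" "y' \<in> pts (objs Y)" for y y'
    using that inj0 by (auto dest: inj_onD)
  have sel: "objs ?T = transport_mfd \<beta>0 (objs Y)" "arrs ?T = transport_mfd \<beta>1 (arrs Y)"
    "source ?T = (\<lambda>a. \<beta>0 (source Y (?\<gamma>1 a)))" "target ?T = (\<lambda>a. \<beta>0 (target Y (?\<gamma>1 a)))"
    "comp_arr ?T = (\<lambda>a2 a1. \<beta>1 (comp_arr Y (?\<gamma>1 a2) (?\<gamma>1 a1)))"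
    "unit_arr ?T = (\<lambda>y. \<beta>1 (unit_arr Y (?\<gamma>0 y)))" "inv_arr ?T = (\<lambda>a. \<beta>1 (inv_arr Y (?\<gamma>1 a)))"
    by (simp_all add: transport_grpd_def Let_def)
  \<comment> \<open>Injectivity of \<open>\<beta>0\<close> prevents new composable pairs: equal
    names of source and target mean equal objects.\<close>
  have comp: "composable ?T = map_prod \<beta>1 \<beta>1 ` composable Y"
  proof (intro equalityI subsetI)
    fix p assume "p \<in> composable ?T"
    then obtain b2 b1 where b: "p = (\<beta>1 b2, \<beta>1 b1)" "b2 \<in> pts (arrs Y)" "b1 \<in> pts (arrs Y)"
      "\<beta>0 (source Y b2) = \<beta>0 (target Y b1)"
      by (auto simp: composable_def sel g1)
    then have "(b2, b1) \<in> composable Y"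
      using yp(1,2) by (simp add: composable_def b0)
    then show "p \<in> map_prod \<beta>1 \<beta>1 ` composable Y"
      using b(1) by auto
  qed (auto simp: composable_def sel g1)
  note m0 = manifold_transport_mfd[OF y(1) inj0] and m1 = manifold_transport_mfd[OF y(2) inj1]
  note s0 = smooth_map_transport[OF y(1) inj0] and s1 = smooth_map_transport[OF y(2) inj1]
  note i0 = smooth_map_transport_inv[OF y(1) inj0] and i1 = smooth_map_transport_inv[OF y(2) inj1]
  note mm = manifold_prod_mfd[OF m1 m1]
  note sub0 = diffeomorphism_imp_surjective_submersion[OF y(1) m0 diffeomorphism_transport[OF y(1) inj0]]
  note sub1 = diffeomorphism_imp_surjective_submersion[OF m1 y(2) diffeomorphism_transport_inv[OF y(2) inj1]]
  show ?thesis
  proof (rule lie_groupoidI)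
    show "manifold (objs ?T)" "manifold (arrs ?T)"
      using m0 m1 by (simp_all add: sel)
    show "surjective_submersion (arrs ?T) (objs ?T) (source ?T)"
      unfolding sel by (intro surjective_submersion_compose[OF m1 y(1) m0 _ sub0] surjective_submersion_compose[OF m1 y(2) y(1) sub1 y(3)])
    show "surjective_submersion (arrs ?T) (objs ?T) (target ?T)"
      unfolding sel by (intro surjective_submersion_compose[OF m1 y(1) m0 _ sub0] surjective_submersion_compose[OF m1 y(2) y(1) sub1 y(4)])
    have "smooth_map (prod_mfd (arrs ?T) (arrs ?T)) (prod_mfd (arrs Y) (arrs Y)) (\<lambda>p. (?\<gamma>1 (fst p), ?\<gamma>1 (snd p)))"
      unfolding sel by (rule smooth_map_on_Pair[OF mm smooth_map_compose[OF mm m1 smooth_map_fst[OF m1 m1] i1]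
          smooth_map_compose[OF mm m1 smooth_map_snd[OF m1 m1] i1]])
    then have sm: "smooth_map_on (composable ?T) (prod_mfd (arrs ?T) (arrs ?T)) (prod_mfd (arrs Y) (arrs Y)) (\<lambda>p. (?\<gamma>1 (fst p), ?\<gamma>1 (snd p)))"
      by (rule smooth_map_on_subset) (auto simp: composable_def)
    have "smooth_map_on (composable ?T) (prod_mfd (arrs ?T) (arrs ?T)) (arrs Y) (\<lambda>p. (\<lambda>(a2, a1). comp_arr Y a2 a1) (?\<gamma>1 (fst p), ?\<gamma>1 (snd p)))"
    proof (rule smooth_map_on_compose[OF _ _ sm y(5)])
      show "(?\<gamma>1 (fst p), ?\<gamma>1 (snd p)) \<in> composable Y" if "p \<in> composable ?T" for p
        using that unfolding comp by (auto simp: composable_def g1)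
    qed (simp_all add: sel mm manifold_prod_mfd y)
    from smooth_map_compose[OF _ y(2) this s1]
    show "smooth_map_on (composable ?T) (prod_mfd (arrs ?T) (arrs ?T)) (arrs ?T) (\<lambda>(a2, a1). comp_arr ?T a2 a1)"
      unfolding sel by (simp add: mm case_prod_beta')
    show "smooth_map (objs ?T) (arrs ?T) (unit_arr ?T)"
      unfolding sel by (intro smooth_map_compose[OF m0 y(2) _ s1] smooth_map_compose[OF m0 y(1) i0 y(6)])
    show "smooth_map (arrs ?T) (arrs ?T) (inv_arr ?T)"
      unfolding sel by (intro smooth_map_compose[OF m1 y(2) _ s1] smooth_map_compose[OF m1 y(2) i1 y(7)])
    have cc: "\<exists>b2 b1. a2 = \<beta>1 b2 \<and> a1 = \<beta>1 b1 \<and> (b2, b1) \<in> composable Y" if "(a2, a1) \<in> composable ?T" for a2 a1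
      using that unfolding comp by auto
    have cp: "b2 \<in> pts (arrs Y)" "b1 \<in> pts (arrs Y)" if "(b2, b1) \<in> composable Y" for b2 b1
      using that by (auto simp: composable_def)
    {
      fix a2 a1 assume "(a2, a1) \<in> composable ?T"
      then obtain b2 b1 where b: "a2 = \<beta>1 b2" "a1 = \<beta>1 b1" "(b2, b1) \<in> composable Y"
        using cc by blast
      then show "source ?T (comp_arr ?T a2 a1) = source ?T a1" "target ?T (comp_arr ?T a2 a1) = target ?T a2"
        using cp[OF b(3)] yp(3)[OF b(3)] y(8,9)[OF b(3)] by (simp_all add: sel g1)
    }
    show "comp_arr ?T (comp_arr ?T a3 a2) a1 = comp_arr ?T a3 (comp_arr ?T a2 a1)"
      if as: "(a3, a2) \<in> composable ?T" "(a2, a1) \<in> composable ?T" for a3 a2 a1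
    proof -
      obtain b3 b2 where b: "a3 = \<beta>1 b3" "a2 = \<beta>1 b2" "(b3, b2) \<in> composable Y"
        using cc[OF as(1)] by blast
      obtain b2' b1 where b': "a2 = \<beta>1 b2'" "a1 = \<beta>1 b1" "(b2', b1) \<in> composable Y"
        using cc[OF as(2)] by blast
      \<comment> \<open>The middle arrow was lifted once for each pair; injectivity of
        \<open>\<beta>1\<close> identifies the two lifts.\<close>
      have "b2' = b2" using g1 cp[OF b(3)] cp[OF b'(3)] b b' by metis
      then have "(b2, b1) \<in> composable Y" using b' by simp
      then show ?thesis
        using b b' cp[OF b(3)] cp[OF b'(3)] yp(3) y(10) by (simp add: sel g1)
    qed
    fix a assume "a \<in> pts (arrs ?T)"
    then obtain b where b: "a = \<beta>1 b" "b \<in> pts (arrs Y)"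
      by (auto simp: sel)
    then show "comp_arr ?T a (unit_arr ?T (source ?T a)) = a" "comp_arr ?T (unit_arr ?T (target ?T a)) a = a"
      "source ?T (inv_arr ?T a) = target ?T a" "target ?T (inv_arr ?T a) = source ?T a"
      "comp_arr ?T (inv_arr ?T a) a = unit_arr ?T (source ?T a)"
      "comp_arr ?T a (inv_arr ?T a) = unit_arr ?T (target ?T a)"
      using y(13-18) yp by (simp_all add: sel g0 g1)
  next
    fix y assume "y \<in> pts (objs ?T)"
    then obtain x where "y = \<beta>0 x" "x \<in> pts (objs Y)"
      by (auto simp: sel)
    then show "source ?T (unit_arr ?T y) = y" "target ?T (unit_arr ?T y) = y"
      using y(11,12) yp by (simp_all add: sel g0 g1)
  qed
qed

text \<open>The inverse maps are used because the identification of the quotient with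
  \<open>Y\<close> runs from the quotient to \<open>Y\<close>.\<close>

lemma lie_groupoid_isomorphism_transport_inv:
  "lie_groupoid_isomorphism (transport_grpd \<beta>0 \<beta>1 Y) Y
     (inv_into (pts (arrs Y)) \<beta>1) (inv_into (pts (objs Y)) \<beta>0)"
proof -
  note y = lie_groupoidD[OF Y] and yp = lie_groupoid_pts[OF Y]
  note d0 = diffeomorphism_transport_inv[OF y(1) inj0]
  note d1 = diffeomorphism_transport_inv[OF y(2) inj1]
  have inv: "inv_into (pts (arrs Y)) \<beta>1 a \<in> pts (arrs Y)" if "a \<in> \<beta>1 ` pts (arrs Y)" for a
    using that by (rule inv_into_into)
  have "(inv_into (pts (arrs Y)) \<beta>1 a2, inv_into (pts (arrs Y)) \<beta>1 a1) \<in> composable Y"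
    if "(a2, a1) \<in> composable (transport_grpd \<beta>0 \<beta>1 Y)" for a2 a1
    using that inv yp(1,2) inj_onD[OF inj0] by (auto simp: composable_def transport_grpd_def Let_def)
  then show ?thesis
    unfolding lie_groupoid_isomorphism_def lie_groupoid_morphism_def
    using d0 d1 diffeomorphism_smooth[OF d0] diffeomorphism_smooth[OF d1] inj0 inj1 inv yp
    by (auto simp: transport_grpd_def Let_def)
qed

end

lemma quotient_groupoid_of_submersion:
  fixes Y :: "('y, 'z, 'ey::euclidean_space, 'ez::euclidean_space) grpd"
    and P :: "('o, 'a, 'eo::euclidean_space, 'ea::euclidean_space) grpd"
    and H :: "('h, 'eh::euclidean_space) lie_grp" and G :: "('g, 'eg::euclidean_space) lie_grp"
  assumes P: "lie_groupoid P" and Y: "lie_groupoid Y"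
    and mor: "lie_groupoid_morphism P Y p1 p0"
    and p1: "surjective_submersion (arrs P) (arrs Y) p1"
    and p0: "surjective_submersion (objs P) (objs Y) p0"
    and orb1: "\<And>a a'. a \<in> pts (arrs P) \<Longrightarrow> a' \<in> pts (arrs P) \<Longrightarrow>
      group_orbit (cm_group H G C) A1 a = group_orbit (cm_group H G C) A1 a' \<longleftrightarrow> p1 a = p1 a'"
    and orb0: "\<And>x x'. x \<in> pts (objs P) \<Longrightarrow> x' \<in> pts (objs P) \<Longrightarrow>
      group_orbit G A0 x = group_orbit G A0 x' \<longleftrightarrow> p0 x = p0 x'"
  shows "\<exists>(Q :: ('o set, 'a set, 'ey, 'ez) grpd) F1 F0.
        quotient_groupoid H G C P A1 A0 Q \<and>
        lie_groupoid_isomorphism Q Y F1 F0 \<and>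
        (\<forall>a\<in>pts (arrs P). F1 (group_orbit (cm_group H G C) A1 a) = p1 a) \<and>
        (\<forall>x\<in>pts (objs P). F0 (group_orbit G A0 x) = p0 x)"
proof -
  let ?O1 = "group_orbit (cm_group H G C) A1" and ?O0 = "group_orbit G A0"
  \<comment> \<open>A point of \<open>Y\<close> is sent to the orbit of a chosen preimage. One
    direction of \<open>orb1\<close> makes this independent of the choice, the other makes it
    injective.\<close>
  define \<beta>1 where "\<beta>1 = (\<lambda>z. ?O1 (inv_into (pts (arrs P)) p1 z))"
  define \<beta>0 where "\<beta>0 = (\<lambda>z. ?O0 (inv_into (pts (objs P)) p0 z))"
  note im1 = surjective_submersion_image[OF p1] and im0 = surjective_submersion_image[OF p0]
  note p = lie_groupoidD[OF P] and pp = lie_groupoid_pts[OF P]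
  note y = lie_groupoidD[OF Y] and yp = lie_groupoid_pts[OF Y]
  have \<beta>1: "\<beta>1 (p1 a) = ?O1 a" if "a \<in> pts (arrs P)" for a
    using that orb1 unfolding \<beta>1_def by (simp add: inv_into_into f_inv_into_f)
  have \<beta>0: "\<beta>0 (p0 a) = ?O0 a" if "a \<in> pts (objs P)" for a
    using that orb0 unfolding \<beta>0_def by (simp add: inv_into_into f_inv_into_f)
  have inj1: "inj_on \<beta>1 (pts (arrs Y))"
    unfolding im1[symmetric] by (auto intro!: inj_onI simp: \<beta>1 orb1)
  have inj0: "inj_on \<beta>0 (pts (objs Y))"
    unfolding im0[symmetric] by (auto intro!: inj_onI simp: \<beta>0 orb0)
  have F1: "inv_into (pts (arrs Y)) \<beta>1 (?O1 a) = p1 a" if "a \<in> pts (arrs P)" for a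
    using \<beta>1[OF that] inj1 im1 that by (metis imageI inv_into_f_f)
  have F0: "inv_into (pts (objs Y)) \<beta>0 (?O0 a) = p0 a" if "a \<in> pts (objs P)" for a
    using \<beta>0[OF that] inj0 im0 that by (metis imageI inv_into_f_f)
  let ?Q = "transport_grpd \<beta>0 \<beta>1 Y"
  note Q = lie_groupoid_transport_grpd[OF Y inj0 inj1] and iso = lie_groupoid_isomorphism_transport_inv[OF Y inj0 inj1]
  note m0 = manifold_transport_mfd[OF y(1) inj0] and m1 = manifold_transport_mfd[OF y(2) inj1]
  have sel: "objs ?Q = transport_mfd \<beta>0 (objs Y)" "arrs ?Q = transport_mfd \<beta>1 (arrs Y)"
    by (simp_all add: transport_grpd_def Let_def)
  \<comment> \<open>On points, the orbit map is the submersion \<open>p1\<close> followed by a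
    diffeomorphism.\<close>
  have "surjective_submersion (arrs P) (arrs ?Q) (\<lambda>a. \<beta>1 (p1 a))"
    unfolding sel
    by (rule surjective_submersion_compose[OF p(2) y(2) m1 p1
        diffeomorphism_imp_surjective_submersion[OF y(2) m1 diffeomorphism_transport[OF y(2) inj1]]])
  then have s1: "surjective_submersion (arrs P) (arrs ?Q) ?O1"
    by (rule surjective_submersion_cong[OF p(2)]) (rule \<beta>1)
  have "surjective_submersion (objs P) (objs ?Q) (\<lambda>a. \<beta>0 (p0 a))"
    unfolding sel
    by (rule surjective_submersion_compose[OF p(1) y(1) m0 p0
        diffeomorphism_imp_surjective_submersion[OF y(1) m0 diffeomorphism_transport[OF y(1) inj0]]])
  then have s0: "surjective_submersion (objs P) (objs ?Q) ?O0"
    by (rule surjective_submersion_cong[OF p(1)]) (rule \<beta>0)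
  have "lie_groupoid_morphism P ?Q ?O1 ?O0"
    unfolding lie_groupoid_morphism_def
  proof (intro conjI ballI)
    show "smooth_map (arrs P) (arrs ?Q) ?O1"
      by (rule surjective_submersion_smooth[OF s1])
    show "smooth_map (objs P) (objs ?Q) ?O0"
      by (rule surjective_submersion_smooth[OF s0])
    show "source ?Q (?O1 a) = ?O0 (source P a)" "target ?Q (?O1 a) = ?O0 (target P a)"
      if "a \<in> pts (arrs P)" for a
      using that mor pp(1,2)[OF that] unfolding lie_groupoid_morphism_def
      by (simp_all add: transport_grpd_def Let_def F1 flip: \<beta>0)
    fix c assume "c \<in> composable P"
    then obtain a2 a1 where c: "c = (a2, a1)" "(a2, a1) \<in> composable P"
      by (metis surj_pair)
    then have "a2 \<in> pts (arrs P)" "a1 \<in> pts (arrs P)"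
      by (auto simp: composable_def)
    moreover have "p1 (comp_arr P a2 a1) = comp_arr Y (p1 a2) (p1 a1)"
      using mor c(2) unfolding lie_groupoid_morphism_def by fast
    ultimately show "case c of (a2, a1) \<Rightarrow> ?O1 (comp_arr P a2 a1) = comp_arr ?Q (?O1 a2) (?O1 a1)"
      using pp(3)[OF c(2)] by (simp add: c(1) transport_grpd_def Let_def F1 \<beta>1[symmetric, of "comp_arr P a2 a1"])
  qed
  then have "quotient_groupoid H G C P A1 A0 ?Q"
    unfolding quotient_groupoid_def quotient_manifold_def using Q m0 m1 s0 s1 by (simp add: sel)
  with iso F1 F0 show ?thesis
    by blast
qed

section \<open>Crossed modules and bundle gerbes\<close>

lemma smooth_map_on_fst:
  "manifold M \<Longrightarrow> manifold N \<Longrightarrow> manifold P \<Longrightarrow> smooth_map_on S M (prod_mfd N P) f \<Longrightarrow>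
    smooth_map_on S M N (\<lambda>x. fst (f x))"
  by (rule smooth_map_compose[OF _ manifold_prod_mfd _ smooth_map_fst])

lemma smooth_map_on_snd:
  "manifold M \<Longrightarrow> manifold N \<Longrightarrow> manifold P \<Longrightarrow> smooth_map_on S M (prod_mfd N P) f \<Longrightarrow>
    smooth_map_on S M P (\<lambda>x. snd (f x))"
  by (rule smooth_map_compose[OF _ manifold_prod_mfd _ smooth_map_snd])

lemma smooth_map_on_binop:
  assumes "manifold M" "manifold N" "manifold P" "smooth_map (prod_mfd N P) R (\<lambda>(a, b). op a b)"
    and "smooth_map_on S M N f" "smooth_map_on S M P g"
  shows "smooth_map_on S M R (\<lambda>x. op (f x) (g x))"
  using smooth_map_compose[OF assms(1) manifold_prod_mfd[OF assms(2,3)]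
      smooth_map_on_Pair[OF assms(1,5,6)] assms(4)] by simp

lemma continuous_map_interchange:
  "continuous_map (prod_topology (prod_topology X X') (prod_topology Y Y'))
     (prod_topology (prod_topology X Y) (prod_topology X' Y'))
     (\<lambda>p. ((fst (fst p), fst (snd p)), (snd (fst p), snd (snd p))))"
  using continuous_map_fst_of[OF continuous_map_fst] continuous_map_fst_of[OF continuous_map_snd]
    continuous_map_snd_of[OF continuous_map_fst] continuous_map_snd_of[OF continuous_map_snd]
  unfolding o_def by (intro continuous_map_pairedI)

text \<open>The same formula serves as its own inverse. In the properness proofs it regroups the
  pair of group components and the pair of remaining components into image point and original
  point.\<close>

lemma homeomorphic_map_interchange:
  "homeomorphic_map (prod_topology (prod_topology X X') (prod_topology Y Y'))
     (prod_topology (prod_topology X Y) (prod_topology X' Y'))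
     (\<lambda>p. ((fst (fst p), fst (snd p)), (snd (fst p), snd (snd p))))"
proof -
  have "homeomorphic_maps (prod_topology (prod_topology X X') (prod_topology Y Y'))
     (prod_topology (prod_topology X Y) (prod_topology X' Y'))
     (\<lambda>p. ((fst (fst p), fst (snd p)), (snd (fst p), snd (snd p))))
     (\<lambda>p. ((fst (fst p), fst (snd p)), (snd (fst p), snd (snd p))))"
    unfolding homeomorphic_maps_def by (simp add: continuous_map_interchange)
  then show ?thesis
    unfolding homeomorphic_map_maps by blast
qed

lemma (in group) inv_mult_cancel:
  assumes "a \<in> carrier G" "x \<in> carrier G"
  shows "inv a \<otimes> (a \<otimes> x) = x" "a \<otimes> (inv a \<otimes> x) = x"
  using assms by (simp_all flip: m_assoc)

section \<open>Crossed modules and their semidirect product group\<close>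

locale lie_crossed_module =
  fixes H :: "('h, 'eh::euclidean_space) lie_grp"
    and G :: "('g, 'eg::euclidean_space) lie_grp"
    and C :: "'g \<Rightarrow> 'h \<Rightarrow> 'h"
    and d :: "'h \<Rightarrow> 'g"
  assumes crossed_module: "crossed_module H G C d"
begin

lemma lie_H: "lie_group H" and lie_G: "lie_group G"
  using crossed_module unfolding crossed_module_def by auto

sublocale H: group H
  using lie_H unfolding lie_group_def by blast
sublocale G: group G
  using lie_G unfolding lie_group_def by blast

lemma pts_gmfd [simp]: "pts (gmfd H) = carrier H" "pts (gmfd G) = carrier G"
  using lie_H lie_G unfolding lie_group_def by simp_all

lemma manifold_gmfd: "manifold (gmfd H)" "manifold (gmfd G)"
  using lie_H lie_G unfolding lie_group_def by simp_all

lemma C_iso: "g \<in> carrier G \<Longrightarrow> C g \<in> iso H H"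
  and C_one [simp]: "h \<in> carrier H \<Longrightarrow> C \<one>\<^bsub>G\<^esub> h = h"
  and C_mult: "g \<in> carrier G \<Longrightarrow> g' \<in> carrier G \<Longrightarrow> h \<in> carrier H \<Longrightarrow> C (g \<otimes>\<^bsub>G\<^esub> g') h = C g (C g' h)"
  and d_hom: "d \<in> hom H G"
  and d_C: "g \<in> carrier G \<Longrightarrow> h \<in> carrier H \<Longrightarrow> d (C g h) = g \<otimes>\<^bsub>G\<^esub> d h \<otimes>\<^bsub>G\<^esub> inv\<^bsub>G\<^esub> g"
  and C_d: "h \<in> carrier H \<Longrightarrow> h' \<in> carrier H \<Longrightarrow> C (d h) h' = h \<otimes>\<^bsub>H\<^esub> h' \<otimes>\<^bsub>H\<^esub> inv\<^bsub>H\<^esub> h"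
  using crossed_module unfolding crossed_module_def lie_group_action_def by simp_all

lemma C_hom: "g \<in> carrier G \<Longrightarrow> group_hom H H (C g)"
  using C_iso by (auto simp: iso_def group_hom_def group_hom_axioms_def)

lemma C_closed [simp]: "g \<in> carrier G \<Longrightarrow> h \<in> carrier H \<Longrightarrow> C g h \<in> carrier H"
  and C_H_mult: "g \<in> carrier G \<Longrightarrow> h \<in> carrier H \<Longrightarrow> h' \<in> carrier H \<Longrightarrow> C g (h \<otimes>\<^bsub>H\<^esub> h') = C g h \<otimes>\<^bsub>H\<^esub> C g h'"
  and C_H_one [simp]: "g \<in> carrier G \<Longrightarrow> C g \<one>\<^bsub>H\<^esub> = \<one>\<^bsub>H\<^esub>"
  and C_H_inv: "g \<in> carrier G \<Longrightarrow> h \<in> carrier H \<Longrightarrow> C g (inv\<^bsub>H\<^esub> h) = inv\<^bsub>H\<^esub> (C g h)"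
  using group_hom.hom_closed[OF C_hom] group_hom.hom_mult[OF C_hom] group_hom.hom_one[OF C_hom]
    group_hom.hom_inv[OF C_hom] by auto

lemma C_inv_cancel: 
  assumes "g \<in> carrier G" "h \<in> carrier H"
  shows "C (inv\<^bsub>G\<^esub> g) (C g h) = h" "C g (C (inv\<^bsub>G\<^esub> g) h) = h"
  using assms by (simp_all flip: C_mult)

lemma C_eq_one:
  assumes "g \<in> carrier G" "h \<in> carrier H" "C g h = \<one>\<^bsub>H\<^esub>"
  shows "h = \<one>\<^bsub>H\<^esub>"
  using C_inv_cancel(1)[OF assms(1,2)] assms by simp

lemma group_hom_d: "group_hom H G d"
  using d_hom by (simp add: group_hom_def group_hom_axioms_def H.is_group G.is_group)

lemma d_closed [simp]: "h \<in> carrier H \<Longrightarrow> d h \<in> carrier G"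
  and d_inv: "h \<in> carrier H \<Longrightarrow> d (inv\<^bsub>H\<^esub> h) = inv\<^bsub>G\<^esub> (d h)"
  using group_hom.hom_closed[OF group_hom_d] group_hom.hom_inv[OF group_hom_d] by auto

text \<open>In this pointwise form, over an arbitrary domain \<open>S\<close>, smoothness of a long
  word in group elements reduces to that of its letters by introduction rules.\<close>

lemma smooth_ops:
  assumes "manifold M"
  shows "smooth_map_on S M (gmfd H) h \<Longrightarrow> smooth_map_on S M (gmfd H) h' \<Longrightarrow>
      smooth_map_on S M (gmfd H) (\<lambda>x. h x \<otimes>\<^bsub>H\<^esub> h' x)"
    and "smooth_map_on S M (gmfd H) h \<Longrightarrow> smooth_map_on S M (gmfd H) (\<lambda>x. inv\<^bsub>H\<^esub> (h x))"
    and "smooth_map_on S M (gmfd G) g \<Longrightarrow> smooth_map_on S M (gmfd G) g' \<Longrightarrow>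
      smooth_map_on S M (gmfd G) (\<lambda>x. g x \<otimes>\<^bsub>G\<^esub> g' x)"
    and "smooth_map_on S M (gmfd G) g \<Longrightarrow> smooth_map_on S M (gmfd G) (\<lambda>x. inv\<^bsub>G\<^esub> (g x))"
    and "smooth_map_on S M (gmfd G) g \<Longrightarrow> smooth_map_on S M (gmfd H) h \<Longrightarrow>
      smooth_map_on S M (gmfd H) (\<lambda>x. C (g x) (h x))"
proof -
  have sm: "smooth_map (prod_mfd (gmfd H) (gmfd H)) (gmfd H) (\<lambda>(a, b). a \<otimes>\<^bsub>H\<^esub> b)"
    "smooth_map (gmfd H) (gmfd H) (\<lambda>a. inv\<^bsub>H\<^esub> a)"
    "smooth_map (prod_mfd (gmfd G) (gmfd G)) (gmfd G) (\<lambda>(a, b). a \<otimes>\<^bsub>G\<^esub> b)"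
    "smooth_map (gmfd G) (gmfd G) (\<lambda>a. inv\<^bsub>G\<^esub> a)"
    "smooth_map (prod_mfd (gmfd G) (gmfd H)) (gmfd H) (\<lambda>(g, h). C g h)"
    using crossed_module lie_H lie_G
    unfolding crossed_module_def lie_group_def lie_group_action_def by blast+
  note m = manifold_gmfd
  show "smooth_map_on S M (gmfd H) h \<Longrightarrow> smooth_map_on S M (gmfd H) h' \<Longrightarrow>
      smooth_map_on S M (gmfd H) (\<lambda>x. h x \<otimes>\<^bsub>H\<^esub> h' x)"
    by (rule smooth_map_on_binop[OF assms m(1) m(1) sm(1)])
  show "smooth_map_on S M (gmfd H) h \<Longrightarrow> smooth_map_on S M (gmfd H) (\<lambda>x. inv\<^bsub>H\<^esub> (h x))"
    by (rule smooth_map_compose[OF assms m(1) _ sm(2)])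
  show "smooth_map_on S M (gmfd G) g \<Longrightarrow> smooth_map_on S M (gmfd G) g' \<Longrightarrow>
      smooth_map_on S M (gmfd G) (\<lambda>x. g x \<otimes>\<^bsub>G\<^esub> g' x)"
    by (rule smooth_map_on_binop[OF assms m(2) m(2) sm(3)])
  show "smooth_map_on S M (gmfd G) g \<Longrightarrow> smooth_map_on S M (gmfd G) (\<lambda>x. inv\<^bsub>G\<^esub> (g x))"
    by (rule smooth_map_compose[OF assms m(2) _ sm(4)])
  show "smooth_map_on S M (gmfd G) g \<Longrightarrow> smooth_map_on S M (gmfd H) h \<Longrightarrow>
      smooth_map_on S M (gmfd H) (\<lambda>x. C (g x) (h x))"
    by (rule smooth_map_on_binop[OF assms m(2) m(1) sm(5)])
qed

lemma cm_group_sel [simp]: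
  "carrier (cm_group H G C) = carrier H \<times> carrier G"
  "(h2, g2) \<otimes>\<^bsub>cm_group H G C\<^esub> (h1, g1) = (h2 \<otimes>\<^bsub>H\<^esub> C g2 h1, g2 \<otimes>\<^bsub>G\<^esub> g1)"
  "\<one>\<^bsub>cm_group H G C\<^esub> = (\<one>\<^bsub>H\<^esub>, \<one>\<^bsub>G\<^esub>)"
  "gmfd (cm_group H G C) = prod_mfd (gmfd H) (gmfd G)"
  by (simp_all add: cm_group_def)

lemma group_cm_group: "group (cm_group H G C)"
proof (rule groupI)
  fix x y z
  assume "x \<in> carrier (cm_group H G C)" "y \<in> carrier (cm_group H G C)" "z \<in> carrier (cm_group H G C)"
  then show "x \<otimes>\<^bsub>cm_group H G C\<^esub> y \<otimes>\<^bsub>cm_group H G C\<^esub> z = x \<otimes>\<^bsub>cm_group H G C\<^esub> (y \<otimes>\<^bsub>cm_group H G C\<^esub> z)"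
    by (cases x; cases y; cases z) (simp add: C_mult C_H_mult H.m_assoc G.m_assoc)
next
  fix x assume x: "x \<in> carrier (cm_group H G C)"
  then show "\<exists>y\<in>carrier (cm_group H G C). y \<otimes>\<^bsub>cm_group H G C\<^esub> x = \<one>\<^bsub>cm_group H G C\<^esub>"
    by (intro bexI[of _ "(C (inv\<^bsub>G\<^esub> (snd x)) (inv\<^bsub>H\<^esub> (fst x)), inv\<^bsub>G\<^esub> (snd x))"])
      (cases x; simp add: C_H_inv)+
qed auto

text \<open>The explicit formula makes inversion in the semidirect product visibly smooth.\<close>

lemma inv_cm_group:
  assumes "h \<in> carrier H" "g \<in> carrier G"
  shows "inv\<^bsub>cm_group H G C\<^esub> (h, g) = (C (inv\<^bsub>G\<^esub> g) (inv\<^bsub>H\<^esub> h), inv\<^bsub>G\<^esub> g)"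
  by (rule group.inv_equality[OF group_cm_group]) (use assms in \<open>simp_all add: C_H_inv\<close>)

lemma lie_group_cm_group: "lie_group (cm_group H G C)"
proof -
  let ?K = "prod_mfd (gmfd H) (gmfd G)"
  note m = manifold_gmfd
  have K: "manifold ?K" by (rule manifold_prod_mfd[OF m])
  have KK: "manifold (prod_mfd ?K ?K)" by (rule manifold_prod_mfd[OF K K])
  note p = smooth_map_fst[OF K K] smooth_map_snd[OF K K]
  have "smooth_map (prod_mfd ?K ?K) ?K
      (\<lambda>x. (fst (fst x) \<otimes>\<^bsub>H\<^esub> C (snd (fst x)) (fst (snd x)), snd (fst x) \<otimes>\<^bsub>G\<^esub> snd (snd x)))"
    by (intro smooth_map_on_Pair[OF KK] smooth_ops[OF KK]
        smooth_map_on_fst[OF KK m p(1)] smooth_map_on_fst[OF KK m p(2)]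
        smooth_map_on_snd[OF KK m p(1)] smooth_map_on_snd[OF KK m p(2)])
  then have mult: "smooth_map (prod_mfd ?K ?K) ?K (\<lambda>(a, b). a \<otimes>\<^bsub>cm_group H G C\<^esub> b)"
    by (simp add: cm_group_def case_prod_beta')
  have "smooth_map ?K ?K (\<lambda>x. (C (inv\<^bsub>G\<^esub> (snd x)) (inv\<^bsub>H\<^esub> (fst x)), inv\<^bsub>G\<^esub> (snd x)))"
    by (intro smooth_map_on_Pair[OF K] smooth_ops[OF K] smooth_map_fst[OF m] smooth_map_snd[OF m])
  then have "smooth_map ?K ?K (\<lambda>a. inv\<^bsub>cm_group H G C\<^esub> a)"
    by (rule smooth_map_on_cong[OF K]) (auto simp: inv_cm_group)
  with mult group_cm_group K show ?thesis
    unfolding lie_group_def by simp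
qed

end

section \<open>Bundle gerbes and the action of H on the fibres\<close>

locale gerbe = lie_crossed_module H G C d
  for H :: "('h, 'eh::euclidean_space) lie_grp"
    and G :: "('g, 'eg::euclidean_space) lie_grp"
    and C :: "'g \<Rightarrow> 'h \<Rightarrow> 'h"
    and d :: "'h \<Rightarrow> 'g" +
  fixes Y :: "('y, 'z, 'ey::euclidean_space, 'ez::euclidean_space) grpd"
    and B :: "('y, 'b, 'ey, 'eb::euclidean_space) grpd"
    and pr :: "'b \<Rightarrow> 'z"
    and \<rho> :: "'b \<Rightarrow> 'g"
    and star :: "'h \<times> 'g \<Rightarrow> 'b \<Rightarrow> 'b"
  assumes lie_Y: "lie_groupoid Y"
    and bundle_gerbe: "bundle_gerbe H G C d Y B pr \<rho> star"
begin

abbreviation "BB \<equiv> pts (arrs B)"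

text \<open>The action of \<open>H\<rtimes>G\<close> on an element \<open>b\<close> only involves the arrows with source \<open>\<rho> b\<close>, which are
  parametrised by \<open>H\<close>.\<close>

definition hact :: "'h \<Rightarrow> 'b \<Rightarrow> 'b" where
  "hact h b = star (h, \<rho> b) b"

lemma lie_B: "lie_groupoid B" and objs_B: "objs B = objs Y"
  and mor_pr: "lie_groupoid_morphism B Y pr id"
  and principal_pr: "principal_groupoid_bundle (cm_groupoid H G d) (arrs B) \<rho> star (arrs Y) pr"
  using bundle_gerbe unfolding bundle_gerbe_def by auto

lemmas B = lie_groupoidD[OF lie_B] and B_pts = lie_groupoid_pts[OF lie_B]

lemma act_star: "groupoid_action (cm_groupoid H G d) (arrs B) \<rho> star"
  and sub_pr: "surjective_submersion (arrs B) (arrs Y) pr"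
  using principal_pr unfolding principal_groupoid_bundle_def by auto

lemma action_domain_eq: "action_domain (cm_groupoid H G d) (arrs B) \<rho> = {((h, g), b). h \<in> carrier H \<and> g = \<rho> b \<and> g \<in> carrier G \<and> b \<in> BB}"
  by (auto simp: action_domain_def cm_groupoid_def)

lemma smooth_rho: "smooth_map (arrs B) (gmfd G) \<rho>"
  using act_star unfolding groupoid_action_def by (simp add: cm_groupoid_def surjective_submersion_smooth)

lemma rho_closed [simp]: "b \<in> BB \<Longrightarrow> \<rho> b \<in> carrier G"
  using smooth_map_on_pts[OF smooth_rho] by simp

lemma in_action_domain: "b \<in> BB \<Longrightarrow> h \<in> carrier H \<Longrightarrow> ((h, \<rho> b), b) \<in> action_domain (cm_groupoid H G d) (arrs B) \<rho>"
  by (simp add: action_domain_eq)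

lemma smooth_star: "smooth_map_on (action_domain (cm_groupoid H G d) (arrs B) \<rho>)
    (prod_mfd (prod_mfd (gmfd H) (gmfd G)) (arrs B)) (arrs B) (\<lambda>(\<gamma>, b). star \<gamma> b)"
  using act_star unfolding groupoid_action_def by (simp add: cm_groupoid_def)

lemma hact_closed [simp]:
  assumes "b \<in> BB" "h \<in> carrier H"
  shows "hact h b \<in> BB"
  using smooth_map_on_pts[OF smooth_star in_action_domain[OF assms]] assms by (simp add: hact_def)

lemma rho_hact [simp]:
  assumes "b \<in> BB" "h \<in> carrier H"
  shows "\<rho> (hact h b) = d h \<otimes>\<^bsub>G\<^esub> \<rho> b"
  using act_star in_action_domain[OF assms] unfolding groupoid_action_def
  by (fastforce simp: hact_def cm_groupoid_def)

text \<open>The anchor equation makes the arrow labelled \<open>h'\<close> at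
  \<open>\<rho> (hact h b)\<close> composable with the arrow labelled \<open>h\<close> at
  \<open>\<rho> b\<close>, and composition multiplies labels. So \<open>hact\<close> is an honest
  action of the group \<open>H\<close>.\<close>

lemma hact_hact:
  assumes "b \<in> BB" "h \<in> carrier H" "h' \<in> carrier H"
  shows "hact h' (hact h b) = hact (h' \<otimes>\<^bsub>H\<^esub> h) b"
proof -
  have "((h', d h \<otimes>\<^bsub>G\<^esub> \<rho> b), (h, \<rho> b)) \<in> composable (cm_groupoid H G d)"
    using assms by (simp add: composable_def cm_groupoid_def)
  then have "star (h', d h \<otimes>\<^bsub>G\<^esub> \<rho> b) (star (h, \<rho> b) b) = star (h' \<otimes>\<^bsub>H\<^esub> h, \<rho> b) b"
    using act_star in_action_domain[OF assms(1,2)] unfolding groupoid_action_def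
    by (simp add: cm_groupoid_def)
  then show ?thesis
    using rho_hact[OF assms(1,2)] by (simp add: hact_def)
qed

lemma hact_one [simp]: "b \<in> BB \<Longrightarrow> hact \<one>\<^bsub>H\<^esub> b = b"
  using act_star unfolding groupoid_action_def by (simp add: hact_def cm_groupoid_def)

lemma hact_free:
  assumes "b \<in> BB" "h \<in> carrier H" "hact h b = b"
  shows "h = \<one>\<^bsub>H\<^esub>"
proof -
  have "(h, \<rho> b) = unit_arr (cm_groupoid H G d) (\<rho> b)"
    using principal_pr in_action_domain[OF assms(1,2)] assms(3)
    unfolding principal_groupoid_bundle_def hact_def by fast
  then show ?thesis by (simp add: cm_groupoid_def)
qed

lemma pr_hact [simp]:
  assumes "b \<in> BB" "h \<in> carrier H"
  shows "pr (hact h b) = pr b"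
  using principal_pr in_action_domain[OF assms] unfolding principal_groupoid_bundle_def hact_def by fast

text \<open>The identification of the orbit space with \<open>arrs Y\<close> is injective, so points
  with the same projection have the same orbit. The unit law puts \<open>b'\<close> into its own
  orbit, hence into that of \<open>b\<close>.\<close>

lemma hact_transitive:
  assumes "b \<in> BB" "b' \<in> BB" "pr b = pr b'"
  obtains h where "h \<in> carrier H" "b' = hact h b"
proof -
  let ?O = "groupoid_orbit (cm_groupoid H G d) \<rho> star"
  obtain Q :: "('b set, 'ez) mfd" and F where Q: "quotient_manifold (arrs B) ?O Q"
    "\<And>b. b \<in> BB \<Longrightarrow> F (?O b) = pr b" "diffeomorphism Q (arrs Y) F"
    using principal_pr unfolding principal_groupoid_bundle_def by blast
  have "?O c \<in> pts Q" if "c \<in> BB" for c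
    using Q(1) that surjective_submersion_image unfolding quotient_manifold_def by blast
  moreover have "inj_on F (pts Q)"
    using Q(3) unfolding diffeomorphism_def by (metis inj_on_inverseI)
  ultimately have "?O b = ?O b'"
    using Q(2) assms by (metis inj_onD)
  moreover have "b' \<in> ?O b'"
  proof -
    have "b' = star (\<one>\<^bsub>H\<^esub>, \<rho> b') b'"
      using hact_one[OF assms(2)] by (simp add: hact_def)
    then show ?thesis
      using assms(2) unfolding groupoid_orbit_def by (force simp: cm_groupoid_def)
  qed
  ultimately obtain h where "h \<in> carrier H" "b' = star (h, \<rho> b) b"
    unfolding groupoid_orbit_def by (auto simp: cm_groupoid_def)
  then show thesis
    using that unfolding hact_def by blast
qed

lemma source_pr: "b \<in> BB \<Longrightarrow> source Y (pr b) = source B b"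
  and target_pr: "b \<in> BB \<Longrightarrow> target Y (pr b) = target B b"
  using mor_pr unfolding lie_groupoid_morphism_def by auto

lemma pr_comp: "(b2, b1) \<in> composable B \<Longrightarrow> pr (comp_arr B b2 b1) = comp_arr Y (pr b2) (pr b1)"
  using mor_pr unfolding lie_groupoid_morphism_def by auto

lemma source_hact [simp]: "b \<in> BB \<Longrightarrow> h \<in> carrier H \<Longrightarrow> source B (hact h b) = source B b"
  and target_hact [simp]: "b \<in> BB \<Longrightarrow> h \<in> carrier H \<Longrightarrow> target B (hact h b) = target B b"
  by (simp_all flip: source_pr target_pr)

lemma rho_comp: "(b2, b1) \<in> composable B \<Longrightarrow> \<rho> (comp_arr B b2 b1) = \<rho> b2 \<otimes>\<^bsub>G\<^esub> \<rho> b1"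
  using bundle_gerbe unfolding bundle_gerbe_def by fast

lemma comp_hact:
  assumes "(b2, b1) \<in> composable B" "h2 \<in> carrier H" "h1 \<in> carrier H"
  shows "comp_arr B (hact h2 b2) (hact h1 b1) = hact (h2 \<otimes>\<^bsub>H\<^esub> C (\<rho> b2) h1) (comp_arr B b2 b1)"
proof -
  have "comp_arr B (hact h2 b2) (hact h1 b1) =
      star ((h2, \<rho> b2) \<otimes>\<^bsub>cm_group H G C\<^esub> (h1, \<rho> b1)) (comp_arr B b2 b1)"
    using bundle_gerbe assms unfolding bundle_gerbe_def hact_def by fast
  then show ?thesis
    using rho_comp[OF assms(1)] by (simp add: hact_def)
qed

lemma composable_B: "(b2, b1) \<in> composable B \<longleftrightarrow> b2 \<in> BB \<and> b1 \<in> BB \<and> source B b2 = target B b1"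
  by (simp add: composable_def)

text \<open>A unit composed with itself is itself, so multiplicativity of \<open>\<rho>\<close>
  makes its anchor an idempotent of the group \<open>G\<close>.\<close>

lemma rho_unit [simp]:
  assumes "y \<in> pts (objs Y)"
  shows "\<rho> (unit_arr B y) = \<one>\<^bsub>G\<^esub>"
proof -
  let ?u = "unit_arr B y"
  have u: "?u \<in> BB" "source B ?u = y" "target B ?u = y"
    using assms B(11,12) B_pts(4) by (simp_all add: objs_B)
  then have "comp_arr B ?u ?u = ?u"
    using B(13)[of ?u] by simp
  then have "\<rho> ?u \<otimes>\<^bsub>G\<^esub> \<rho> ?u = \<rho> ?u"
    using rho_comp[of ?u ?u] u by (simp add: composable_B)
  then show ?thesis
    using u(1) by (metis G.l_cancel_one rho_closed)
qed

lemma rho_inv [simp]: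
  assumes "b \<in> BB"
  shows "\<rho> (inv_arr B b) = inv\<^bsub>G\<^esub> (\<rho> b)"
proof -
  have "(inv_arr B b, b) \<in> composable B"
    using assms B(15) B_pts(5) by (simp add: composable_B)
  then have "\<rho> (inv_arr B b) \<otimes>\<^bsub>G\<^esub> \<rho> b = \<one>\<^bsub>G\<^esub>"
    using rho_comp[of "inv_arr B b" b] B(17)[OF assms] B_pts(1)[OF assms] by (simp add: objs_B)
  then show ?thesis
    using G.inv_equality assms B_pts(5) by simp
qed

lemma smooth_B_ops:
  assumes M: "manifold M"
  shows "smooth_map_on S M (arrs B) b \<Longrightarrow> smooth_map_on S M (gmfd G) (\<lambda>x. \<rho> (b x))"
    and "smooth_map_on S M (gmfd H) h \<Longrightarrow> smooth_map_on S M (arrs B) b \<Longrightarrow>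
      smooth_map_on S M (arrs B) (\<lambda>x. hact (h x) (b x))"
proof -
  show rho: "smooth_map_on S M (gmfd G) (\<lambda>x. \<rho> (b x))" if "smooth_map_on S M (arrs B) b"
    by (rule smooth_map_compose[OF M B(2) that smooth_rho])
  show "smooth_map_on S M (arrs B) (\<lambda>x. hact (h x) (b x))"
    if h: "smooth_map_on S M (gmfd H) h" and b: "smooth_map_on S M (arrs B) b"
  proof -
    have "smooth_map_on S M (prod_mfd (prod_mfd (gmfd H) (gmfd G)) (arrs B)) (\<lambda>x. ((h x, \<rho> (b x)), b x))"
      by (intro smooth_map_on_Pair[OF M] h b rho)
    \<comment> \<open>\<open>star\<close> is known to be smooth only on the fibre product; taking
      \<open>\<rho> (b x)\<close> as the source of the arrow ensures membership there.\<close>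
    moreover have "((h x, \<rho> (b x)), b x) \<in> action_domain (cm_groupoid H G d) (arrs B) \<rho>"
      if "x \<in> S" "x \<in> pts M" for x
      using smooth_map_on_pts[OF h that] smooth_map_on_pts[OF b that] by (simp add: in_action_domain)
    ultimately have "smooth_map_on S M (arrs B) (\<lambda>x. (\<lambda>(\<gamma>, b). star \<gamma> b) ((h x, \<rho> (b x)), b x))"
      by (intro smooth_map_on_compose[OF M _ _ smooth_star] manifold_prod_mfd manifold_gmfd B(2))
    then show ?thesis
      by (simp add: hact_def)
  qed
qed

section \<open>The associated principal bundle groupoid\<close>

definition gerbe_bundle :: "('g \<times> 'y, 'g \<times> 'b, 'eg \<times> 'ey, 'eg \<times> 'eb) grpd" where
  "gerbe_bundle =
    \<lparr> objs = prod_mfd (gmfd G) (objs Y),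
      arrs = prod_mfd (gmfd G) (arrs B),
      source = (\<lambda>(k, b). (k, source Y (pr b))),
      target = (\<lambda>(k, b). (k \<otimes>\<^bsub>G\<^esub> inv\<^bsub>G\<^esub> (\<rho> b), target Y (pr b))),
      comp_arr = (\<lambda>(k2, b2) (k1, b1). (k1, comp_arr B b2 b1)),
      unit_arr = (\<lambda>(g, y). (g, unit_arr B y)),
      inv_arr = (\<lambda>(g, b). (g \<otimes>\<^bsub>G\<^esub> inv\<^bsub>G\<^esub> (\<rho> b), inv_arr B b)) \<rparr>"

lemma gerbe_bundle_sel [simp]:
  "objs gerbe_bundle = prod_mfd (gmfd G) (objs Y)"
  "arrs gerbe_bundle = prod_mfd (gmfd G) (arrs B)"
  "source gerbe_bundle (k, b) = (k, source Y (pr b))"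
  "target gerbe_bundle (k, b) = (k \<otimes>\<^bsub>G\<^esub> inv\<^bsub>G\<^esub> (\<rho> b), target Y (pr b))"
  "comp_arr gerbe_bundle (k2, b2) (k1, b1) = (k1, comp_arr B b2 b1)"
  "unit_arr gerbe_bundle (k, y) = (k, unit_arr B y)"
  "inv_arr gerbe_bundle (k, b) = (k \<otimes>\<^bsub>G\<^esub> inv\<^bsub>G\<^esub> (\<rho> b), inv_arr B b)"
  by (simp_all add: gerbe_bundle_def)

text \<open>The twist x = \<rho>(b)k^-1 g^-1 is the inverse of gk\<rho>(b)^-1, the group component
  of the target after acting by g alone. Moving b by C_x h^-1 multiplies \<rho>(b) on the left by x
  d(h)^-1 x^-1, which turns the component x^-1 into d(h)x^-1. This is what the target d(h)g of the
  arrow (h, g) requires.\<close>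

definition act1 :: "'h \<times> 'g \<Rightarrow> 'g \<times> 'b \<Rightarrow> 'g \<times> 'b" where
  "act1 = (\<lambda>(h, g) (k, b).
     (g \<otimes>\<^bsub>G\<^esub> k, star (C (\<rho> b \<otimes>\<^bsub>G\<^esub> inv\<^bsub>G\<^esub> k \<otimes>\<^bsub>G\<^esub> inv\<^bsub>G\<^esub> g) (inv\<^bsub>H\<^esub> h), \<rho> b) b))"

definition act0 :: "'g \<Rightarrow> 'g \<times> 'y \<Rightarrow> 'g \<times> 'y" where
  "act0 = (\<lambda>g (k, y). (g \<otimes>\<^bsub>G\<^esub> k, y))"

lemma act1_eq [simp]: 
  "act1 (h, g) (k, b) = (g \<otimes>\<^bsub>G\<^esub> k, hact (C (\<rho> b \<otimes>\<^bsub>G\<^esub> inv\<^bsub>G\<^esub> k \<otimes>\<^bsub>G\<^esub> inv\<^bsub>G\<^esub> g) (inv\<^bsub>H\<^esub> h)) b)"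
  by (simp add: act1_def hact_def)

lemma act0_eq [simp]: "act0 g (k, y) = (g \<otimes>\<^bsub>G\<^esub> k, y)"
  by (simp add: act0_def)

text \<open>Composability leaves \<open>k\<close>, \<open>b2\<close> and \<open>b1\<close> free: the
  group component of the later arrow is determined by the earlier one, which is why composition may
  discard it. Since \<open>pr\<close> covers the identity on objects, the other component is
  composability in \<open>B\<close>.\<close>

lemma composable_gerbe_bundleE:
  assumes "(a2, a1) \<in> composable gerbe_bundle"
  obtains k b2 b1 where "a1 = (k, b1)" "a2 = (k \<otimes>\<^bsub>G\<^esub> inv\<^bsub>G\<^esub> (\<rho> b1), b2)" "k \<in> carrier G"
    "(b2, b1) \<in> composable B"
  using assms
  by (cases a1; cases a2) (auto simp: composable_def source_pr target_pr)

section \<open>The Lie groupoid structure\<close>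

lemma manifold_GB: "manifold (prod_mfd (gmfd G) (arrs B))"
  and manifold_GY: "manifold (prod_mfd (gmfd G) (objs Y))"
  using manifold_prod_mfd manifold_gmfd B(2) lie_groupoidD(1)[OF lie_Y] by blast+

lemma lie_groupoid_gerbe_bundle: "lie_groupoid gerbe_bundle"
proof (rule lie_groupoidI)
  note mG = manifold_gmfd(2)
  note mY = lie_groupoidD(1)[OF lie_Y]
  let ?P = "prod_mfd (gmfd G) (arrs B)"
  note fs = smooth_map_fst[OF mG B(2)] smooth_map_snd[OF mG B(2)]
  show "manifold (objs gerbe_bundle)" "manifold (arrs gerbe_bundle)"
    using manifold_GB manifold_GY by simp_all
  have sG: "surjective_submersion (gmfd G) (gmfd G) (\<lambda>x. x)"
    by (rule surjective_submersion_ident[OF mG])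
  have ss: "surjective_submersion ?P (prod_mfd (gmfd G) (objs Y)) (map_prod (\<lambda>x. x) (source B))"
    by (rule surjective_submersion_map_prod[OF mG B(2) mG mY sG B(3)[unfolded objs_B]])
  then show "surjective_submersion (arrs gerbe_bundle) (objs gerbe_bundle) (source gerbe_bundle)"
    unfolding gerbe_bundle_sel by (rule surjective_submersion_cong[OF manifold_GB]) (auto simp: source_pr)
  have st: "surjective_submersion ?P (prod_mfd (gmfd G) (objs Y)) (map_prod (\<lambda>x. x) (target B))"
    by (rule surjective_submersion_map_prod[OF mG B(2) mG mY sG B(4)[unfolded objs_B]])
  let ?\<theta> = "\<lambda>x. (fst x \<otimes>\<^bsub>G\<^esub> inv\<^bsub>G\<^esub> (\<rho> (snd x)), snd x)"
  have \<theta>: "smooth_map ?P ?P ?\<theta>"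
    by (intro smooth_map_on_Pair[OF manifold_GB] smooth_ops[OF manifold_GB] smooth_B_ops[OF manifold_GB] fs)
  have "diffeomorphism ?P ?P ?\<theta>"
  proof (rule diffeomorphismI)
    \<comment> \<open>\<open>?\<theta>\<close> leaves \<open>b\<close> alone, so multiplying back by
      the same \<open>\<rho> b\<close> inverts it.\<close>
    show "smooth_map ?P ?P (\<lambda>x. (fst x \<otimes>\<^bsub>G\<^esub> \<rho> (snd x), snd x))"
      by (intro smooth_map_on_Pair[OF manifold_GB] smooth_ops[OF manifold_GB] smooth_B_ops[OF manifold_GB] fs)
  qed (use \<theta> in \<open>auto simp: G.m_assoc\<close>)
  then have "surjective_submersion ?P ?P ?\<theta>"
    by (rule diffeomorphism_imp_surjective_submersion[OF manifold_GB manifold_GB])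
  from surjective_submersion_compose[OF manifold_GB manifold_GB manifold_GY this st]
  show "surjective_submersion (arrs gerbe_bundle) (objs gerbe_bundle) (target gerbe_bundle)"
    unfolding gerbe_bundle_sel by (rule surjective_submersion_cong[OF manifold_GB]) (auto simp: target_pr)
  let ?PP = "prod_mfd ?P ?P"
  have PP: "manifold ?PP" by (rule manifold_prod_mfd[OF manifold_GB manifold_GB])
  note pp = smooth_map_fst[OF manifold_GB manifold_GB] smooth_map_snd[OF manifold_GB manifold_GB]
  have sub: "composable gerbe_bundle \<subseteq> pts ?PP"
    by (auto simp: composable_def)
  have k: "smooth_map_on (composable gerbe_bundle) ?PP (gmfd G) (\<lambda>x. fst (snd x))"
    by (rule smooth_map_on_subset[OF smooth_map_on_fst[OF PP mG B(2) pp(2)] sub])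
  have b: "smooth_map_on (composable gerbe_bundle) ?PP (prod_mfd (arrs B) (arrs B)) (\<lambda>x. (snd (fst x), snd (snd x)))"
    by (intro smooth_map_on_subset[OF _ sub] smooth_map_on_Pair[OF PP]
        smooth_map_on_snd[OF PP mG B(2) pp(1)] smooth_map_on_snd[OF PP mG B(2) pp(2)])
  have "smooth_map_on (composable gerbe_bundle) ?PP (arrs B)
      (\<lambda>x. (\<lambda>(b2, b1). comp_arr B b2 b1) (snd (fst x), snd (snd x)))"
    by (rule smooth_map_on_compose[OF PP manifold_prod_mfd[OF B(2) B(2)] b B(5)])
      (auto elim!: composable_gerbe_bundleE)
  from smooth_map_on_Pair[OF PP k this]
  show "smooth_map_on (composable gerbe_bundle) (prod_mfd (arrs gerbe_bundle) (arrs gerbe_bundle)) (arrs gerbe_bundle)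
      (\<lambda>(a2, a1). comp_arr gerbe_bundle a2 a1)"
    by (simp add: gerbe_bundle_def case_prod_beta')
  note fsY = smooth_map_fst[OF mG mY] smooth_map_snd[OF mG mY]
  have "smooth_map (prod_mfd (gmfd G) (objs Y)) ?P (\<lambda>x. (fst x, unit_arr B (snd x)))"
    by (intro smooth_map_on_Pair[OF manifold_GY fsY(1)] smooth_map_compose[OF manifold_GY mY fsY(2)] B(6)[unfolded objs_B])
  then show "smooth_map (objs gerbe_bundle) (arrs gerbe_bundle) (unit_arr gerbe_bundle)"
    by (simp add: gerbe_bundle_def case_prod_beta')
  have "smooth_map ?P ?P (\<lambda>x. (fst x \<otimes>\<^bsub>G\<^esub> inv\<^bsub>G\<^esub> (\<rho> (snd x)), inv_arr B (snd x)))"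
    by (intro smooth_map_on_Pair[OF manifold_GB] smooth_ops[OF manifold_GB] smooth_B_ops[OF manifold_GB] fs
      smooth_map_compose[OF manifold_GB B(2) fs(2) B(7)])
  then show "smooth_map (arrs gerbe_bundle) (arrs gerbe_bundle) (inv_arr gerbe_bundle)"
    by (simp add: gerbe_bundle_def case_prod_beta')
  note B_simps = B(8,9) B_pts source_pr target_pr rho_comp
  show "source gerbe_bundle (comp_arr gerbe_bundle a2 a1) = source gerbe_bundle a1"
    if "(a2, a1) \<in> composable gerbe_bundle" for a2 a1
    using that by (rule composable_gerbe_bundleE) (simp add: B_simps composable_B)
  show "target gerbe_bundle (comp_arr gerbe_bundle a2 a1) = target gerbe_bundle a2"
    if "(a2, a1) \<in> composable gerbe_bundle" for a2 a1
    using that by (rule composable_gerbe_bundleE) (simp add: B_simps composable_B G.m_assoc G.inv_mult_group)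
  show "comp_arr gerbe_bundle (comp_arr gerbe_bundle a3 a2) a1 = comp_arr gerbe_bundle a3 (comp_arr gerbe_bundle a2 a1)"
    if "(a3, a2) \<in> composable gerbe_bundle" "(a2, a1) \<in> composable gerbe_bundle" for a3 a2 a1
    using that by (auto elim!: composable_gerbe_bundleE simp: B(10))
  fix a assume "a \<in> pts (arrs gerbe_bundle)"
  then obtain k b where a: "a = (k, b)" "k \<in> carrier G" "b \<in> BB"
    by auto
  then show "comp_arr gerbe_bundle a (unit_arr gerbe_bundle (source gerbe_bundle a)) = a"
    "comp_arr gerbe_bundle (unit_arr gerbe_bundle (target gerbe_bundle a)) a = a"
    "source gerbe_bundle (inv_arr gerbe_bundle a) = target gerbe_bundle a"
    "target gerbe_bundle (inv_arr gerbe_bundle a) = source gerbe_bundle a"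
    "comp_arr gerbe_bundle (inv_arr gerbe_bundle a) a = unit_arr gerbe_bundle (source gerbe_bundle a)"
    "comp_arr gerbe_bundle a (inv_arr gerbe_bundle a) = unit_arr gerbe_bundle (target gerbe_bundle a)"
    using B(13-18)[OF a(3)] B_pts(5)[OF a(3)] by (simp_all add: source_pr target_pr G.m_assoc)
next
  fix x assume "x \<in> pts (objs gerbe_bundle)"
  then show "source gerbe_bundle (unit_arr gerbe_bundle x) = x" "target gerbe_bundle (unit_arr gerbe_bundle x) = x"
    using B(11,12) B_pts(4) by (auto simp: source_pr target_pr objs_B)
qed

section \<open>The Lie 2-group action\<close>

lemma rho_act1:
  assumes "h \<in> carrier H" "g \<in> carrier G" "k \<in> carrier G" "b \<in> BB"
  shows "\<rho> (snd (act1 (h, g) (k, b))) = \<rho> b \<otimes>\<^bsub>G\<^esub> inv\<^bsub>G\<^esub> k \<otimes>\<^bsub>G\<^esub> inv\<^bsub>G\<^esub> g \<otimes>\<^bsub>G\<^esub> inv\<^bsub>G\<^esub> (d h) \<otimes>\<^bsub>G\<^esub> g \<otimes>\<^bsub>G\<^esub> k"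
  \<comment> \<open>With x = \<rho>(b)k^-1 g^-1 the new anchor is x d(h)^-1 x^-1 \<rho>(b), and x^-1
    \<rho>(b) = gk.\<close>
  using assms by (simp add: d_C d_inv G.m_assoc G.inv_mult_group G.inv_mult_cancel)

lemma smooth_act1:
  "smooth_map (prod_mfd (prod_mfd (gmfd H) (gmfd G)) (prod_mfd (gmfd G) (arrs B))) (prod_mfd (gmfd G) (arrs B))
     (\<lambda>(p, x). act1 p x)" (is "smooth_map ?M ?P _")
proof -
  let ?K = "prod_mfd (gmfd H) (gmfd G)"
  note m = manifold_gmfd
  have K: "manifold ?K" by (rule manifold_prod_mfd[OF m])
  have M: "manifold ?M" by (rule manifold_prod_mfd[OF K manifold_GB])
  note p = smooth_map_fst[OF K manifold_GB] smooth_map_snd[OF K manifold_GB]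
  have "smooth_map ?M ?P (\<lambda>x. (snd (fst x) \<otimes>\<^bsub>G\<^esub> fst (snd x),
      hact (C (\<rho> (snd (snd x)) \<otimes>\<^bsub>G\<^esub> inv\<^bsub>G\<^esub> (fst (snd x)) \<otimes>\<^bsub>G\<^esub> inv\<^bsub>G\<^esub> (snd (fst x))) (inv\<^bsub>H\<^esub> (fst (fst x)))) (snd (snd x))))"
    by (intro smooth_map_on_Pair[OF M] smooth_ops[OF M] smooth_B_ops[OF M]
        smooth_map_on_fst[OF M m p(1)] smooth_map_on_snd[OF M m p(1)]
        smooth_map_on_fst[OF M m(2) B(2) p(2)] smooth_map_on_snd[OF M m(2) B(2) p(2)])
  then show ?thesis
    by (simp add: act1_def hact_def case_prod_beta')
qed

lemma lie_group_action_act1: "lie_group_action (cm_group H G C) (prod_mfd (gmfd G) (arrs B)) act1"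
  unfolding lie_group_action_def
proof (intro conjI ballI)
  show "lie_group (cm_group H G C)" by (rule lie_group_cm_group)
  show "manifold (prod_mfd (gmfd G) (arrs B))" by (rule manifold_GB)
  show "smooth_map (prod_mfd (gmfd (cm_group H G C)) (prod_mfd (gmfd G) (arrs B)))
     (prod_mfd (gmfd G) (arrs B)) (\<lambda>(k, x). act1 k x)"
    using smooth_act1 by simp
  fix x assume "x \<in> pts (prod_mfd (gmfd G) (arrs B))"
  then obtain k b where x: "x = (k, b)" "k \<in> carrier G" "b \<in> BB"
    by auto
  show "act1 \<one>\<^bsub>cm_group H G C\<^esub> x = x"
    using x by simp
  fix p2 p1 assume "p2 \<in> carrier (cm_group H G C)" "p1 \<in> carrier (cm_group H G C)"
  then obtain h2 g2 h1 g1 where p: "p2 = (h2, g2)" "p1 = (h1, g1)"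
    and c: "h2 \<in> carrier H" "g2 \<in> carrier G" "h1 \<in> carrier H" "g1 \<in> carrier G"
    by auto
  let ?g = "\<rho> b \<otimes>\<^bsub>G\<^esub> inv\<^bsub>G\<^esub> k \<otimes>\<^bsub>G\<^esub> inv\<^bsub>G\<^esub> g1"
  let ?b = "snd (act1 (h1, g1) (k, b))"
  have g: "?g \<in> carrier G" using x c by simp
  \<comment> \<open>The twist of the second move, taken at the moved arrow, is the first twist
    \<open>?g\<close> followed by d(h1)^-1 g2^-1.\<close>
  have "\<rho> ?b \<otimes>\<^bsub>G\<^esub> inv\<^bsub>G\<^esub> (g1 \<otimes>\<^bsub>G\<^esub> k) \<otimes>\<^bsub>G\<^esub> inv\<^bsub>G\<^esub> g2 = ?g \<otimes>\<^bsub>G\<^esub> (d (inv\<^bsub>H\<^esub> h1) \<otimes>\<^bsub>G\<^esub> inv\<^bsub>G\<^esub> g2)"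
    unfolding rho_act1[OF c(3,4) x(2,3)] using x c
    by (simp add: d_inv G.m_assoc G.inv_mult_group G.inv_mult_cancel)
  \<comment> \<open>The Peiffer identity \<open>C_d\<close> replaces the action of d(h1)^-1 by
    conjugation with h1^-1. Its trailing h1 then cancels against the h1^-1 of the first
    move.\<close>
  then have "C (\<rho> ?b \<otimes>\<^bsub>G\<^esub> inv\<^bsub>G\<^esub> (g1 \<otimes>\<^bsub>G\<^esub> k) \<otimes>\<^bsub>G\<^esub> inv\<^bsub>G\<^esub> g2) (inv\<^bsub>H\<^esub> h2)
      = C ?g (inv\<^bsub>H\<^esub> h1 \<otimes>\<^bsub>H\<^esub> C (inv\<^bsub>G\<^esub> g2) (inv\<^bsub>H\<^esub> h2) \<otimes>\<^bsub>H\<^esub> h1)"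
    using g c by (simp add: C_mult C_d)
  also have "\<dots> \<otimes>\<^bsub>H\<^esub> C ?g (inv\<^bsub>H\<^esub> h1) = C ?g (inv\<^bsub>H\<^esub> h1 \<otimes>\<^bsub>H\<^esub> C (inv\<^bsub>G\<^esub> g2) (inv\<^bsub>H\<^esub> h2))"
    using g c by (simp add: H.m_assoc flip: C_H_mult)
  \<comment> \<open>The inverse of h2 C_{g2}(h1) is C_{g2}(h1^-1) h2^-1, and the action of g2^-1
    takes this to h1^-1 C_{g2^-1}(h2^-1).\<close>
  also have "\<dots> = C (?g \<otimes>\<^bsub>G\<^esub> inv\<^bsub>G\<^esub> g2) (inv\<^bsub>H\<^esub> (h2 \<otimes>\<^bsub>H\<^esub> C g2 h1))"
    using g c by (simp add: C_mult[of ?g] H.inv_mult_group C_H_mult C_inv_cancel C_H_inv)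
  finally show "act1 (p2 \<otimes>\<^bsub>cm_group H G C\<^esub> p1) x = act1 p2 (act1 p1 x)"
    using x c g unfolding p x by (simp add: hact_hact G.m_assoc G.inv_mult_group)
qed

lemma lie_group_action_act0: "lie_group_action G (prod_mfd (gmfd G) (objs Y)) act0"
  unfolding lie_group_action_def
proof (intro conjI ballI)
  note mG = manifold_gmfd(2)
  note mY = lie_groupoidD(1)[OF lie_Y]
  let ?P = "prod_mfd (gmfd G) (objs Y)"
  show "lie_group G" by (rule lie_G)
  show "manifold ?P" by (rule manifold_GY)
  have M: "manifold (prod_mfd (gmfd G) ?P)" by (rule manifold_prod_mfd[OF mG manifold_GY])
  note p = smooth_map_fst[OF mG manifold_GY] smooth_map_snd[OF mG manifold_GY]
  have "smooth_map (prod_mfd (gmfd G) ?P) ?P (\<lambda>x. (fst x \<otimes>\<^bsub>G\<^esub> fst (snd x), snd (snd x)))"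
    by (intro smooth_map_on_Pair[OF M] smooth_ops[OF M] p(1)
        smooth_map_on_fst[OF M mG mY p(2)] smooth_map_on_snd[OF M mG mY p(2)])
  then show "smooth_map (prod_mfd (gmfd G) ?P) ?P (\<lambda>(k, x). act0 k x)"
    by (simp add: act0_def case_prod_beta')
qed (auto simp: G.m_assoc)

lemma lie_2group_action_gerbe_bundle: "lie_2group_action H G C d gerbe_bundle act1 act0"
  unfolding lie_2group_action_def
proof (intro conjI)
  show "lie_groupoid gerbe_bundle" by (rule lie_groupoid_gerbe_bundle)
  show "lie_group_action (cm_group H G C) (arrs gerbe_bundle) act1" "lie_group_action G (objs gerbe_bundle) act0"
    using lie_group_action_act1 lie_group_action_act0 by simp_all
  show "lie_groupoid_morphism (prod_groupoid (cm_groupoid H G d) gerbe_bundle) gerbe_bundle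
     (\<lambda>(k, a). act1 k a) (\<lambda>(g, y). act0 g y)"
    unfolding lie_groupoid_morphism_def
  proof (intro conjI ballI)
    show "smooth_map (arrs (prod_groupoid (cm_groupoid H G d) gerbe_bundle)) (arrs gerbe_bundle) (\<lambda>(k, a). act1 k a)"
      using smooth_act1 by (simp add: prod_groupoid_def cm_groupoid_def)
    show "smooth_map (objs (prod_groupoid (cm_groupoid H G d) gerbe_bundle)) (objs gerbe_bundle) (\<lambda>(g, y). act0 g y)"
      using lie_group_action_act0 unfolding lie_group_action_def by (simp add: prod_groupoid_def cm_groupoid_def)
  next
    fix a assume "a \<in> pts (arrs (prod_groupoid (cm_groupoid H G d) gerbe_bundle))"
    then obtain h g k b where a: "a = ((h, g), (k, b))"
      and c: "h \<in> carrier H" "g \<in> carrier G" "k \<in> carrier G" "b \<in> BB"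
      by (auto simp: prod_groupoid_def cm_groupoid_def)
    show "source gerbe_bundle ((\<lambda>(k, a). act1 k a) a) =
        (\<lambda>(g, y). act0 g y) (source (prod_groupoid (cm_groupoid H G d) gerbe_bundle) a)"
      unfolding a using c by (simp add: prod_groupoid_def cm_groupoid_def)
    show "target gerbe_bundle ((\<lambda>(k, a). act1 k a) a) =
        (\<lambda>(g, y). act0 g y) (target (prod_groupoid (cm_groupoid H G d) gerbe_bundle) a)"
      unfolding a using c
      by (simp add: prod_groupoid_def cm_groupoid_def d_C d_inv G.m_assoc G.inv_mult_group G.inv_mult_cancel)
  next
    fix c assume "c \<in> composable (prod_groupoid (cm_groupoid H G d) gerbe_bundle)"
    then obtain h2 g2 h1 g1 a2 a1 where c: "c = (((h2, g2), a2), ((h1, g1), a1))"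
      "(a2, a1) \<in> composable gerbe_bundle"
      and h: "h2 \<in> carrier H" "h1 \<in> carrier H" "g1 \<in> carrier G" "g2 = d h1 \<otimes>\<^bsub>G\<^esub> g1"
      by (auto simp: composable_def prod_groupoid_def cm_groupoid_def)
    obtain k b2 b1 where a: "a1 = (k, b1)" "a2 = (k \<otimes>\<^bsub>G\<^esub> inv\<^bsub>G\<^esub> (\<rho> b1), b2)" "k \<in> carrier G"
      and b: "(b2, b1) \<in> composable B"
      using c(2) by (rule composable_gerbe_bundleE)
    have bb: "b2 \<in> BB" "b1 \<in> BB" using b by (auto simp: composable_B)
    \<comment> \<open>\<open>?g\<close> is the twist for the composite arrow, \<open>?g1\<close> and
      \<open>?g2\<close> are the twists for the two factors.\<close>
    let ?g = "\<rho> b2 \<otimes>\<^bsub>G\<^esub> (\<rho> b1 \<otimes>\<^bsub>G\<^esub> (inv\<^bsub>G\<^esub> k \<otimes>\<^bsub>G\<^esub> inv\<^bsub>G\<^esub> g1))"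
    let ?g1 = "\<rho> b1 \<otimes>\<^bsub>G\<^esub> inv\<^bsub>G\<^esub> k \<otimes>\<^bsub>G\<^esub> inv\<^bsub>G\<^esub> g1"
    let ?g2 = "\<rho> b2 \<otimes>\<^bsub>G\<^esub> inv\<^bsub>G\<^esub> (k \<otimes>\<^bsub>G\<^esub> inv\<^bsub>G\<^esub> (\<rho> b1)) \<otimes>\<^bsub>G\<^esub> inv\<^bsub>G\<^esub> g2"
    have g: "?g \<in> carrier G" "?g1 \<in> carrier G" "?g2 \<in> carrier G" using a(3) bb h by simp_all
    \<comment> \<open>Since \<open>g2\<close> is d(h1)g1 and the later arrow carries k\<rho>(b1)^-1,
      its twist differs from \<open>?g\<close> only by d(h1)^-1 on the right.\<close>
    have g2: "?g2 = ?g \<otimes>\<^bsub>G\<^esub> d (inv\<^bsub>H\<^esub> h1)"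
      using a(3) bb h by (simp add: d_inv G.m_assoc G.inv_mult_group)
    have g1: "\<rho> b2 \<otimes>\<^bsub>G\<^esub> ?g1 = ?g"
      using a(3) bb h by (simp add: G.m_assoc)
    \<comment> \<open>Equivariance of the composition of \<open>B\<close> contributes the outer
      \<open>C (\<rho> b2)\<close>, which completes \<open>?g1\<close> to \<open>?g\<close>. On the
      other factor \<open>C_d\<close> conjugates by h1^-1, and h1^-1 h2^-1 h1 h1^-1 = (h2 h1)^-1
      belongs to the composite arrow of the 2-group.\<close>
    have "C ?g2 (inv\<^bsub>H\<^esub> h2) \<otimes>\<^bsub>H\<^esub> C (\<rho> b2) (C ?g1 (inv\<^bsub>H\<^esub> h1))
        = C ?g (inv\<^bsub>H\<^esub> h1 \<otimes>\<^bsub>H\<^esub> inv\<^bsub>H\<^esub> h2 \<otimes>\<^bsub>H\<^esub> h1) \<otimes>\<^bsub>H\<^esub> C ?g (inv\<^bsub>H\<^esub> h1)"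
      using g(1) bb h unfolding g2
      by (simp only: C_mult[symmetric, OF rho_closed[OF bb(1)] g(2) H.inv_closed[OF h(2)]] g1)
        (simp add: C_mult C_d)
    also have "\<dots> = C ?g (inv\<^bsub>H\<^esub> (h2 \<otimes>\<^bsub>H\<^esub> h1))"
      using g(1) h by (simp add: H.m_assoc H.inv_mult_group flip: C_H_mult)
    finally have eq: "C ?g2 (inv\<^bsub>H\<^esub> h2) \<otimes>\<^bsub>H\<^esub> C (\<rho> b2) (C ?g1 (inv\<^bsub>H\<^esub> h1)) = C ?g (inv\<^bsub>H\<^esub> (h2 \<otimes>\<^bsub>H\<^esub> h1))" .
    have "comp_arr B (hact (C ?g2 (inv\<^bsub>H\<^esub> h2)) b2) (hact (C ?g1 (inv\<^bsub>H\<^esub> h1)) b1)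
        = hact (C ?g (inv\<^bsub>H\<^esub> (h2 \<otimes>\<^bsub>H\<^esub> h1))) (comp_arr B b2 b1)"
      unfolding eq[symmetric] by (rule comp_hact[OF b]) (use g h in simp_all)
    moreover have "\<rho> (comp_arr B b2 b1) \<otimes>\<^bsub>G\<^esub> inv\<^bsub>G\<^esub> k \<otimes>\<^bsub>G\<^esub> inv\<^bsub>G\<^esub> g1 = ?g"
      using a(3) bb h by (simp add: rho_comp[OF b] G.m_assoc)
    ultimately show "case c of (a2, a1) \<Rightarrow>
        (\<lambda>(k, a). act1 k a) (comp_arr (prod_groupoid (cm_groupoid H G d) gerbe_bundle) a2 a1) =
        comp_arr gerbe_bundle ((\<lambda>(k, a). act1 k a) a2) ((\<lambda>(k, a). act1 k a) a1)"
      unfolding c(1) a(1,2) by (simp add: prod_groupoid_def cm_groupoid_def)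
  qed
qed

section \<open>Freeness and properness\<close>

lemma free_act1: "free_group_action (cm_group H G C) (prod_mfd (gmfd G) (arrs B)) act1"
  unfolding free_group_action_def
proof (intro ballI impI)
  fix p x assume "p \<in> carrier (cm_group H G C)" "x \<in> pts (prod_mfd (gmfd G) (arrs B))"
    and fixed: "act1 p x = x"
  then obtain h g k b where px: "p = (h, g)" "x = (k, b)"
    and c: "h \<in> carrier H" "g \<in> carrier G" "k \<in> carrier G" "b \<in> BB"
    by auto
  have "g \<otimes>\<^bsub>G\<^esub> k = k" and hb: "hact (C (\<rho> b \<otimes>\<^bsub>G\<^esub> inv\<^bsub>G\<^esub> k \<otimes>\<^bsub>G\<^esub> inv\<^bsub>G\<^esub> g) (inv\<^bsub>H\<^esub> h)) b = b"
    using fixed unfolding px by simp_all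
  then have "g = \<one>\<^bsub>G\<^esub>"
    using c by simp
  moreover have "inv\<^bsub>H\<^esub> h = \<one>\<^bsub>H\<^esub>"
    using C_eq_one[OF _ _ hact_free[OF c(4) _ hb]] c by simp
  then have "h = \<one>\<^bsub>H\<^esub>"
    using c by simp
  ultimately show "p = \<one>\<^bsub>cm_group H G C\<^esub>"
    by (simp add: px)
qed

lemma free_act0: "free_group_action G (prod_mfd (gmfd G) (objs Y)) act0"
  unfolding free_group_action_def by auto

lemma proper_act0: "proper_group_action G (prod_mfd (gmfd G) (objs Y)) act0"
proof -
  let ?G = "mtop (gmfd G)" and ?Y = "mtop (objs Y)"
  let ?X = "prod_topology ?G (prod_topology ?G ?Y)" and ?Z = "prod_topology (prod_topology ?G ?G) ?Y"
  note mG = manifold_gmfd(2)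
  note mY = lie_groupoidD(1)[OF lie_Y]
  let ?\<Phi> = "\<lambda>x. ((fst x \<otimes>\<^bsub>G\<^esub> fst (snd x), fst (snd x)), snd (snd x))"
  let ?\<Psi> = "\<lambda>z. (fst (fst z) \<otimes>\<^bsub>G\<^esub> inv\<^bsub>G\<^esub> (snd (fst z)), (snd (fst z), snd z))"
  let ?MX = "prod_mfd (gmfd G) (prod_mfd (gmfd G) (objs Y))" and ?MZ = "prod_mfd (prod_mfd (gmfd G) (gmfd G)) (objs Y)"
  have GG: "manifold (prod_mfd (gmfd G) (gmfd G))" by (rule manifold_prod_mfd[OF mG mG])
  have X: "manifold ?MX" by (rule manifold_prod_mfd[OF mG manifold_GY])
  have Z: "manifold ?MZ" by (rule manifold_prod_mfd[OF GG mY])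
  note px = smooth_map_fst[OF mG manifold_GY] smooth_map_snd[OF mG manifold_GY]
  note pz = smooth_map_fst[OF GG mY] smooth_map_snd[OF GG mY]
  have s\<Phi>: "smooth_map ?MX ?MZ ?\<Phi>"
    by (intro smooth_map_on_Pair[OF X] smooth_ops[OF X] px(1)
        smooth_map_on_fst[OF X mG mY px(2)] smooth_map_on_snd[OF X mG mY px(2)])
  have s\<Psi>: "smooth_map ?MZ ?MX ?\<Psi>"
    by (intro smooth_map_on_Pair[OF Z] smooth_ops[OF Z] pz(2)
        smooth_map_on_fst[OF Z mG mG pz(1)] smooth_map_on_snd[OF Z mG mG pz(1)])
  have "homeomorphic_maps ?X ?Z ?\<Phi> ?\<Psi>"
    unfolding homeomorphic_maps_def
    using smooth_map_continuous[OF s\<Phi>] smooth_map_continuous[OF s\<Psi>] by (auto simp: G.m_assoc)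
  then have \<Phi>: "proper_map ?X ?Z ?\<Phi>"
    using homeomorphic_imp_proper_map homeomorphic_map_maps by blast
  \<comment> \<open>The action on objects fixes \<open>y\<close>, so what remains of the shear map
    is the diagonal, which is proper because the manifold of objects is Hausdorff.\<close>
  have "proper_map ?Y (prod_topology ?Y ?Y) (\<lambda>y. (y, y))"
    using proper_map_paired[of ?Y ?Y "\<lambda>y. y" ?Y "\<lambda>y. y"] manifoldD(1)[OF mY] proper_map_id[of ?Y] by (simp add: id_def)
  then have "proper_map ?Z (prod_topology (prod_topology ?G ?G) (prod_topology ?Y ?Y)) (\<lambda>(a, y). (a, (y, y)))"
    using proper_map_id[of "prod_topology ?G ?G"] by (simp add: proper_map_prod id_def)
  from proper_map_compose[OF proper_map_compose[OF \<Phi> this] homeomorphic_imp_proper_map[OF homeomorphic_map_interchange]]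
  show ?thesis
    unfolding proper_group_action_def by (simp add: act0_def case_prod_beta' o_def)
qed

lemma proper_act1: "proper_group_action (cm_group H G C) (prod_mfd (gmfd G) (arrs B)) act1"
proof -
  let ?G = "mtop (gmfd G)" and ?H = "mtop (gmfd H)" and ?B = "mtop (arrs B)"
  let ?A = "action_domain (cm_groupoid H G d) (arrs B) \<rho>"
  let ?T = "subtopology (prod_topology (prod_topology ?H ?G) ?B) ?A"
  let ?X = "prod_topology (prod_topology ?H ?G) (prod_topology ?G ?B)" 
  let ?W = "prod_topology (prod_topology ?G ?G) (prod_topology (prod_topology ?H ?G) ?B)"
  let ?Z = "prod_topology (prod_topology ?G ?G) ?T"
  note m = manifold_gmfd
  let ?h = "\<lambda>x. C (\<rho> (snd (snd x)) \<otimes>\<^bsub>G\<^esub> inv\<^bsub>G\<^esub> (fst (snd x)) \<otimes>\<^bsub>G\<^esub> inv\<^bsub>G\<^esub> (snd (fst x))) (inv\<^bsub>H\<^esub> (fst (fst x)))"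
  let ?\<Phi> = "\<lambda>x. ((snd (fst x) \<otimes>\<^bsub>G\<^esub> fst (snd x), fst (snd x)), ((?h x, \<rho> (snd (snd x))), snd (snd x)))"
  \<comment> \<open>This recovers the group element from ((a, k), ((h', r), b)): a = gk gives g =
    ak^-1, and h' = C_x h^-1 with x^-1 = a\<rho>(b)^-1 gives h. The formula is smooth on the whole
    product; the condition r = \<rho>(b) of the action domain enters in
    \<open>?\<Phi> (?\<Psi> z) = z\<close>.\<close>
  let ?\<Psi> = "\<lambda>z. ((inv\<^bsub>H\<^esub> (C (fst (fst z) \<otimes>\<^bsub>G\<^esub> inv\<^bsub>G\<^esub> (\<rho> (snd (snd z)))) (fst (fst (snd z)))), fst (fst z) \<otimes>\<^bsub>G\<^esub> inv\<^bsub>G\<^esub> (snd (fst z))),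
    (snd (fst z), snd (snd z)))"
  let ?HG = "prod_mfd (gmfd H) (gmfd G)" and ?GG = "prod_mfd (gmfd G) (gmfd G)"
  let ?MX = "prod_mfd ?HG (prod_mfd (gmfd G) (arrs B))" and ?MZ = "prod_mfd ?GG (prod_mfd ?HG (arrs B))"
  have HG: "manifold ?HG" and GG: "manifold ?GG" 
    by (rule manifold_prod_mfd[OF m] manifold_prod_mfd[OF m(2) m(2)])+
  have X: "manifold ?MX" by (rule manifold_prod_mfd[OF HG manifold_GB])
  have HGB: "manifold (prod_mfd ?HG (arrs B))" by (rule manifold_prod_mfd[OF HG B(2)])
  have Z: "manifold ?MZ" by (rule manifold_prod_mfd[OF GG HGB])
  note px = smooth_map_fst[OF HG manifold_GB] smooth_map_snd[OF HG manifold_GB]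
  note pz = smooth_map_fst[OF GG HGB] smooth_map_snd[OF GG HGB]
  note pz2 = smooth_map_on_fst[OF Z HG B(2) pz(2)]
  have s\<Phi>: "smooth_map ?MX ?MZ ?\<Phi>"
    by (intro smooth_map_on_Pair[OF X] smooth_ops[OF X] smooth_B_ops[OF X]
        smooth_map_on_fst[OF X m px(1)] smooth_map_on_snd[OF X m px(1)]
        smooth_map_on_fst[OF X m(2) B(2) px(2)] smooth_map_on_snd[OF X m(2) B(2) px(2)])
  have "continuous_map ?X ?W ?\<Phi>"
    using smooth_map_continuous[OF s\<Phi>] by simp
  \<comment> \<open>The shear map of the groupoid action is proper on the action domain with its
    subspace topology, so continuity into the ambient product has to be cut down to that
    subspace.\<close>
  then have "continuous_map ?X (subtopology ?W (topspace (prod_topology ?G ?G) \<times> ?A)) ?\<Phi>"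
    by (rule continuous_map_into_subtopology) (auto simp: action_domain_eq)
  then have c\<Phi>: "continuous_map ?X ?Z ?\<Phi>"
    by (simp only: prod_topology_subtopology(2))
  have s\<Psi>: "smooth_map ?MZ ?MX ?\<Psi>"
    by (intro smooth_map_on_Pair[OF Z] smooth_ops[OF Z] smooth_B_ops[OF Z]
        smooth_map_on_fst[OF Z m(2) m(2) pz(1)] smooth_map_on_snd[OF Z m(2) m(2) pz(1)]
        smooth_map_on_fst[OF Z m pz2] smooth_map_on_snd[OF Z HG B(2) pz(2)])
  have "continuous_map ?W ?X ?\<Psi>"
    using smooth_map_continuous[OF s\<Psi>] by simp
  then have c\<Psi>: "continuous_map ?Z ?X ?\<Psi>"
    unfolding prod_topology_subtopology(2) by (rule continuous_map_from_subtopology)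
  have "?\<Psi> (?\<Phi> x) = x" if "x \<in> topspace ?X" for x
    using that by (auto simp: G.m_assoc G.inv_mult_group G.inv_mult_cancel simp flip: C_mult)
  moreover have "?\<Phi> (?\<Psi> z) = z" if "z \<in> topspace ?Z" for z
    using that by (auto simp: action_domain_eq G.m_assoc G.inv_mult_group G.inv_mult_cancel simp flip: C_mult)
  ultimately have "homeomorphic_maps ?X ?Z ?\<Phi> ?\<Psi>"
    unfolding homeomorphic_maps_def using c\<Phi> c\<Psi> by blast
  then have \<Phi>: "proper_map ?X ?Z ?\<Phi>"
    using homeomorphic_imp_proper_map homeomorphic_map_maps by blast
  have "proper_map ?T (prod_topology ?B ?B) (\<lambda>(\<gamma>, b). (star \<gamma> b, b))"
    using principal_pr unfolding principal_groupoid_bundle_def by (simp add: cm_groupoid_def)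
  then have "proper_map ?Z (prod_topology (prod_topology ?G ?G) (prod_topology ?B ?B))
      (\<lambda>(a, y). (a, (\<lambda>(\<gamma>, b). (star \<gamma> b, b)) y))"
    using proper_map_id[of "prod_topology ?G ?G"] by (simp add: proper_map_prod id_def)
  from proper_map_compose[OF proper_map_compose[OF \<Phi> this] homeomorphic_imp_proper_map[OF homeomorphic_map_interchange]]
  show ?thesis
    unfolding proper_group_action_def by (simp add: act1_def case_prod_beta' o_def)
qed

section \<open>Orbits and the quotient groupoid\<close>

lemma orbit_act1:
  assumes "k \<in> carrier G" "b \<in> BB"
  shows "group_orbit (cm_group H G C) act1 (k, b) = carrier G \<times> {b' \<in> BB. pr b' = pr b}"
proof (intro equalityI subsetI)
  fix x assume "x \<in> group_orbit (cm_group H G C) act1 (k, b)"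
  then show "x \<in> carrier G \<times> {b' \<in> BB. pr b' = pr b}"
    using assms by (auto simp: group_orbit_def)
next
  fix x assume "x \<in> carrier G \<times> {b' \<in> BB. pr b' = pr b}"
  then obtain k' b' where x: "x = (k', b')" "k' \<in> carrier G" "b' \<in> BB" "pr b = pr b'"
    by auto
  obtain h where h: "h \<in> carrier H" "b' = hact h b"
    using hact_transitive[OF assms(2) x(3,4)] .
  \<comment> \<open>Left translation by \<open>?g\<close> takes \<open>k\<close> to
    \<open>k'\<close>. The twist is then \<open>?a\<close>, and the element of \<open>H\<close>
    below is chosen so that \<open>C ?a\<close> sends its inverse to \<open>h\<close>.\<close>
  let ?g = "k' \<otimes>\<^bsub>G\<^esub> inv\<^bsub>G\<^esub> k"
  let ?a = "\<rho> b \<otimes>\<^bsub>G\<^esub> inv\<^bsub>G\<^esub> k \<otimes>\<^bsub>G\<^esub> inv\<^bsub>G\<^esub> ?g"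
  have "x = act1 (inv\<^bsub>H\<^esub> (C (inv\<^bsub>G\<^esub> ?a) h), ?g) (k, b)"
    using assms x h by (simp add: G.m_assoc C_inv_cancel del: G.inv_mult_group)
  moreover have "(inv\<^bsub>H\<^esub> (C (inv\<^bsub>G\<^esub> ?a) h), ?g) \<in> carrier (cm_group H G C)"
    using assms x h by simp
  ultimately show "x \<in> group_orbit (cm_group H G C) act1 (k, b)"
    unfolding group_orbit_def by blast
qed

lemma orbit_act0:
  assumes "k \<in> carrier G"
  shows "group_orbit G act0 (k, y) = carrier G \<times> {y}"
proof -
  have "\<exists>g. k' = g \<otimes>\<^bsub>G\<^esub> k \<and> g \<in> carrier G" if "k' \<in> carrier G" for k'
    using assms that by (intro exI[of _ "k' \<otimes>\<^bsub>G\<^esub> inv\<^bsub>G\<^esub> k"]) (simp add: G.m_assoc)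
  then show ?thesis
    using assms unfolding group_orbit_def by auto
qed

lemma principal_gerbe_bundle:
  "principal_bundle_groupoid H G C d gerbe_bundle act1 act0 Y (\<lambda>(k, b). pr b) (\<lambda>(k, y). y)"
  unfolding principal_bundle_groupoid_def
proof (intro conjI quotient_groupoid_of_submersion)
  show "lie_2group_action H G C d gerbe_bundle act1 act0" by (rule lie_2group_action_gerbe_bundle)
  show "free_group_action (cm_group H G C) (arrs gerbe_bundle) act1" "free_group_action G (objs gerbe_bundle) act0"
    "proper_group_action (cm_group H G C) (arrs gerbe_bundle) act1" "proper_group_action G (objs gerbe_bundle) act0"
    using free_act1 free_act0 proper_act1 proper_act0 by simp_all
  show "lie_groupoid gerbe_bundle" by (rule lie_groupoid_gerbe_bundle)
  show "lie_groupoid Y" by (rule lie_Y)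
  note mG = manifold_gmfd(2)
  note mY = lie_groupoidD(1)[OF lie_Y]
  \<comment> \<open>The projection that forgets the group component is onto because \<open>G\<close>
    contains its unit.\<close>
  have ne: "pts (gmfd G) \<noteq> {}"
    using G.one_closed by auto
  show p1: "surjective_submersion (arrs gerbe_bundle) (arrs Y) (\<lambda>(k, b). pr b)"
    using surjective_submersion_compose[OF manifold_GB B(2) lie_groupoidD(2)[OF lie_Y]
        surjective_submersion_snd[OF mG B(2) ne] sub_pr] by (simp add: case_prod_beta')
  show p0: "surjective_submersion (objs gerbe_bundle) (objs Y) (\<lambda>(k, y). y)"
    using surjective_submersion_snd[OF mG mY ne] by (simp add: case_prod_beta')
  show "lie_groupoid_morphism gerbe_bundle Y (\<lambda>(k, b). pr b) (\<lambda>(k, y). y)"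
    unfolding lie_groupoid_morphism_def
    using surjective_submersion_smooth[OF p1] surjective_submersion_smooth[OF p0]
    by (auto elim!: composable_gerbe_bundleE simp: pr_comp)
  show "group_orbit (cm_group H G C) act1 a = group_orbit (cm_group H G C) act1 a' \<longleftrightarrow>
      (\<lambda>(k, b). pr b) a = (\<lambda>(k, b). pr b) a'"
    if "a \<in> pts (arrs gerbe_bundle)" "a' \<in> pts (arrs gerbe_bundle)" for a a'
    \<comment> \<open>As \<open>G\<close> is nonempty, equal products have equal second factors, and
      each arrow lies in its own fibre of \<open>pr\<close>.\<close>
    using that G.one_closed by (auto simp: orbit_act1 times_eq_iff)
  show "group_orbit G act0 a = group_orbit G act0 a' \<longleftrightarrow> (\<lambda>(k, y). y) a = (\<lambda>(k, y). y) a'"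
    if "a \<in> pts (objs gerbe_bundle)" "a' \<in> pts (objs gerbe_bundle)" for a a'
    using that G.one_closed by (auto simp: orbit_act0 times_eq_iff)
qed

end

theorem proposition2p11:
  fixes H :: "('h, 'eh::euclidean_space) lie_grp"
    and G :: "('g, 'eg::euclidean_space) lie_grp"
    and C :: "'g \<Rightarrow> 'h \<Rightarrow> 'h"
    and d :: "'h \<Rightarrow> 'g"
    and Y :: "('y, 'z, 'ey::euclidean_space, 'ez::euclidean_space) grpd"
    and B :: "('y, 'b, 'ey, 'eb::euclidean_space) grpd"
    and pr :: "'b \<Rightarrow> 'z"
    and \<rho> :: "'b \<Rightarrow> 'g"
    and star :: "'h \<times> 'g \<Rightarrow> 'b \<Rightarrow> 'b"
  assumes "crossed_module H G C d"
    and "lie_groupoid Y"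
    and "bundle_gerbe H G C d Y B pr \<rho> star"
  shows "trivial_base_principal_bundle_groupoid H G C d
    \<lparr> objs = prod_mfd (gmfd G) (objs Y),
      arrs = prod_mfd (gmfd G) (arrs B),
      source = (\<lambda>(k, b). (k, source Y (pr b))),
      target = (\<lambda>(k, b). (k \<otimes>\<^bsub>G\<^esub> inv\<^bsub>G\<^esub> (\<rho> b), target Y (pr b))),
      comp_arr = (\<lambda>(k2, b2) (k1, b1). (k1, comp_arr B b2 b1)),
      unit_arr = (\<lambda>(g, y). (g, unit_arr B y)),
      inv_arr = (\<lambda>(g, b). (g \<otimes>\<^bsub>G\<^esub> inv\<^bsub>G\<^esub> (\<rho> b), inv_arr B b)) \<rparr>
    (\<lambda>(h, g) (k, b).
       (g \<otimes>\<^bsub>G\<^esub> k, star (C (\<rho> b \<otimes>\<^bsub>G\<^esub> inv\<^bsub>G\<^esub> k \<otimes>\<^bsub>G\<^esub> inv\<^bsub>G\<^esub> g) (inv\<^bsub>H\<^esub> h), \<rho> b) b))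
    (\<lambda>g (k, y). (g \<otimes>\<^bsub>G\<^esub> k, y))
    Y
    (\<lambda>(k, b). pr b)
    (\<lambda>(k, y). y)"
proof -
  interpret gerbe H G C d Y B pr \<rho> star
    using assms by unfold_locales
  show ?thesis
    using principal_gerbe_bundle
    unfolding trivial_base_principal_bundle_groupoid_def gerbe_bundle_def act1_def act0_def by simp
qed

end
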